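(* Let $\mu$ be a non-negative Radon measure on $\mathbb{R}$ satisfying the Brinck condition, and let $\mathbf{H}_\mu$ be the operator associated with the form $\mathbf{a}_\mu$. Assume that the negative part of the spectrum of $\mathbf{H}_\mu$ is discrete, and let $\{\lambda_\nu\}$ be the negative eigenvalues of $\mathbf{H}_\mu$. Then $$\frac{\alpha}{32}\,\mu(\mathbb{R})\ \le\ \sum_{\nu}|\lambda_\nu|^{1/2}\ \le\ \frac12\,\mu(\mathbb{R}),\qquad \alpha=\left(\pi^2+\tfrac34\right)^{-1},$$ in the sense that all the occurring terms are either simultaneously finite (and satisfy the inequalities) or simultaneously infinite.
   Context: A Radon measure here is a positive Borel measure on $\mathbb{R}$, finite on compact sets (and regular). The Brinck condition: there is $C>0$ with $\mu([x,x+1])<C$ for all $x\in\mathbb{R}$. The form is $\mathbf{a}_\mu(f,g)=\int_{\mathbb{R}}f'\overline{g'}\,dx-\int_{\mathbb{R}}f\overline{g}\,d\mu$ on $\{f\in H^1(\mathbb{R}):\int|f|^2d\mu<\infty\}$; under the Brinck condition it is densely defined, symmetric, lower semibounded and closed in $L^2(\mathbb{R})$, and $\mathbf{H}_\mu$ is the self-adjoint operator associated with it. The negative spectrum is discrete if the spectrum in $(-\infty,0)$ consists of isolated eigenvalues of finite multiplicity; eigenvalues are counted with multiplicity and there may be finitely or infinitely many. *)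

theory Defs
  imports "HOL-Analysis.Analysis" "HOL-Library.Function_Algebras"
begin

subsection \<open>Measures\<close>

definition radon_measure :: "real measure \<Rightarrow> bool" where
  "radon_measure \<mu> \<longleftrightarrow>
     sets \<mu> = sets borel \<and>
     (\<forall>K. compact K \<longrightarrow> emeasure \<mu> K < \<infinity>) \<and>
     (\<forall>B\<in>sets borel. emeasure \<mu> B = (SUP K\<in>{K. K \<subseteq> B \<and> compact K}. emeasure \<mu> K)) \<and>
     (\<forall>B\<in>sets borel. emeasure \<mu> B = (INF U\<in>{U. B \<subseteq> U \<and> open U}. emeasure \<mu> U))"

definition brinck :: "real measure \<Rightarrow> bool" where
  "brinck \<mu> \<longleftrightarrow> (\<exists>C::real. C > 0 \<and> (\<forall>x. emeasure \<mu> {x..x+1} < ennreal C))"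


subsection \<open>The spaces \<open>L\<^sup>2(\<real>)\<close> and \<open>H\<^sup>1(\<real>)\<close>\<close>

text \<open>Elements of \<open>L\<^sup>2(\<real>)\<close> are represented by Borel functions; two functions represent
  the same element iff they agree almost everywhere.\<close>

definition L2 :: "(real \<Rightarrow> complex) set" where
  "L2 = {f. f \<in> borel_measurable lborel \<and> integrable lborel (\<lambda>x. (cmod (f x))\<^sup>2)}"

definition L2_inner :: "(real \<Rightarrow> complex) \<Rightarrow> (real \<Rightarrow> complex) \<Rightarrow> complex" where
  "L2_inner f g = (LINT x|lborel. f x * cnj (g x))"

definition L2_norm :: "(real \<Rightarrow> complex) \<Rightarrow> real" where
  "L2_norm f = sqrt (LINT x|lborel. (cmod (f x))\<^sup>2)"

text \<open>\<open>g \<in> L\<^sup>2\<close> is a weak derivative of \<open>f\<close>, with test functions in \<open>C\<^sup>1\<close> with compact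
  support. (Testing only with \<open>C\<^sup>\<infinity>\<close> functions of compact support would give the same notion.)\<close>

definition weak_L2_deriv :: "(real \<Rightarrow> complex) \<Rightarrow> (real \<Rightarrow> complex) \<Rightarrow> bool" where
  "weak_L2_deriv f g \<longleftrightarrow> g \<in> L2 \<and>
     (\<forall>\<phi>::real \<Rightarrow> real. \<phi> C1_differentiable_on UNIV \<and> compact (closure {x. \<phi> x \<noteq> 0}) \<longrightarrow>
        (LINT x|lborel. deriv \<phi> x *\<^sub>R f x) = - (LINT x|lborel. \<phi> x *\<^sub>R g x))"

text \<open>Each class in \<open>H\<^sup>1(\<real>)\<close> has exactly one continuous representative, and \<open>H1\<close> is the set of
  these. This is the representative that has to be integrated against \<open>\<mu>\<close> (which may charge
  Lebesgue null sets), and on \<open>H1\<close> equality in \<open>L\<^sup>2\<close> is equality of functions.\<close>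

definition H1 :: "(real \<Rightarrow> complex) set" where
  "H1 = {f. continuous_on UNIV f \<and> f \<in> L2 \<and> (\<exists>g. weak_L2_deriv f g)}"

text \<open>Determined only up to Lebesgue null sets; it is used only under Lebesgue integrals.\<close>

definition H1_deriv :: "(real \<Rightarrow> complex) \<Rightarrow> real \<Rightarrow> complex" where
  "H1_deriv f = (SOME g. weak_L2_deriv f g)"


subsection \<open>The form and the associated operator\<close>

definition form_dom :: "real measure \<Rightarrow> (real \<Rightarrow> complex) set" where
  "form_dom \<mu> = {f \<in> H1. integrable \<mu> (\<lambda>x. (cmod (f x))\<^sup>2)}"

definition form :: "real measure \<Rightarrow> (real \<Rightarrow> complex) \<Rightarrow> (real \<Rightarrow> complex) \<Rightarrow> complex" where
  "form \<mu> f g = (LINT x|lborel. H1_deriv f x * cnj (H1_deriv g x)) - (LINT x|\<mu>. f x * cnj (g x))"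

text \<open>An operator in \<open>L\<^sup>2(\<real>)\<close> is given by its graph. Below, the first component of a pair in
  the graph is a continuous representative, while the second may be replaced by any Borel
  function that agrees with it almost everywhere. The operator associated with a densely
  defined, closed, lower semibounded symmetric form \<open>a\<close> with domain \<open>D\<close> (first
  representation theorem) maps \<open>f \<in> D\<close> to \<open>h\<close> iff \<open>a f g = \<langle>h, g\<rangle>\<close> for all \<open>g \<in> D\<close>.\<close>

definition form_operator ::
  "(real \<Rightarrow> complex) set \<Rightarrow> ((real \<Rightarrow> complex) \<Rightarrow> (real \<Rightarrow> complex) \<Rightarrow> complex)
    \<Rightarrow> ((real \<Rightarrow> complex) \<times> (real \<Rightarrow> complex)) set" where
  "form_operator D a = {(f, h). f \<in> D \<and> h \<in> L2 \<and> (\<forall>g\<in>D. a f g = L2_inner h g)}"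

definition H_op :: "real measure \<Rightarrow> ((real \<Rightarrow> complex) \<times> (real \<Rightarrow> complex)) set" where
  "H_op \<mu> = form_operator (form_dom \<mu>) (form \<mu>)"


subsection \<open>Spectrum and eigenvalues\<close>

text \<open>For \<open>T\<close> the graph of an operator, \<open>(f, h + z f) \<in> T\<close> says \<open>(T - z) f = h\<close>. So \<open>z\<close> is in the
  resolvent set iff \<open>T - z\<close> maps the domain of \<open>T\<close> bijectively onto \<open>L\<^sup>2\<close> with bounded inverse.\<close>

definition resolvent_set :: "((real \<Rightarrow> complex) \<times> (real \<Rightarrow> complex)) set \<Rightarrow> complex set" where
  "resolvent_set T = {z.
     (\<forall>h\<in>L2. \<exists>!f. (f, \<lambda>x. h x + z * f x) \<in> T) \<and>
     (\<exists>C. \<forall>h\<in>L2. \<forall>f. (f, \<lambda>x. h x + z * f x) \<in> T \<longrightarrow> L2_norm f \<le> C * L2_norm h)}"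

definition op_spectrum :: "((real \<Rightarrow> complex) \<times> (real \<Rightarrow> complex)) set \<Rightarrow> complex set" where
  "op_spectrum T = - resolvent_set T"

definition eigenspace ::
  "((real \<Rightarrow> complex) \<times> (real \<Rightarrow> complex)) set \<Rightarrow> complex \<Rightarrow> (real \<Rightarrow> complex) set" where
  "eigenspace T z = {f. (f, \<lambda>x. z * f x) \<in> T}"

definition is_eigenvalue :: "((real \<Rightarrow> complex) \<times> (real \<Rightarrow> complex)) set \<Rightarrow> complex \<Rightarrow> bool" where
  "is_eigenvalue T z \<longleftrightarrow> (\<exists>f\<in>eigenspace T z. f \<noteq> (\<lambda>x. 0))"

global_interpretation cfun: vector_space "\<lambda>(c::complex) (f::real \<Rightarrow> complex) x. c * f x"
  by unfold_locales (auto simp: fun_eq_iff algebra_simps)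

definition finite_multiplicity ::
  "((real \<Rightarrow> complex) \<times> (real \<Rightarrow> complex)) set \<Rightarrow> complex \<Rightarrow> bool" where
  "finite_multiplicity T z \<longleftrightarrow> (\<exists>B. finite B \<and> eigenspace T z \<subseteq> cfun.span B)"

text \<open>Meaningful only in case of \<open>finite_multiplicity T z\<close>. As the elements of the eigenspace are
  continuous, their linear independence as functions is that in \<open>L\<^sup>2\<close>.\<close>

definition multiplicity ::
  "((real \<Rightarrow> complex) \<times> (real \<Rightarrow> complex)) set \<Rightarrow> complex \<Rightarrow> nat" where
  "multiplicity T z = cfun.dim (eigenspace T z)"

definition negative_spectrum_discrete ::
  "((real \<Rightarrow> complex) \<times> (real \<Rightarrow> complex)) set \<Rightarrow> bool" where
  "negative_spectrum_discrete T \<longleftrightarrow>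
     (\<forall>l::real. l < 0 \<and> complex_of_real l \<in> op_spectrum T \<longrightarrow>
        complex_of_real l isolated_in op_spectrum T \<and>
        is_eigenvalue T (complex_of_real l) \<and>
        finite_multiplicity T (complex_of_real l))"

definition negative_eigenvalues :: "((real \<Rightarrow> complex) \<times> (real \<Rightarrow> complex)) set \<Rightarrow> real set" where
  "negative_eigenvalues T = {l. l < 0 \<and> is_eigenvalue T (complex_of_real l)}"

text \<open>\<open>\<Sum>\<^sub>\<nu> |\<lambda>\<^sub>\<nu>|\<^bsup>1/2\<^esup>\<close> over the negative eigenvalues counted with multiplicity, in \<open>[0, \<infinity>]\<close>.\<close>

definition sum_sqrt_negative_eigenvalues ::
  "((real \<Rightarrow> complex) \<times> (real \<Rightarrow> complex)) set \<Rightarrow> ennreal" where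
  "sum_sqrt_negative_eigenvalues T =
     (\<Sum>\<^sub>\<infinity>l\<in>negative_eigenvalues T.
        of_nat (multiplicity T (complex_of_real l)) * ennreal (\<bar>l\<bar> powr (1/2)))"

end

theory Submission
  imports Defs
begin

text \<open>For the upper bound (after Hundertmark, Lieb and Thomas) let \<open>L\<^sub>k\<close> be the integral operator in \<open>L\<^sup>2(\<mu>)\<close>
  with kernel \<open>exp (-k |x - y|)\<close>. By the Birman-Schwinger principle, the \<open>n\<close>-th eigenvalue of \<open>L\<^sub>k\<close> is at
  least \<open>2 k\<close> if \<open>-k\<^sup>2\<close> is the \<open>n\<close>-th eigenvalue of the differential operator. The sum of the \<open>n\<close> largest
  eigenvalues of \<open>L\<^sub>k\<close> decreases in \<open>k\<close>, because \<open>L\<^sub>k'\<close> is for \<open>k < k'\<close> an average of operators unitarily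
  equivalent to \<open>L\<^sub>k\<close>, and it is \<open>\<mu>(\<real>)\<close> at most for \<open>k = 0\<close>. Passing from \<open>k = 0\<close> successively through the
  eigenvalues \<open>-k\<^sub>n\<^sup>2, ..., -k\<^sub>1\<^sup>2\<close>, one can split off \<open>2 k\<^sub>n, ..., 2 k\<^sub>1\<close> from this bound.

  For the lower bound, an interval of length \<open>l\<close> with mass greater than \<open>6/l\<close> carries a trapezoidal test
  function with Rayleigh quotient below \<open>-1/l\<^sup>2\<close>. Counting such intervals in dyadic grids bounds the
  number of eigenvalues below \<open>-1/l\<^sup>2\<close> for \<open>l = 2\<^sup>m\<close> from below, and successive halving bounds the total
  mass by the sum over all the scales. The discreteness of the negative spectrum enters through the
  min-max principle, which is derived from the resolvent alone.\<close>

section \<open>Hermitian forms\<close>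

text \<open>Neither the differential operator nor \<open>L\<^sub>k\<close> is diagonalized. Sums of
  largest eigenvalues of \<open>L\<^sub>k\<close> are replaced by bounds of its form summed over all
  orthonormal families of length \<open>n\<close>, and an eigenvalue is split off by enlarging such
  a family with a vector orthogonal to it. The bound persists only when \<open>k\<close> grows, so
  the eigenvalue nearest to zero goes first. At \<open>k = 0\<close> the kernel is constant, hence
  of rank one, which makes the start independent of \<open>n\<close>. Infinite mass makes the upper
  bound trivial, so that part works with finite mass.

  The lower bound comes out with 1/96, which exceeds \<open>\<alpha>/32\<close>. Here 96 = 24 * 2 *
  2: the two halves of a heavy interval of length \<open>l\<close> lose at most \<open>24/l\<close>
  when they are light, neighbouring test functions overlap so that only every second one counts, and
  the scales above one eigenvalue form a geometric progression of ratio 2.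

  The spectrum is known only as the complement of the resolvent set, so a gap in it must first be
  turned into norm estimates.\<close>

lemma underdetermined_system:
  fixes A :: "'i \<Rightarrow> 'j \<Rightarrow> complex"
  assumes "finite I" "finite J" "card I < card J"
  shows "\<exists>c. (\<exists>j\<in>J. c j \<noteq> 0) \<and> (\<forall>i\<in>I. (\<Sum>j\<in>J. A i j * c j) = 0)"
  using assms
proof (induction I arbitrary: J A rule: finite_induct)
  case empty
  then obtain j where "j \<in> J" by fastforce
  then show ?case by (intro exI[of _ "\<lambda>_. 1"]) auto
next
  case (insert i0 I)
  show ?case
  proof (cases "\<exists>j\<in>J. A i0 j \<noteq> 0")
    case False
    from insert.IH[of J A] insert.prems insert.hyps obtain c where
      "\<exists>j\<in>J. c j \<noteq> 0" "\<forall>i\<in>I. (\<Sum>j\<in>J. A i j * c j) = 0" by auto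
    with False show ?thesis by (intro exI[of _ c]) auto
  next
    case True
    then obtain j0 where j0: "j0 \<in> J" "A i0 j0 \<noteq> 0" by blast
    define J' where "J' = J - {j0}"
    have J': "finite J'" "J = insert j0 J'" "j0 \<notin> J'" using insert.prems j0 by (auto simp: J'_def)
    have "card I < card J'" using insert J' by simp
    \<comment> \<open>One step of Gaussian elimination: equation \<open>i0\<close> is solved for the
      pivot unknown \<open>j0\<close> and substituted into the others. The lemma later supplies
      vectors in a span that are orthogonal to fewer vectors than its dimension.\<close>
    from insert.IH[OF J'(1) this, of "\<lambda>i j. A i j - A i j0 * A i0 j / A i0 j0"] obtain c where
      c: "\<exists>j\<in>J'. c j \<noteq> 0" "\<forall>i\<in>I. (\<Sum>j\<in>J'. (A i j - A i j0 * A i0 j / A i0 j0) * c j) = 0" by auto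
    define e where "e = - (\<Sum>j\<in>J'. A i0 j * c j) / A i0 j0"
    define c' where "c' = c(j0 := e)"
    have s: "(\<Sum>j\<in>J. A i j * c' j) = A i j0 * e + (\<Sum>j\<in>J'. A i j * c j)" for i
    proof -
      have "(\<Sum>j\<in>J'. A i j * c' j) = (\<Sum>j\<in>J'. A i j * c j)"
        using J' by (intro sum.cong) (auto simp: c'_def)
      then show ?thesis using J' by (simp add: c'_def)
    qed
    have "(\<Sum>j\<in>J. A i j * c' j) = 0" if "i \<in> insert i0 I" for i
    proof (cases "i = i0")
      case True
      then show ?thesis unfolding s e_def using j0 by simp
    next
      case False
      then have "0 = (\<Sum>j\<in>J'. (A i j - A i j0 * A i0 j / A i0 j0) * c j)" using c that by auto
      also have "\<dots> = (\<Sum>j\<in>J'. A i j * c j) - (\<Sum>j\<in>J'. A i j0 / A i0 j0 * (A i0 j * c j))"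
        by (simp add: sum_subtractf[symmetric] algebra_simps)
      also have "\<dots> = (\<Sum>j\<in>J. A i j * c' j)" unfolding s e_def sum_distrib_left[symmetric]
        using j0 by (simp add: field_simps)
      finally show ?thesis ..
    qed
    moreover have "\<exists>j\<in>J. c' j \<noteq> 0" using c J' by (auto simp: c'_def)
    ultimately show ?thesis by blast
  qed
qed

text \<open>The carrier is a set, because one ambient function space carries several forms on
  different domains: the inner products with respect to Lebesgue measure and \<open>\<mu>\<close>,
  the Dirichlet form, and the form of the operator.\<close>

locale hermitian_form = vector_space scale
  for scale :: "complex \<Rightarrow> 'b::ab_group_add \<Rightarrow> 'b" (infixr "*s" 75) +
  fixes V :: "'b set" and B :: "'b \<Rightarrow> 'b \<Rightarrow> complex"
  assumes subspace_V: "subspace V"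
    and add_left: "\<lbrakk>x \<in> V; y \<in> V; z \<in> V\<rbrakk> \<Longrightarrow> B (x + y) z = B x z + B y z"
    and scale_left: "\<lbrakk>x \<in> V; z \<in> V\<rbrakk> \<Longrightarrow> B (c *s x) z = c * B x z"
    and hermitian: "\<lbrakk>x \<in> V; y \<in> V\<rbrakk> \<Longrightarrow> B y x = cnj (B x y)"
begin

lemma V_closed [simp, intro]:
  "0 \<in> V" "\<lbrakk>x \<in> V; y \<in> V\<rbrakk> \<Longrightarrow> x + y \<in> V" "x \<in> V \<Longrightarrow> c *s x \<in> V"
  "\<lbrakk>x \<in> V; y \<in> V\<rbrakk> \<Longrightarrow> x - y \<in> V" "x \<in> V \<Longrightarrow> - x \<in> V"
  using subspace_V by (auto simp: subspace_0 subspace_add subspace_scale subspace_diff subspace_neg)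

lemma V_sum [intro]: "(\<And>i. i \<in> I \<Longrightarrow> f i \<in> V) \<Longrightarrow> sum f I \<in> V"
  using subspace_V by (rule subspace_sum)

lemma add_right: "\<lbrakk>x \<in> V; y \<in> V; z \<in> V\<rbrakk> \<Longrightarrow> B z (x + y) = B z x + B z y"
  using add_left[of x y z] hermitian[of "x + y" z] hermitian[of x z] hermitian[of y z]
  by simp

lemma scale_right: "\<lbrakk>x \<in> V; z \<in> V\<rbrakk> \<Longrightarrow> B z (c *s x) = cnj c * B z x"
  using scale_left[of x z c] hermitian[of "c *s x" z] hermitian[of x z] by simp

lemma minus_left: "\<lbrakk>x \<in> V; z \<in> V\<rbrakk> \<Longrightarrow> B (- x) z = - B x z"
  using scale_left[of x z "-1"] by (simp add: scale_minus_left)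

lemma minus_right: "\<lbrakk>x \<in> V; z \<in> V\<rbrakk> \<Longrightarrow> B z (- x) = - B z x"
  using scale_right[of x z "-1"] by (simp add: scale_minus_left)

lemma diff_left: "\<lbrakk>x \<in> V; y \<in> V; z \<in> V\<rbrakk> \<Longrightarrow> B (x - y) z = B x z - B y z"
  using add_left[of x "-y" z] minus_left[of y z] by simp

lemma diff_right: "\<lbrakk>x \<in> V; y \<in> V; z \<in> V\<rbrakk> \<Longrightarrow> B z (x - y) = B z x - B z y"
  using add_right[of x "-y" z] minus_right[of y z] by simp

lemma zero_left: "z \<in> V \<Longrightarrow> B 0 z = 0"
  using scale_left[of 0 z 0] by simp

lemma zero_right: "z \<in> V \<Longrightarrow> B z 0 = 0"
  using scale_right[of 0 z 0] by simp

lemmas sesqui = add_left add_right scale_left scale_right minus_left minus_right diff_left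
  diff_right zero_left zero_right

lemma sum_left: "\<lbrakk>\<And>i. i \<in> I \<Longrightarrow> f i \<in> V; z \<in> V\<rbrakk> \<Longrightarrow> B (sum f I) z = (\<Sum>i\<in>I. B (f i) z)"
  by (induction I rule: infinite_finite_induct) (auto simp: sesqui V_sum)

lemma sum_right: "\<lbrakk>\<And>i. i \<in> I \<Longrightarrow> f i \<in> V; z \<in> V\<rbrakk> \<Longrightarrow> B z (sum f I) = (\<Sum>i\<in>I. B z (f i))"
  by (induction I rule: infinite_finite_induct) (auto simp: sesqui V_sum)

definition qf :: "'b \<Rightarrow> real" where "qf x = Re (B x x)"

lemma form_self: "x \<in> V \<Longrightarrow> B x x = complex_of_real (qf x)"
  using hermitian[of x x] by (simp add: qf_def complex_eq_iff)

lemma qf_diff: "\<lbrakk>x \<in> V; y \<in> V\<rbrakk> \<Longrightarrow> qf (x - y) = qf x - 2 * Re (B x y) + qf y"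
  using hermitian[of x y] by (simp add: qf_def sesqui)

lemma qf_add: "\<lbrakk>x \<in> V; y \<in> V\<rbrakk> \<Longrightarrow> qf (x + y) = qf x + 2 * Re (B x y) + qf y"
  using hermitian[of x y] by (simp add: qf_def sesqui)

lemma qf_scale: "x \<in> V \<Longrightarrow> qf (c *s x) = (cmod c)\<^sup>2 * qf x"
proof -
  assume x: "x \<in> V"
  have "B (c *s x) (c *s x) = (c * cnj c) * B x x" using x by (simp add: sesqui)
  also have "\<dots> = complex_of_real ((cmod c)\<^sup>2 * qf x)"
    unfolding complex_norm_square[symmetric] form_self[OF x] by simp
  finally show ?thesis by (simp add: qf_def)
qed

end

locale positive_form = hermitian_form +
  assumes qf_nonneg: "x \<in> V \<Longrightarrow> 0 \<le> qf x"
begin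

lemma Cauchy_Schwarz:
  assumes x: "x \<in> V" and y: "y \<in> V"
  shows "(cmod (B x y))\<^sup>2 \<le> qf x * qf y"
proof -
  define b where "b = (cmod (B x y))\<^sup>2"
  have ineq: "0 \<le> qf x - 2 * t * b + t\<^sup>2 * b * qf y" for t :: real
  proof -
    define c where "c = complex_of_real t * B x y"
    have "0 \<le> qf (x - c *s y)" using x y by (intro qf_nonneg) auto
    also have "\<dots> = qf x - 2 * Re (cnj c * B x y) + (cmod c)\<^sup>2 * qf y"
      using x y by (simp add: qf_diff qf_scale scale_right)
    also have "cnj c * B x y = complex_of_real (t * b)"
      using complex_norm_square[of "B x y"] by (simp add: c_def b_def mult.commute mult.left_commute)
    also have "(cmod c)\<^sup>2 = t\<^sup>2 * b" by (simp add: c_def b_def norm_mult power_mult_distrib)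
    finally show ?thesis by simp
  qed
  have b0: "0 \<le> b" by (simp add: b_def)
  show ?thesis
  proof (cases "qf y = 0")
    case True
    have "b = 0"
    proof (rule ccontr)
      assume "b \<noteq> 0"
      then have "0 < b" using b0 by simp
      \<comment> \<open>For \<open>qf y = 0\<close> this choice of \<open>t\<close> turns the
        inequality into \<open>0 \<le> -1\<close>.\<close>
      then show False using ineq[of "(qf x + 1) / (2 * b)"] True by (simp add: field_simps)
    qed
    then show ?thesis using True by (simp add: b_def)
  next
    case False
    then have "0 < qf y" using qf_nonneg[OF y] by simp
    then have "b \<le> qf x * qf y" using ineq[of "1 / qf y"]
      by (simp add: field_simps power2_eq_square)
    then show ?thesis by (simp add: b_def)
  qed
qed

lemma Cauchy_Schwarz_sqrt:
  assumes "x \<in> V" "y \<in> V" shows "cmod (B x y) \<le> sqrt (qf x) * sqrt (qf y)"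
  using Cauchy_Schwarz[OF assms] by (metis real_le_rsqrt real_sqrt_mult)

lemma sqrt_qf_triangle:
  assumes x: "x \<in> V" and y: "y \<in> V" shows "sqrt (qf (x + y)) \<le> sqrt (qf x) + sqrt (qf y)"
proof (rule real_le_lsqrt)
  have "Re (B x y) \<le> sqrt (qf x) * sqrt (qf y)"
    using Cauchy_Schwarz_sqrt[OF x y] complex_Re_le_cmod[of "B x y"] by linarith
  then show "qf (x + y) \<le> (sqrt (qf x) + sqrt (qf y))\<^sup>2"
    using qf_nonneg[OF x] qf_nonneg[OF y] by (simp add: qf_add[OF x y] power2_sum)
qed (use qf_nonneg x y in auto)

lemma sqrt_qf_scale: "x \<in> V \<Longrightarrow> sqrt (qf (c *s x)) = cmod c * sqrt (qf x)"
  by (simp add: qf_scale real_sqrt_mult)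

lemma sqrt_qf_triangle_diff:
  assumes x: "x \<in> V" and y: "y \<in> V" shows "sqrt (qf (x - y)) \<le> sqrt (qf x) + sqrt (qf y)"
proof -
  have "qf (- y) = qf y" using y by (simp add: qf_def sesqui)
  then show ?thesis using sqrt_qf_triangle[of x "-y"] x y by simp
qed

lemma Bessel:
  assumes I: "finite I" and \<phi>: "\<And>i. i \<in> I \<Longrightarrow> \<phi> i \<in> V" and v: "v \<in> V"
    and on: "\<And>i j. \<lbrakk>i \<in> I; j \<in> I\<rbrakk> \<Longrightarrow> B (\<phi> i) (\<phi> j) = (if i = j then 1 else 0)"
  shows "(\<Sum>i\<in>I. (cmod (B v (\<phi> i)))\<^sup>2) \<le> qf v"
proof -
  \<comment> \<open>The orthogonal projection of \<open>v\<close> onto the span of the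
    family.\<close>
  define w where "w = (\<Sum>i\<in>I. B v (\<phi> i) *s \<phi> i)"
  have w: "w \<in> V" using \<phi> by (auto simp: w_def)
  have vw: "B v w = complex_of_real (\<Sum>i\<in>I. (cmod (B v (\<phi> i)))\<^sup>2)"
    unfolding w_def using \<phi> v
    by (subst sum_right) (auto simp: sesqui complex_norm_square mult.commute simp del: of_real_power)
  have "B (\<phi> j) w = cnj (B v (\<phi> j))" if "j \<in> I" for j
    unfolding w_def using \<phi> that I
    by (subst sum_right) (auto simp: sesqui on if_distrib sum.delta cong: if_cong)
  then have Bw: "B (\<phi> j) w = cnj (B v (\<phi> j))" if "j \<in> I" for j
    using that by blast
  have "B w z = (\<Sum>i\<in>I. B v (\<phi> i) * B (\<phi> i) z)" if "z \<in> V" for z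
    unfolding w_def using \<phi> that by (subst sum_left) (auto simp: sesqui)
  from this[OF w] have "B w w = B v w"
    by (simp add: Bw vw complex_norm_square del: of_real_power)
  then have "qf w = Re (B v w)" by (simp add: qf_def)
  moreover have "0 \<le> qf (v - w)" using v w by (intro qf_nonneg) auto
  ultimately have "Re (B v w) \<le> qf v" using v w by (simp add: qf_diff)
  then show ?thesis by (simp add: vw)
qed

end

section \<open>Resolvents and eigenvectors of a closed form\<close>

text \<open>Closedness is stated for sequences with geometrically decaying increments and with weak
  limits, which is what the passage to the limit in an eigenvalue equation consumes. Definiteness
  concerns \<open>D\<close> only: a function in \<open>X\<close> may vanish almost everywhere
  without being 0, while the intended \<open>D\<close> consists of continuous functions.\<close>

locale closed_form = ip: positive_form scale X ip + a: hermitian_form scale D a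
  for scale :: "complex \<Rightarrow> 'b::ab_group_add \<Rightarrow> 'b" (infixr "*s" 75)
    and X :: "'b set" and ip :: "'b \<Rightarrow> 'b \<Rightarrow> complex" and D :: "'b set"
    and a :: "'b \<Rightarrow> 'b \<Rightarrow> complex" +
  assumes D_subset: "D \<subseteq> X"
    and definite: "\<lbrakk>x \<in> D; ip x x = 0\<rbrakk> \<Longrightarrow> x = 0"
    and closed: "\<lbrakk>\<And>n::nat. p n \<in> D;
      \<And>n. Re (ip (p (Suc n) - p n) (p (Suc n) - p n)) \<le> K * (1/16) ^ n;
      \<And>n. Re (a (p (Suc n) - p n) (p (Suc n) - p n)) \<le> K * (1/16) ^ n\<rbrakk> \<Longrightarrow>
      \<exists>q\<in>D. \<forall>g\<in>D. (\<lambda>n. ip (p n) g) \<longlonglongrightarrow> ip q g \<and> (\<lambda>n. a (p n) g) \<longlonglongrightarrow> a q g"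
begin

definition nrm :: "'b \<Rightarrow> real" where "nrm x = sqrt (ip.qf x)"

text \<open>\<open>sol c f h\<close> says that \<open>(H - c) f = h\<close> for the operator \<open>H\<close> associated with the form.\<close>

definition sol :: "real \<Rightarrow> 'b \<Rightarrow> 'b \<Rightarrow> bool" where
  "sol c f h \<longleftrightarrow> f \<in> D \<and> h \<in> X \<and> (\<forall>g\<in>D. a f g - complex_of_real c * ip f g = ip h g)"

text \<open>Membership of the real number \<open>c\<close> in the resolvent set; see
  \<open>resolvent_set_iff\<close>.\<close>

definition regular :: "real \<Rightarrow> bool" where
  "regular c \<longleftrightarrow> (\<forall>h\<in>X. \<exists>!f. sol c f h) \<and> (\<exists>C. \<forall>h\<in>X. \<forall>f. sol c f h \<longrightarrow> nrm f \<le> C * nrm h)"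

lemma DX: "x \<in> D \<Longrightarrow> x \<in> X"
  using D_subset by blast

lemma nrm_nonneg: "x \<in> X \<Longrightarrow> 0 \<le> nrm x"
  by (simp add: nrm_def ip.qf_nonneg)

lemma nrm_sq: "x \<in> X \<Longrightarrow> (nrm x)\<^sup>2 = ip.qf x"
  by (simp add: nrm_def ip.qf_nonneg)

lemma nrm_scale: "x \<in> X \<Longrightarrow> nrm (c *s x) = cmod c * nrm x"
  by (simp add: nrm_def ip.sqrt_qf_scale)

lemmas nrm_triangle_diff = ip.sqrt_qf_triangle_diff[folded nrm_def]
lemmas CS = ip.Cauchy_Schwarz_sqrt[folded nrm_def]

lemma sol_D: "sol c f h \<Longrightarrow> f \<in> D" and sol_X: "sol c f h \<Longrightarrow> h \<in> X"
  and sol_X': "sol c f h \<Longrightarrow> f \<in> X"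
  and sol_eq: "sol c f h \<Longrightarrow> g \<in> D \<Longrightarrow> a f g - complex_of_real c * ip f g = ip h g"
  by (auto simp: sol_def DX)

lemma sol_add: "sol c f h \<Longrightarrow> sol c f' h' \<Longrightarrow> sol c (f + f') (h + h')"
  by (auto simp: sol_def DX ip.sesqui a.sesqui algebra_simps)

lemma sol_diff: "sol c f h \<Longrightarrow> sol c f' h' \<Longrightarrow> sol c (f - f') (h - h')"
  by (auto simp: sol_def DX ip.sesqui a.sesqui algebra_simps)

lemma sol_scale: "sol c f h \<Longrightarrow> sol c (k *s f) (k *s h)"
  unfolding sol_def
  by (auto simp: DX ip.sesqui a.sesqui right_diff_distrib[symmetric] mult.left_commute)

text \<open>A change of the spectral parameter moves a multiple of \<open>f\<close> to the
  right-hand side. The resolvent identities below rest on this.\<close>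

lemma sol_shift: "sol c f h \<Longrightarrow> sol c' f (h + complex_of_real (c - c') *s f)"
  by (auto simp: sol_def DX ip.sesqui a.sesqui algebra_simps)

lemma sol_zero: "sol c 0 0"
  by (auto simp: sol_def DX ip.sesqui a.sesqui)

text \<open>Symmetry of the resolvent \<open>R\<close>: for \<open>g = R v\<close> and
  \<open>g' = R v'\<close> both sides are the value at \<open>(g, g')\<close> of the form shifted by
  \<open>c\<close>.\<close>

lemma sol_sym: "sol c g v \<Longrightarrow> sol c g' v' \<Longrightarrow> ip v g' = ip g v'"
proof -
  assume gv: "sol c g v" and gv': "sol c g' v'"
  note [simp] = sol_D[OF gv] sol_D[OF gv'] sol_X[OF gv] sol_X[OF gv'] sol_X'[OF gv] sol_X'[OF gv']
  have "ip v g' = a g g' - complex_of_real c * ip g g'" using sol_eq[OF gv, of g'] by simp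
  also have "\<dots> = cnj (a g' g - complex_of_real c * ip g' g)"
    by (simp add: a.hermitian[of g' g] ip.hermitian[of g' g])
  also have "\<dots> = ip g v'" using sol_eq[OF gv', of g] by (simp add: ip.hermitian[of v' g])
  finally show ?thesis .
qed

lemma regular_ex1: "\<lbrakk>regular c; h \<in> X\<rbrakk> \<Longrightarrow> \<exists>!f. sol c f h"
  unfolding regular_def by blast

lemma eigenvalue_not_regular: "\<lbrakk>sol c e 0; e \<noteq> 0\<rbrakk> \<Longrightarrow> \<not> regular c"
  using sol_zero[of c] regular_ex1[of c 0] by auto

lemma regular_bound:
  assumes "regular c"
  obtains C where "0 \<le> C" "\<And>f h. sol c f h \<Longrightarrow> nrm f \<le> C * nrm h"
proof -
  from assms obtain C where C: "\<And>f h. sol c f h \<Longrightarrow> nrm f \<le> C * nrm h"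
    unfolding regular_def by (metis sol_X)
  have "nrm f \<le> max C 0 * nrm h" if "sol c f h" for f h
  proof -
    have "C * nrm h \<le> max C 0 * nrm h"
      using nrm_nonneg[OF sol_X[OF that]] by (intro mult_right_mono) auto
    with C[OF that] show ?thesis by simp
  qed
  then show ?thesis by (intro that[of "max C 0"]) auto
qed

text \<open>The norm \<open>\<rho>\<close> of the resolvent \<open>R\<close> at \<open>c\<close> or its negative belongs to the spectrum of \<open>R\<close>,
  so that \<open>c + 1/\<rho>\<close> or \<open>c - 1/\<rho>\<close> belongs to the spectrum of the operator.\<close>

lemma resolvent_lower_bound:
  assumes d: "0 < d" and reg: "\<And>t. \<bar>t - c\<bar> < d \<Longrightarrow> regular t" and gv: "sol c g0 v0"
  shows "d * nrm g0 \<le> nrm v0"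
proof (rule ccontr)
  assume "\<not> ?thesis"
  then have less: "nrm v0 < d * nrm g0" by simp
  have regc: "regular c" using reg d by simp
  obtain K where K: "0 \<le> K" "\<And>f h. sol c f h \<Longrightarrow> nrm f \<le> K * nrm h"
    using regular_bound[OF regc] by blast
  define S where "S = {nrm g | g v. sol c g v \<and> nrm v \<le> 1}"
  define \<rho> where "\<rho> = Sup S"
  have "s \<le> K" if "s \<in> S" for s
  proof -
    from that obtain g v where "s = nrm g" "sol c g v" "nrm v \<le> 1" by (auto simp: S_def)
    then show ?thesis using K(2)[of g v] mult_left_mono[of "nrm v" 1 K] K(1) by simp
  qed
  then have bdd: "bdd_above S" by (auto simp: bdd_above_def)
  have S0: "0 \<in> S" using sol_zero[of c]
    by (force simp: S_def nrm_def ip.qf_def ip.sesqui)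
  have \<rho>0: "0 \<le> \<rho>" using cSup_upper[OF S0 bdd] by (simp add: \<rho>_def)
  have \<rho>: "nrm g \<le> \<rho> * nrm v" if gv: "sol c g v" for g v
  proof (cases "nrm v = 0")
    case True
    then show ?thesis using K(2)[OF gv] by simp
  next
    case False
    then have pos: "0 < nrm v" using nrm_nonneg[OF sol_X[OF gv]] by simp
    define k where "k = complex_of_real (1 / nrm v)"
    have "nrm (k *s g) \<in> S" using sol_scale[OF gv, of k] pos
      by (auto simp: S_def k_def nrm_scale sol_X[OF gv] norm_divide intro!: exI)
    then have "nrm (k *s g) \<le> \<rho>" unfolding \<rho>_def by (rule cSup_upper[OF _ bdd])
    then show ?thesis using pos
      by (simp add: k_def nrm_scale sol_X'[OF gv] norm_divide field_simps)
  qed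
  have \<rho>d: "1 / d < \<rho>"
  proof (rule ccontr)
    assume "\<not> 1 / d < \<rho>"
    then have "\<rho> * nrm v0 \<le> 1 / d * nrm v0" using nrm_nonneg[OF sol_X[OF gv]]
      by (intro mult_right_mono) auto
    then have "nrm g0 \<le> nrm v0 / d" using \<rho>[OF gv] by simp
    then show False using less d by (simp add: field_simps)
  qed
  then have \<rho>pos: "0 < \<rho>" using d by (meson divide_pos_pos less_trans zero_less_one)
  \<comment> \<open>If the claim fails, then \<open>1 / \<rho>\<close> is smaller than
    \<open>d\<close>, so that both \<open>c + 1 / \<rho>\<close> and \<open>c - 1 / \<rho>\<close>
    are regular.\<close>
  have \<rho>inv: "1 / \<rho> < d" using \<rho>d d \<rho>pos by (simp add: field_simps)
  have "regular (c + 1 / \<rho>)" "regular (c - 1 / \<rho>)" using \<rho>inv \<rho>pos by (auto intro!: reg)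
  then obtain K1 K2 where K1: "0 \<le> K1" "\<And>f h. sol (c + 1 / \<rho>) f h \<Longrightarrow> nrm f \<le> K1 * nrm h"
    and K2: "0 \<le> K2" "\<And>f h. sol (c - 1 / \<rho>) f h \<Longrightarrow> nrm f \<le> K2 * nrm h"
    using regular_bound by metis
  define M where "M = K2 / \<rho> * ((K1 / \<rho> + 1) / \<rho>)"
  have M0: "0 \<le> M" using K1(1) K2(1) \<rho>pos by (simp add: M_def)
  \<comment> \<open>If \<open>nrm g\<close> were close to \<open>\<rho>\<close> for some
    \<open>v\<close> in the unit ball, then \<open>(R\<^sup>2 - \<rho>\<^sup>2) v\<close> would be
    small. But this operator is the product of \<open>R - \<rho>\<close> and
    \<open>R + \<rho>\<close>, whose bounded inverses come from the regularity of the two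
    points.\<close>
  have key: "(nrm g)\<^sup>2 \<le> M\<^sup>2 * (\<rho>\<^sup>2 * (\<rho>\<^sup>2 - (nrm g)\<^sup>2))" if gv: "sol c g v" and v1: "nrm v \<le> 1" for g v
  proof -
    note mem [simp] = sol_D[OF gv] sol_X[OF gv] sol_X'[OF gv]
    obtain g2 where g2: "sol c g2 g" using regular_ex1[OF regc, of g] by auto
    note mem2 [simp] = sol_D[OF g2] sol_X[OF g2] sol_X'[OF g2]
    \<comment> \<open>In operator notation \<open>h = (R\<^sup>2 - \<rho>\<^sup>2) v\<close>,
      \<open>w = (R + \<rho>) v\<close> and \<open>x = R w\<close>, so that
      \<open>h = (R - \<rho>) w\<close>.\<close>
    define h where "h = g2 - complex_of_real (\<rho>\<^sup>2) *s v"
    define w where "w = g + complex_of_real \<rho> *s v"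
    define x where "x = g2 + complex_of_real \<rho> *s g"
    have hwx [simp]: "h \<in> X" "w \<in> X" "x \<in> X" by (auto simp: h_def w_def x_def)
    have "Re (ip g2 v) = (nrm g)\<^sup>2"
      using sol_sym[OF gv g2] ip.hermitian[of g2 v] sol_sym[OF g2 gv]
      by (simp add: nrm_sq ip.qf_def)
    then have "ip.qf h = (nrm g2)\<^sup>2 - 2 * \<rho>\<^sup>2 * (nrm g)\<^sup>2 + \<rho>\<^sup>2 * \<rho>\<^sup>2 * (nrm v)\<^sup>2"
      by (simp add: h_def ip.qf_diff ip.qf_scale ip.scale_right nrm_sq[of g2] nrm_sq[of v]
          power2_eq_square[of "\<rho>\<^sup>2"] del: of_real_power)
    also have "\<dots> \<le> \<rho>\<^sup>2 * (nrm g)\<^sup>2 - 2 * \<rho>\<^sup>2 * (nrm g)\<^sup>2 + \<rho>\<^sup>2 * \<rho>\<^sup>2 * 1"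
    proof -
      have "(nrm g2)\<^sup>2 \<le> (\<rho> * nrm g)\<^sup>2" using \<rho>[OF g2] by (intro power_mono) (auto simp: nrm_nonneg)
      moreover have "\<rho>\<^sup>2 * \<rho>\<^sup>2 * (nrm v)\<^sup>2 \<le> \<rho>\<^sup>2 * \<rho>\<^sup>2 * 1"
        using v1 by (intro mult_left_mono) (auto simp: nrm_nonneg abs_square_le_1)
      ultimately show ?thesis by (simp add: power_mult_distrib)
    qed
    also have "\<dots> = \<rho>\<^sup>2 * (\<rho>\<^sup>2 - (nrm g)\<^sup>2)" by (simp add: algebra_simps)
    finally have h: "(nrm h)\<^sup>2 \<le> \<rho>\<^sup>2 * (\<rho>\<^sup>2 - (nrm g)\<^sup>2)" by (simp add: nrm_sq)
    have x: "sol c x w" unfolding x_def w_def by (intro sol_add sol_scale g2 gv)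
    have hx: "h = x - complex_of_real \<rho> *s w"
      by (simp add: h_def x_def w_def ip.scale_right_distrib power2_eq_square)
    have "w + complex_of_real (c - (c + 1 / \<rho>)) *s x = complex_of_real (- (1 / \<rho>)) *s h"
      using \<rho>pos by (simp add: hx ip.scale_right_diff_distrib)
    with sol_shift[OF x, of "c + 1 / \<rho>"]
    have "sol (c + 1 / \<rho>) x (complex_of_real (- (1 / \<rho>)) *s h)" by simp
    from K1(2)[OF this] have nx: "nrm x \<le> K1 / \<rho> * nrm h"
      using \<rho>pos by (simp add: nrm_scale norm_divide del: of_real_minus of_real_divide)
    have "complex_of_real \<rho> *s w = x - h" by (simp add: hx)
    then have "\<rho> * nrm w \<le> nrm x + nrm h"
      using nrm_triangle_diff[of x h] nrm_scale[of w "complex_of_real \<rho>"] \<rho>pos by simp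
    with nx have "\<rho> * nrm w \<le> (K1 / \<rho> + 1) * nrm h" by (simp add: algebra_simps)
    then have nw: "nrm w \<le> (K1 / \<rho> + 1) / \<rho> * nrm h" using \<rho>pos by (simp add: field_simps)
    have "v + complex_of_real (c - (c - 1 / \<rho>)) *s g = complex_of_real (1 / \<rho>) *s w"
      using \<rho>pos by (simp add: w_def ip.scale_right_distrib add.commute)
    with sol_shift[OF gv, of "c - 1 / \<rho>"]
    have "sol (c - 1 / \<rho>) g (complex_of_real (1 / \<rho>) *s w)" by simp
    from K2(2)[OF this] have "nrm g \<le> K2 / \<rho> * nrm w"
      using \<rho>pos by (simp add: nrm_scale norm_divide del: of_real_divide)
    also have "\<dots> \<le> K2 / \<rho> * ((K1 / \<rho> + 1) / \<rho> * nrm h)"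
      using nw K2(1) \<rho>pos by (intro mult_left_mono) auto
    finally have "nrm g \<le> M * nrm h" by (simp add: M_def mult.assoc)
    then have "(nrm g)\<^sup>2 \<le> (M * nrm h)\<^sup>2" by (intro power_mono) (auto simp: nrm_nonneg)
    also have "\<dots> \<le> M\<^sup>2 * (\<rho>\<^sup>2 * (\<rho>\<^sup>2 - (nrm g)\<^sup>2))"
      using h by (simp add: power_mult_distrib mult_left_mono)
    finally show ?thesis .
  qed
  \<comment> \<open>By \<open>key\<close>, every \<open>s\<close> in \<open>S\<close> satisfies
    \<open>s\<^sup>2 * (1 + (M * \<rho>)\<^sup>2) \<le> (M * \<rho>)\<^sup>2 *
    \<rho>\<^sup>2\<close>. This keeps \<open>S\<close> below \<open>\<rho> * sqrt q\<close> with
    \<open>q < 1\<close>, although \<open>\<rho>\<close> is its supremum.\<close>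
  define q where "q = (M * \<rho>)\<^sup>2 / (1 + (M * \<rho>)\<^sup>2)"
  have q: "0 \<le> q" "q < 1" by (auto simp: q_def add_pos_nonneg)
  have "s \<le> \<rho> * sqrt q" if "s \<in> S" for s
  proof -
    from that obtain g v where s: "s = nrm g" and gv: "sol c g v" "nrm v \<le> 1" by (auto simp: S_def)
    have "s\<^sup>2 * (1 + (M * \<rho>)\<^sup>2) \<le> (M * \<rho>)\<^sup>2 * \<rho>\<^sup>2"
      using key[OF gv] by (simp add: s algebra_simps power_mult_distrib power2_eq_square)
    then have "s\<^sup>2 \<le> \<rho>\<^sup>2 * q" by (simp add: q_def field_simps add_pos_nonneg)
    then show ?thesis using \<rho>pos
      by (metis abs_of_nonneg less_eq_real_def real_le_rsqrt real_sqrt_abs real_sqrt_mult)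
  qed
  then have "\<rho> \<le> \<rho> * sqrt q" unfolding \<rho>_def using S0 by (intro cSup_least) (auto simp: \<rho>_def)
  moreover have "sqrt q < 1" using q by simp
  ultimately show False using \<rho>pos by simp
qed

text \<open>The resolvent bound at the midpoint \<open>s + d\<close> of the gap, squared. In
  operator language, \<open>(H - s) (H - s - 2 d)\<close> is nonnegative when \<open>H\<close> has
  no spectrum between \<open>s\<close> and \<open>s + 2 d\<close>.\<close>

lemma spectral_gap:
  assumes d: "0 < d" and reg: "\<And>t. \<lbrakk>s < t; t < s + 2 * d\<rbrakk> \<Longrightarrow> regular t" and f: "sol s f v"
  shows "2 * d * Re (ip v f) \<le> (nrm v)\<^sup>2"
proof -
  note [simp] = sol_D[OF f] sol_X[OF f] sol_X'[OF f]
  define w where "w = v - complex_of_real d *s f"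
  have "sol (s + d) f w" using sol_shift[OF f, of "s + d"]
    by (simp add: w_def ip.scale_minus_left)
  then have "d * nrm f \<le> nrm w"
    by (rule resolvent_lower_bound[OF d, rotated]) (auto intro!: reg simp: abs_if split: if_splits)
  then have "(d * nrm f)\<^sup>2 \<le> (nrm w)\<^sup>2" using d by (intro power_mono) (auto simp: nrm_nonneg)
  also have "\<dots> = (nrm v)\<^sup>2 - 2 * d * Re (ip v f) + (d * nrm f)\<^sup>2"
    by (simp add: nrm_sq w_def ip.qf_diff ip.qf_scale ip.scale_right power_mult_distrib)
  finally show ?thesis by simp
qed

text \<open>The vectors \<open>\<delta> (H - s + \<delta>)\<^sup>-\<^sup>1 u\<close> converge for \<open>\<delta> \<rightarrow> 0\<close> to the projection of \<open>u\<close> onto the eigenspace of \<open>s\<close>,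
  because the spectral gap above \<open>s\<close> makes them a Cauchy family. They do not converge to \<open>0\<close>,
  because the form at \<open>u\<close> is smaller than the gap.\<close>

lemma bottom_eigenvector:
  assumes d: "0 < d" and reg: "\<And>t. \<lbrakk>0 < \<bar>t - s\<bar>; \<bar>t - s\<bar> < 2 * d\<rbrakk> \<Longrightarrow> regular t"
    and eig: "\<And>e. e \<in> E \<Longrightarrow> \<exists>l. sol l e 0"
    and P_def: "P = {f \<in> D. \<forall>e\<in>E. ip f e = 0}"
    and pos: "\<And>f. f \<in> P \<Longrightarrow> s * ip.qf f \<le> a.qf f"
    and u: "u \<in> P" "nrm u = 1" "a.qf u < s + d"
  shows "\<exists>p\<in>P. p \<noteq> 0 \<and> sol s p 0"
proof -
  have ED: "e \<in> D" if "e \<in> E" for e using eig[OF that] sol_D by blast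
  have PD: "x \<in> P \<Longrightarrow> x \<in> D" and PX: "x \<in> P \<Longrightarrow> x \<in> X" for x by (auto simp: P_def DX)
  have "ip.subspace P"
    by (rule ip.subspaceI) (auto simp: P_def DX ED ip.sesqui)
  \<comment> \<open>On \<open>P\<close> the form shifted by \<open>s\<close> is nonnegative, which
    makes the Cauchy-Schwarz inequality available for it.\<close>
  then interpret as: hermitian_form scale P "\<lambda>f g. a f g - complex_of_real s * ip f g"
  proof (unfold_locales, goal_cases)
    case (4 x y)
    then show ?case using a.hermitian[of x y] ip.hermitian[of x y] by (simp add: PD PX)
  qed (auto simp: PD PX ip.sesqui a.sesqui algebra_simps)
  have asqf: "as.qf x = a.qf x - s * ip.qf x" for x
    by (simp add: as.qf_def a.qf_def ip.qf_def)
  interpret as: positive_form scale P "\<lambda>f g. a f g - complex_of_real s * ip f g"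
    by unfold_locales (use pos asqf in auto)
  \<comment> \<open>The resolvent leaves \<open>P\<close> invariant: a nonzero \<open>e\<close> in
    \<open>E\<close> is an eigenvector for some \<open>l\<close>, and \<open>l\<close> differs from
    \<open>s - \<delta>\<close>, which is regular.\<close>
  have inP: "y \<in> P" if y: "sol (s - \<delta>) y h" and h: "h \<in> P" and \<delta>: "0 < \<delta>" "\<delta> < d" for y h \<delta>
  proof -
    have "ip y e = 0" if e: "e \<in> E" for e
    proof (cases "e = 0")
      case True
      then show ?thesis using sol_X'[OF y] by (simp add: ip.sesqui)
    next
      case False
      obtain l where l: "sol l e 0" using eig[OF e] by blast
      have "regular (s - \<delta>)" using \<delta> by (intro reg) auto
      with eigenvalue_not_regular[OF l False] have ne: "l \<noteq> s - \<delta>" by auto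
      have "a e y - complex_of_real l * ip e y = 0"
        using sol_eq[OF l sol_D[OF y]] sol_X'[OF y] by (simp add: ip.sesqui)
      then have "a y e = complex_of_real l * ip y e"
        using a.hermitian[of e y] ip.hermitian[of e y] sol_D[OF y] sol_X'[OF y] ED[OF e] DX[OF ED[OF e]]
        by simp
      moreover have "a y e - complex_of_real (s - \<delta>) * ip y e = 0"
        using sol_eq[OF y ED[OF e]] h e by (simp add: P_def)
      ultimately have "complex_of_real (l - (s - \<delta>)) * ip y e = 0" by (simp add: algebra_simps)
      with ne show ?thesis by (simp del: of_real_diff)
    qed
    then show ?thesis using sol_D[OF y] by (simp add: P_def)
  qed
  have gap: "2 * d * as.qf f \<le> (nrm v)\<^sup>2" if "sol s f v" for f v
  proof -
    have "2 * d * Re (ip v f) \<le> (nrm v)\<^sup>2"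
      by (rule spectral_gap[OF d _ that]) (auto intro: reg)
    then show ?thesis using sol_eq[OF that sol_D[OF that]] by (simp add: as.qf_def)
  qed
  have uD [simp]: "u \<in> D" and uX [simp]: "u \<in> X" using u PD PX by auto
  \<comment> \<open>Here \<open>y \<delta> = (H - s + \<delta>)\<^sup>-\<^sup>1 u\<close>, while
    \<open>p \<delta>\<close> approximates the projection of \<open>u\<close> onto the eigenspace
    and \<open>z \<delta> = (H - s) (y \<delta>)\<close> is the remainder
    \<open>u - p \<delta>\<close>.\<close>
  define y where "y \<delta> = (THE y. sol (s - \<delta>) y u)" for \<delta>
  define z where "z \<delta> = u - complex_of_real \<delta> *s y \<delta>" for \<delta>
  define p where "p \<delta> = complex_of_real \<delta> *s y \<delta>" for \<delta>
  have y: "sol (s - \<delta>) (y \<delta>) u" if "0 < \<delta>" "\<delta> < d" for \<delta>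
  proof -
    have "regular (s - \<delta>)" using that by (intro reg) auto
    then have "\<exists>!y. sol (s - \<delta>) y u" by (simp add: regular_ex1)
    then show ?thesis unfolding y_def by (rule theI')
  qed
  have yz: "sol s (y \<delta>) (z \<delta>)" if "0 < \<delta>" "\<delta> < d" for \<delta>
    using sol_shift[OF y[OF that], of s] by (simp add: z_def ip.scale_minus_left)
  have yP: "y \<delta> \<in> P" if "0 < \<delta>" "\<delta> < d" for \<delta> using inP[OF y u(1)] that by blast
  have zX: "z \<delta> \<in> X" if "0 < \<delta>" "\<delta> < d" for \<delta> using sol_X[OF yz] that by blast
  have pP: "p \<delta> \<in> P" if "0 < \<delta>" "\<delta> < d" for \<delta> using yP[OF that] by (simp add: p_def)
  \<comment> \<open>With \<open>t = Re (ip (z \<delta>) u)\<close>, Cauchy-Schwarz gives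
    \<open>t\<^sup>2 \<le> as.qf (y \<delta>) * as.qf u\<close>. The gap of length
    \<open>2 d\<close> against \<open>as.qf u < d\<close> produces a factor 1/2, so that
    \<open>t\<^sup>2 \<le> t / 2\<close>.\<close>
  have z_half: "Re (ip (z \<delta>) u) \<le> 1 / 2" and z_le: "nrm (z \<delta>) \<le> 1" if \<delta>: "0 < \<delta>" "\<delta> < d" for \<delta>
  proof -
    note [simp] = zX[OF \<delta>] PX[OF yP[OF \<delta>]] PD[OF yP[OF \<delta>]]
    define t where "t = Re (ip (z \<delta>) u)"
    have yy: "Re (ip (z \<delta>) (y \<delta>)) = as.qf (y \<delta>)"
      using sol_eq[OF yz[OF \<delta>], of "y \<delta>"] by (simp add: as.qf_def)
    have "(nrm (z \<delta>))\<^sup>2 = Re (ip (z \<delta>) (u - complex_of_real \<delta> *s y \<delta>))"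
      by (simp add: nrm_sq ip.qf_def z_def)
    also have "\<dots> = t - \<delta> * as.qf (y \<delta>)" by (simp add: ip.sesqui t_def yy)
    also have "\<dots> \<le> t" using as.qf_nonneg[OF yP[OF \<delta>]] \<delta> by simp
    finally have zt: "(nrm (z \<delta>))\<^sup>2 \<le> t" .
    have "t\<^sup>2 \<le> (cmod (ip (z \<delta>) u))\<^sup>2"
      unfolding t_def using abs_Re_le_cmod[of "ip (z \<delta>) u"] by (simp add: abs_le_square_iff[symmetric])
    also have "ip (z \<delta>) u = a (y \<delta>) u - complex_of_real s * ip (y \<delta>) u"
      using sol_eq[OF yz[OF \<delta>], of u] by simp
    also have "(cmod \<dots>)\<^sup>2 \<le> as.qf (y \<delta>) * as.qf u" using yP[OF \<delta>] u(1) by (rule as.Cauchy_Schwarz)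
    also have "\<dots> \<le> as.qf (y \<delta>) * d"
      using u nrm_sq[of u] as.qf_nonneg[OF yP[OF \<delta>]] by (intro mult_left_mono) (auto simp: asqf)
    also have "\<dots> \<le> (nrm (z \<delta>))\<^sup>2 / 2" using gap[OF yz[OF \<delta>]] by (simp add: mult_ac)
    finally have "t\<^sup>2 \<le> t / 2" using zt by simp
    moreover have "0 \<le> t" using zt by (rule order_trans[rotated]) simp
    ultimately have t: "t \<le> 1 / 2" by (cases "t = 0") (auto simp: power2_eq_square)
    then show "Re (ip (z \<delta>) u) \<le> 1 / 2" by (simp add: t_def)
    have "(nrm (z \<delta>))\<^sup>2 \<le> 1\<^sup>2" using zt t by simp
    then show "nrm (z \<delta>) \<le> 1" by (rule power2_le_imp_le) simp
  qed
  have Cauchy: "nrm (p \<delta> - p \<delta>') \<le> \<bar>\<delta> - \<delta>'\<bar> / d" if \<delta>: "0 < \<delta>" "\<delta> < d" and \<delta>': "0 < \<delta>'" "\<delta>' < d" for \<delta> \<delta>'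
  proof -
    have regd: "regular (s - \<delta>)" using \<delta> by (intro reg) auto
    then obtain t where t: "sol (s - \<delta>) t (y \<delta>')"
      using regular_ex1 PX[OF yP[OF \<delta>']] by blast
    have tP: "t \<in> P" using inP[OF t yP[OF \<delta>'] \<delta>] .
    \<comment> \<open>Here \<open>t = (H - s + \<delta>)\<^sup>-\<^sup>1 (y \<delta>')\<close> and
      \<open>r = (H - s) t\<close>. The difference \<open>p \<delta> - p \<delta>'\<close> will be
      \<open>(\<delta> - \<delta>') r\<close>, so the aim is a bound of \<open>r\<close> independent
      of both parameters.\<close>
    define r where "r = y \<delta>' - complex_of_real \<delta> *s t"
    have rP [simp]: "r \<in> P" using tP yP[OF \<delta>'] by (simp add: r_def)
    note [simp] = PX[OF rP] PD[OF rP] zX[OF \<delta>'] PX[OF pP[OF \<delta>]] PX[OF pP[OF \<delta>']] PX[OF yP[OF \<delta>']]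
    have tr: "sol s t r" using sol_shift[OF t, of s] by (simp add: r_def ip.scale_minus_left)
    have "sol (s - \<delta>) (y \<delta>') (z \<delta>' + complex_of_real \<delta> *s y \<delta>')"
      using sol_shift[OF yz[OF \<delta>'], of "s - \<delta>"] by simp
    from sol_diff[OF this sol_scale[OF t, of "complex_of_real \<delta>"]]
    have rz: "sol (s - \<delta>) r (z \<delta>')" by (simp add: r_def)
    have rs: "sol s r (z \<delta>' - complex_of_real \<delta> *s r)"
      using sol_shift[OF rz, of s] by (simp add: ip.scale_minus_left)
    \<comment> \<open>Reading \<open>ip r r\<close> as the shifted form at \<open>(t, r)\<close>
      lets the gap estimate act on \<open>t\<close> and on \<open>r\<close> at once.\<close>
    have "(ip.qf r)\<^sup>2 \<le> (cmod (ip r r))\<^sup>2" by (simp add: ip.form_self)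
    also have "ip r r = a t r - complex_of_real s * ip t r" using sol_eq[OF tr, of r] by simp
    also have "(cmod \<dots>)\<^sup>2 \<le> as.qf t * as.qf r" by (rule as.Cauchy_Schwarz[OF tP rP])
    also have "\<dots> \<le> (ip.qf r / (2 * d)) * ((nrm (z \<delta>' - complex_of_real \<delta> *s r))\<^sup>2 / (2 * d))"
      using gap[OF tr] gap[OF rs] d as.qf_nonneg[OF rP] ip.qf_nonneg[of r]
      by (intro mult_mono) (auto simp: nrm_sq field_simps)
    finally have *: "ip.qf r * ip.qf r * (2 * d)\<^sup>2 \<le> ip.qf r * (nrm (z \<delta>' - complex_of_real \<delta> *s r))\<^sup>2"
      using d by (simp add: field_simps power2_eq_square)
    have "(2 * d * nrm r)\<^sup>2 \<le> (nrm (z \<delta>' - complex_of_real \<delta> *s r))\<^sup>2"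
    proof (cases "ip.qf r = 0")
      case True
      then show ?thesis by (simp add: nrm_def)
    next
      case False
      then have "0 < ip.qf r" using ip.qf_nonneg[of r] by simp
      then show ?thesis using * by (simp add: nrm_sq power_mult_distrib mult.assoc mult.commute)
    qed
    then have "2 * d * nrm r \<le> nrm (z \<delta>' - complex_of_real \<delta> *s r)"
      by (rule power2_le_imp_le) (simp add: nrm_nonneg)
    also have "\<dots> \<le> nrm (z \<delta>') + \<delta> * nrm r"
      using nrm_triangle_diff[of "z \<delta>'" "complex_of_real \<delta> *s r"] \<delta> by (simp add: nrm_scale)
    also have "\<dots> \<le> 1 + d * nrm r" using z_le[OF \<delta>'] \<delta>
      by (intro add_mono mult_right_mono) (auto simp: nrm_nonneg)
    finally have r1: "nrm r \<le> 1 / d" using d by (simp add: field_simps)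
    have "sol (s - \<delta>) (p \<delta>) (complex_of_real \<delta> *s u)"
      unfolding p_def by (rule sol_scale[OF y[OF \<delta>]])
    moreover have "sol (s - \<delta>) (p \<delta>') (complex_of_real \<delta>' *s u + complex_of_real (\<delta> - \<delta>') *s p \<delta>')"
      using sol_shift[OF sol_scale[OF y[OF \<delta>'], of "complex_of_real \<delta>'"], of "s - \<delta>"]
      by (simp add: p_def)
    ultimately have "sol (s - \<delta>) (p \<delta> - p \<delta>')
      (complex_of_real \<delta> *s u - (complex_of_real \<delta>' *s u + complex_of_real (\<delta> - \<delta>') *s p \<delta>'))"
      by (rule sol_diff)
    also have "complex_of_real \<delta> *s u - (complex_of_real \<delta>' *s u + complex_of_real (\<delta> - \<delta>') *s p \<delta>')
       = complex_of_real (\<delta> - \<delta>') *s z \<delta>'"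
      by (simp add: z_def p_def ip.scale_right_diff_distrib ip.scale_left_diff_distrib)
    finally have "sol (s - \<delta>) (p \<delta> - p \<delta>') (complex_of_real (\<delta> - \<delta>') *s z \<delta>')" .
    moreover have "sol (s - \<delta>) (complex_of_real (\<delta> - \<delta>') *s r) (complex_of_real (\<delta> - \<delta>') *s z \<delta>')"
      by (rule sol_scale[OF rz])
    ultimately have "p \<delta> - p \<delta>' = complex_of_real (\<delta> - \<delta>') *s r"
      using regular_ex1[OF regd, of "complex_of_real (\<delta> - \<delta>') *s z \<delta>'"] zX[OF \<delta>'] by blast
    then have "nrm (p \<delta> - p \<delta>') = \<bar>\<delta> - \<delta>'\<bar> * nrm r"
      by (simp add: nrm_scale del: of_real_diff)
    also have "\<dots> \<le> \<bar>\<delta> - \<delta>'\<bar> * (1 / d)" using r1 by (intro mult_left_mono) auto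
    finally show ?thesis by simp
  qed
  have p_sol: "sol s (p \<delta>) (complex_of_real \<delta> *s z \<delta>)" if "0 < \<delta>" "\<delta> < d" for \<delta>
    unfolding p_def by (rule sol_scale[OF yz[OF that]])
  \<comment> \<open>Closedness refers to both quadratic forms, so the differences must be small for
    the shifted form as well.\<close>
  have as_diff: "as.qf (p \<delta> - p \<delta>') \<le> (\<delta> + \<delta>') * (\<bar>\<delta> - \<delta>'\<bar> / d)"
    if \<delta>: "0 < \<delta>" "\<delta> < d" and \<delta>': "0 < \<delta>'" "\<delta>' < d" for \<delta> \<delta>'
  proof -
    note [simp] = zX[OF \<delta>] zX[OF \<delta>'] pP[OF \<delta>] pP[OF \<delta>'] PX PD
    define v where "v = complex_of_real \<delta> *s z \<delta> - complex_of_real \<delta>' *s z \<delta>'"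
    have "sol s (p \<delta> - p \<delta>') v" unfolding v_def by (rule sol_diff[OF p_sol[OF \<delta>] p_sol[OF \<delta>']])
    from sol_eq[OF this sol_D[OF this]] have "as.qf (p \<delta> - p \<delta>') = Re (ip v (p \<delta> - p \<delta>'))"
      by (simp add: as.qf_def)
    also have "\<dots> \<le> nrm v * nrm (p \<delta> - p \<delta>')"
      using CS[of v "p \<delta> - p \<delta>'"] complex_Re_le_cmod[of "ip v (p \<delta> - p \<delta>')"] by (simp add: v_def)
    also have "\<dots> \<le> (\<delta> + \<delta>') * (\<bar>\<delta> - \<delta>'\<bar> / d)"
    proof (intro mult_mono Cauchy \<delta> \<delta>')
      have "nrm v \<le> nrm (complex_of_real \<delta> *s z \<delta>) + nrm (complex_of_real \<delta>' *s z \<delta>')"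
        unfolding v_def by (intro nrm_triangle_diff) auto
      also have "\<dots> = \<delta> * nrm (z \<delta>) + \<delta>' * nrm (z \<delta>')" using \<delta> \<delta>' by (simp add: nrm_scale)
      also have "\<dots> \<le> \<delta> * 1 + \<delta>' * 1"
        using \<delta> \<delta>' z_le by (intro add_mono mult_left_mono) auto
      finally show "nrm v \<le> \<delta> + \<delta>'" by simp
    qed (use \<delta> \<delta>' in \<open>auto simp: nrm_nonneg\<close>)
    finally show ?thesis .
  qed
  \<comment> \<open>The ratio 1/16 is the rate prescribed in the closedness assumption.\<close>
  define \<delta> where "\<delta> n = d / 2 * (1/16) ^ n" for n :: nat
  have pow: "0 < (1/16 :: real) ^ n" "(1/16 :: real) ^ n \<le> 1" for n by (auto simp: power_le_one)
  have \<delta>: "0 < \<delta> n" "\<delta> n < d" for n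
  proof -
    show "0 < \<delta> n" using d pow by (simp add: \<delta>_def)
    have "d / 2 * (1/16) ^ n \<le> d / 2 * 1" using d pow by (intro mult_left_mono) auto
    then show "\<delta> n < d" using d by (simp add: \<delta>_def)
  qed
  have diff: "\<bar>\<delta> (Suc n) - \<delta> n\<bar> / d \<le> (1/16) ^ n" for n
  proof -
    have "\<delta> (Suc n) - \<delta> n = - (15 / 32 * d * (1/16) ^ n)" by (simp add: \<delta>_def)
    then have "\<bar>\<delta> (Suc n) - \<delta> n\<bar> / d = 15 / 32 * (1/16) ^ n" using d by (simp add: abs_mult)
    then show ?thesis using pow(1)[of n] by linarith
  qed
  have n1: "ip.qf (p (\<delta> (Suc n)) - p (\<delta> n)) \<le> (1/16) ^ n" for n
  proof -
    have X: "p (\<delta> (Suc n)) - p (\<delta> n) \<in> X" using pP[OF \<delta>] PX by simp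
    have "nrm (p (\<delta> (Suc n)) - p (\<delta> n)) \<le> (1/16) ^ n"
      using Cauchy[OF \<delta> \<delta>] diff by (rule order_trans)
    then have "(nrm (p (\<delta> (Suc n)) - p (\<delta> n)))\<^sup>2 \<le> ((1/16) ^ n)\<^sup>2"
      using X by (intro power_mono) (auto simp: nrm_nonneg)
    also have "\<dots> \<le> (1/16) ^ n" using pow[of n]
      by (simp add: power2_eq_square mult_left_le)
    finally show ?thesis using X by (simp add: nrm_sq)
  qed
  have n2: "as.qf (p (\<delta> (Suc n)) - p (\<delta> n)) \<le> 2 * d * (1/16) ^ n" for n
  proof -
    have "as.qf (p (\<delta> (Suc n)) - p (\<delta> n)) \<le> (\<delta> (Suc n) + \<delta> n) * (\<bar>\<delta> (Suc n) - \<delta> n\<bar> / d)"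
      by (rule as_diff[OF \<delta> \<delta>])
    also have "\<dots> \<le> (2 * d) * (1/16) ^ n"
      using \<delta>[of n] \<delta>[of "Suc n"] diff d by (intro mult_mono) auto
    finally show ?thesis .
  qed
  define K where "K = 1 + 2 * d + \<bar>s\<bar>"
  have "\<exists>q\<in>D. \<forall>g\<in>D. (\<lambda>n. ip (p (\<delta> n)) g) \<longlonglongrightarrow> ip q g \<and> (\<lambda>n. a (p (\<delta> n)) g) \<longlonglongrightarrow> a q g"
  proof (rule closed)
    fix n
    show "p (\<delta> n) \<in> D" using pP[OF \<delta>] PD by simp
    have "0 \<le> ip.qf (p (\<delta> (Suc n)) - p (\<delta> n))" using pP[OF \<delta>] PX by (intro ip.qf_nonneg) auto
    then have "s * ip.qf (p (\<delta> (Suc n)) - p (\<delta> n)) \<le> \<bar>s\<bar> * (1/16) ^ n"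
      using n1[of n] by (intro mult_mono) auto
    then have "a.qf (p (\<delta> (Suc n)) - p (\<delta> n)) \<le> 2 * d * (1/16) ^ n + \<bar>s\<bar> * (1/16) ^ n"
      using n2[of n] unfolding asqf by linarith
    also have "\<dots> \<le> K * (1/16) ^ n" using pow(1)[of n] unfolding K_def distrib_right by linarith
    finally show "Re (a (p (\<delta> (Suc n)) - p (\<delta> n)) (p (\<delta> (Suc n)) - p (\<delta> n))) \<le> K * (1/16) ^ n"
      by (simp add: a.qf_def)
    have "0 \<le> (2 * d + \<bar>s\<bar>) * (1/16) ^ n" using d pow[of n] by simp
    then show "Re (ip (p (\<delta> (Suc n)) - p (\<delta> n)) (p (\<delta> (Suc n)) - p (\<delta> n))) \<le> K * (1/16) ^ n"
      using n1[of n] unfolding ip.qf_def K_def distrib_right by linarith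
  qed
  then obtain q where q: "q \<in> D" "\<And>g. g \<in> D \<Longrightarrow> (\<lambda>n. ip (p (\<delta> n)) g) \<longlonglongrightarrow> ip q g"
    "\<And>g. g \<in> D \<Longrightarrow> (\<lambda>n. a (p (\<delta> n)) g) \<longlonglongrightarrow> a q g" by blast
  have "a q g - complex_of_real s * ip q g = 0" if g: "g \<in> D" for g
  proof -
    have "(\<lambda>n. a (p (\<delta> n)) g - complex_of_real s * ip (p (\<delta> n)) g) \<longlonglongrightarrow> a q g - complex_of_real s * ip q g"
      by (intro tendsto_intros q g)
    moreover have "(\<lambda>n. a (p (\<delta> n)) g - complex_of_real s * ip (p (\<delta> n)) g) \<longlonglongrightarrow> 0"
    proof (rule Lim_null_comparison[OF always_eventually[OF allI]])
      fix n
      have "a (p (\<delta> n)) g - complex_of_real s * ip (p (\<delta> n)) g = complex_of_real (\<delta> n) * ip (z (\<delta> n)) g"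
        using sol_eq[OF p_sol[OF \<delta>] g] zX[OF \<delta>] DX[OF g] by (simp add: ip.sesqui)
      then have "norm (a (p (\<delta> n)) g - complex_of_real s * ip (p (\<delta> n)) g) = \<delta> n * cmod (ip (z (\<delta> n)) g)"
        using \<delta>[of n] by (simp add: norm_mult)
      also have "\<dots> \<le> \<delta> n * (1 * nrm g)"
      proof (intro mult_left_mono)
        have "cmod (ip (z (\<delta> n)) g) \<le> nrm (z (\<delta> n)) * nrm g" by (rule CS[OF zX[OF \<delta>] DX[OF g]])
        also have "\<dots> \<le> 1 * nrm g" using z_le[OF \<delta>] nrm_nonneg[OF DX[OF g]] by (intro mult_right_mono)
        finally show "cmod (ip (z (\<delta> n)) g) \<le> 1 * nrm g" .
      qed (use \<delta>[of n] in simp)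
      finally show "norm (a (p (\<delta> n)) g - complex_of_real s * ip (p (\<delta> n)) g) \<le> (d / 2 * nrm g) * (1/16) ^ n"
        by (simp add: \<delta>_def mult_ac)
    next
      show "(\<lambda>n. (d / 2 * nrm g) * (1/16 :: real) ^ n) \<longlonglongrightarrow> 0"
        by (intro tendsto_mult_right_zero LIMSEQ_realpow_zero) auto
    qed
    ultimately show ?thesis by (rule LIMSEQ_unique)
  qed
  then have sq: "sol s q 0" using q(1) by (simp add: sol_def ip.sesqui DX)
  have "ip q e = 0" if e: "e \<in> E" for e
  proof -
    have "(\<lambda>n. ip (p (\<delta> n)) e) = (\<lambda>n. 0)" using pP[OF \<delta>] e by (auto simp: P_def)
    then show ?thesis using q(2)[OF ED[OF e]] LIMSEQ_unique tendsto_const by metis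
  qed
  then have qP: "q \<in> P" using q(1) by (simp add: P_def)
  \<comment> \<open>The part of \<open>u\<close> that \<open>z_half\<close> leaves to
    \<open>p\<close> survives in the limit, so \<open>q\<close> is not 0.\<close>
  have "1 / 2 \<le> Re (ip q u)"
  proof (rule Lim_bounded2)
    show "(\<lambda>n. Re (ip (p (\<delta> n)) u)) \<longlonglongrightarrow> Re (ip q u)" by (intro tendsto_Re q) simp
    have "1 / 2 \<le> Re (ip (p (\<delta> n)) u)" for n
    proof -
      have "ip (p (\<delta> n)) u = ip (u - z (\<delta> n)) u" by (simp add: p_def z_def)
      also have "\<dots> = ip u u - ip (z (\<delta> n)) u" using zX[OF \<delta>] by (simp add: ip.sesqui)
      finally show ?thesis using z_half[OF \<delta>, of n] u(2) nrm_sq[of u] by (simp add: ip.qf_def)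
    qed
    then show "\<forall>n\<ge>0. 1 / 2 \<le> Re (ip (p (\<delta> n)) u)" by simp
  qed
  then have "q \<noteq> 0" by (auto simp: ip.sesqui)
  with qP sq show ?thesis by blast
qed

end

section \<open>Absolutely continuous functions and weak derivatives\<close>

lemma (in pair_sigma_finite) integrable_product_bounded:
  fixes f :: "'a \<Rightarrow> complex" and g :: "'b \<Rightarrow> complex" and k :: "'a \<times> 'b \<Rightarrow> complex"
  assumes f: "integrable M1 f" and g: "integrable M2 g"
    and k [measurable]: "k \<in> borel_measurable (M1 \<Otimes>\<^sub>M M2)" and C: "\<And>z. cmod (k z) \<le> C"
  shows "integrable (M1 \<Otimes>\<^sub>M M2) (\<lambda>(x, y). k (x, y) * (f x * g y))"
proof -
  have [measurable]: "f \<in> borel_measurable M1" "g \<in> borel_measurable M2" using f g by auto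
  have "integrable (M1 \<Otimes>\<^sub>M M2) (\<lambda>(x, y). f x * g y)"
  proof (rule Fubini_integrable)
    show "integrable M1 (\<lambda>x. LINT y|M2. norm (case (x, y) of (x, y) \<Rightarrow> f x * g y))"
      using f by (simp add: norm_mult)
    show "AE x in M1. integrable M2 (\<lambda>y. case (x, y) of (x, y) \<Rightarrow> f x * g y)"
      using g by simp
  qed measurable
  then have "integrable (M1 \<Otimes>\<^sub>M M2) (\<lambda>z. complex_of_real C * (case z of (x, y) \<Rightarrow> f x * g y))"
    by simp
  then show ?thesis
    by (rule Bochner_Integration.integrable_bound)
       (use C in \<open>auto simp: norm_mult intro!: AE_I2 mult_right_mono order_trans[OF C abs_ge_self]\<close>)
qed

text \<open>Absolute continuity as being an indefinite Lebesgue integral, with the density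
  \<open>f\<close> carried along as a representative of the derivative.\<close>

definition ac_on :: "real \<Rightarrow> real \<Rightarrow> (real \<Rightarrow> complex) \<Rightarrow> (real \<Rightarrow> complex) \<Rightarrow> bool" where
  "ac_on a b F f \<longleftrightarrow> set_integrable lborel {a..b} f \<and>
     (\<forall>x\<in>{a..b}. F x = F a + (LINT t:{a..x}|lborel. f t))"

definition ac :: "(real \<Rightarrow> complex) \<Rightarrow> (real \<Rightarrow> complex) \<Rightarrow> bool" where
  "ac F f \<longleftrightarrow> (\<forall>a b. a \<le> b \<longrightarrow> ac_on a b F f)"

lemma set_integral_Icc_combine:
  fixes f :: "real \<Rightarrow> complex"
  assumes "set_integrable lborel {a..c} f" "a \<le> b" "b \<le> c"
  shows "(LINT t:{a..c}|lborel. f t) = (LINT t:{a..b}|lborel. f t) + (LINT t:{b..c}|lborel. f t)"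
proof -
  have "{a..c} = {a..b} \<union> {b..c}" using assms by auto
  moreover have "AE t in lborel. \<not> (t \<in> {a..b} \<and> t \<in> {b..c})"
    using AE_lborel_singleton[of b] by eventually_elim auto
  moreover have "set_integrable lborel {a..b} f" "set_integrable lborel {b..c} f"
    by (rule set_integrable_subset[OF assms(1)]; use assms in simp)+
  ultimately show ?thesis by (simp add: set_integral_Un_AE)
qed

lemma ac_onI_diff:
  assumes "set_integrable lborel {a..b} f"
    "\<And>x. x \<in> {a..b} \<Longrightarrow> F x - F a = (LINT t:{a..x}|lborel. f t)"
  shows "ac_on a b F f"
  unfolding ac_on_def
proof (intro conjI ballI assms(1))
  fix x assume "x \<in> {a..b}"
  from assms(2)[OF this] show "F x = F a + (LINT t:{a..x}|lborel. f t)"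
    by (simp add: diff_eq_eq add.commute)
qed

lemma ac_on_integrable: "ac_on a b F f \<Longrightarrow> set_integrable lborel {a..b} f"
  by (simp add: ac_on_def)

lemma ac_onD: "\<lbrakk>ac_on a b F f; x \<in> {a..b}\<rbrakk> \<Longrightarrow> F x = F a + (LINT t:{a..x}|lborel. f t)"
  unfolding ac_on_def by blast

lemma ac_on_diff:
  assumes F: "ac_on a b F f" and xy: "a \<le> x" "x \<le> y" "y \<le> b"
  shows "F y - F x = (LINT t:{x..y}|lborel. f t)"
proof -
  have "set_integrable lborel {a..y} f"
    by (rule set_integrable_subset[OF ac_on_integrable[OF F]]) (use xy in auto)
  from set_integral_Icc_combine[OF this xy(1,2)] show ?thesis
    using ac_onD[OF F, of x] ac_onD[OF F, of y] xy by (simp only: atLeastAtMost_iff) simp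
qed

lemma ac_on_subinterval:
  assumes F: "ac_on a b F f" and "a \<le> a'" "b' \<le> b" shows "ac_on a' b' F f"
proof (rule ac_onI_diff)
  show "set_integrable lborel {a'..b'} f"
    by (rule set_integrable_subset[OF ac_on_integrable[OF F]]) (use assms in auto)
  show "F x - F a' = (LINT t:{a'..x}|lborel. f t)" if "x \<in> {a'..b'}" for x
    using that assms by (intro ac_on_diff[OF F]) auto
qed

lemma ac_on_continuous:
  assumes F: "ac_on a b F f" shows "continuous_on {a..b} F"
proof -
  have "f integrable_on {a..b}"
    by (rule set_borel_integral_eq_integral[OF ac_on_integrable[OF F]])
  then have c: "continuous_on {a..b} (\<lambda>x. F a + integral {a..x} f)"
    by (intro continuous_intros indefinite_integral_continuous_1)
  have "(LINT t:{a..x}|lborel. f t) = integral {a..x} f" if "x \<in> {a..b}" for x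
    by (rule set_borel_integral_eq_integral, rule set_integrable_subset[OF ac_on_integrable[OF F]])
       (use that in auto)
  then have "F a + integral {a..x} f = F x" if "x \<in> {a..b}" for x
    using ac_onD[OF F that] that by simp
  then show ?thesis by (rule continuous_on_eq[OF c])
qed

lemma ac_integrable:
  assumes "ac F f" shows "set_integrable lborel {a..b} f"
proof (cases "a \<le> b")
  case True
  then show ?thesis using assms ac_on_integrable[of a b F f] by (auto simp: ac_def)
qed (simp add: set_integrable_def)

lemma ac_continuous: "ac F f \<Longrightarrow> continuous_on UNIV F"
proof -
  assume F: "ac F f"
  have "isCont F x" for x
  proof -
    have "continuous_on {x - 1..x + 1} F" using F by (intro ac_on_continuous[of _ _ _ f]) (auto simp: ac_def)
    then show ?thesis by (rule continuous_on_interior) simp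
  qed
  then show ?thesis by (simp add: continuous_at_imp_continuous_on)
qed

lemma ac_on_C1:
  fixes F :: "real \<Rightarrow> complex"
  assumes "\<And>x. a \<le> x \<Longrightarrow> x \<le> b \<Longrightarrow> (F has_vector_derivative f x) (at x within {a..b})" "continuous_on {a..b} f"
  shows "ac_on a b F f"
proof (rule ac_onI_diff)
  show "set_integrable lborel {a..b} f" by (rule borel_integrable_atLeastAtMost'[OF assms(2)])
  fix x assume x: "x \<in> {a..b}"
  have "(LINT t:{a..x}|lborel. f t) = integral\<^sup>L lborel (\<lambda>t. indicator {a..x} t *\<^sub>R f t)"
    by (simp add: set_lebesgue_integral_def)
  also have "\<dots> = F x - F a"
  proof (rule integral_FTC_atLeastAtMost)
    show "(F has_vector_derivative f t) (at t within {a..x})" if "a \<le> t" "t \<le> x" for t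
      by (rule has_vector_derivative_within_subset[OF assms(1)]) (use x that in auto)
    show "continuous_on {a..x} f" by (rule continuous_on_subset[OF assms(2)]) (use x in auto)
  qed (use x in simp)
  finally show "F x - F a = (LINT t:{a..x}|lborel. f t)" ..
qed

lemma set_integrable_mult_continuous:
  fixes f G :: "real \<Rightarrow> complex"
  assumes f: "set_integrable lborel {a..b} f" and G: "continuous_on {a..b} G"
  shows "set_integrable lborel {a..b} (\<lambda>x. f x * G x)"
proof -
  have "bounded (G ` {a..b})"
    by (rule compact_imp_bounded[OF compact_continuous_image[OF G compact_Icc]])
  then obtain C where "\<forall>z\<in>G ` {a..b}. cmod z \<le> C" unfolding bounded_iff by blast
  then have C: "\<And>x. x \<in> {a..b} \<Longrightarrow> cmod (G x) \<le> C" by blast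
  have "set_integrable lborel {a..b} G" by (rule borel_integrable_atLeastAtMost'[OF G])
  then have Gm [measurable]: "(\<lambda>x. indicator {a..b} x *\<^sub>R G x) \<in> borel_measurable lborel"
    by (simp add: set_integrable_def)
  have fm [measurable]: "(\<lambda>x. indicator {a..b} x *\<^sub>R f x) \<in> borel_measurable lborel"
    using f by (simp add: set_integrable_def)
  have "integrable lborel (\<lambda>x. C *\<^sub>R (indicator {a..b} x *\<^sub>R f x))"
    using f unfolding set_integrable_def by (intro integrable_scaleR_right)
  then have "integrable lborel (\<lambda>x. (indicator {a..b} x *\<^sub>R f x) * (indicator {a..b} x *\<^sub>R G x))"
  proof (rule Bochner_Integration.integrable_bound)
    have "norm (indicator {a..b} x *\<^sub>R f x * indicator {a..b} x *\<^sub>R G x)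
      \<le> norm (C *\<^sub>R indicator {a..b} x *\<^sub>R f x)" for x
    proof (cases "x \<in> {a..b}")
      case True
      have "cmod (f x) * cmod (G x) \<le> cmod (f x) * \<bar>C\<bar>"
        using C[OF True] by (intro mult_left_mono) auto
      then show ?thesis using True by (simp add: norm_mult mult.commute)
    qed simp
    then show "AE x in lborel. norm (indicator {a..b} x *\<^sub>R f x * indicator {a..b} x *\<^sub>R G x)
      \<le> norm (C *\<^sub>R indicator {a..b} x *\<^sub>R f x)" by simp
  qed measurable
  also have "(\<lambda>x. (indicator {a..b} x *\<^sub>R f x) * (indicator {a..b} x *\<^sub>R G x)) =
    (\<lambda>x. indicator {a..b} x *\<^sub>R (f x * G x))"
    by (auto simp: fun_eq_iff indicator_def)
  finally show ?thesis by (simp add: set_integrable_def)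
qed

text \<open>Integration by parts through Fubini: the integral of \<open>f x * g y\<close> over the
  triangle \<open>c \<le> x \<le> y \<le> d\<close> is evaluated in both orders.\<close>

lemma ac_product:
  assumes ab: "a \<le> b" and F: "ac_on a b F f" and G: "ac_on a b G g"
  shows "ac_on a b (\<lambda>x. F x * G x) (\<lambda>x. f x * G x + F x * g x)" (is "ac_on a b ?H ?h")
proof -
  have i1: "set_integrable lborel {a..b} (\<lambda>x. f x * G x)"
    by (rule set_integrable_mult_continuous[OF ac_on_integrable[OF F] ac_on_continuous[OF G]])
  have i2: "set_integrable lborel {a..b} (\<lambda>x. F x * g x)"
    using set_integrable_mult_continuous[OF ac_on_integrable[OF G] ac_on_continuous[OF F]] by (simp add: mult.commute)
  have main: "(LINT x:{c..d}|lborel. ?h x) = F d * G d - F c * G c" if cd: "a \<le> c" "c \<le> d" "d \<le> b" for c d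
  proof -
    define fi where "fi x = indicator {c..d} x *\<^sub>R f x" for x
    define gi where "gi x = indicator {c..d} x *\<^sub>R g x" for x
    have F': "ac_on c d F f" and G': "ac_on c d G g"
      by (rule ac_on_subinterval[OF F], use that in simp, use that in simp)
         (rule ac_on_subinterval[OF G], use that in simp, use that in simp)
    have fi: "integrable lborel fi" and gi: "integrable lborel gi"
      using ac_on_integrable[OF F'] ac_on_integrable[OF G'] by (auto simp: set_integrable_def fi_def[abs_def] gi_def[abs_def])
    define k where "k = (\<lambda>z::real \<times> real. if fst z \<le> snd z then 1 else 0 :: complex)"
    have km [measurable]: "k \<in> borel_measurable (lborel \<Otimes>\<^sub>M lborel)"
      unfolding k_def by measurable
    have "integrable (lborel \<Otimes>\<^sub>M lborel) (\<lambda>(x, y). k (x, y) * (fi x * gi y))"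
      by (rule lborel_pair.integrable_product_bounded[OF fi gi km, of 1]) (simp add: k_def)
    from lborel_pair.Fubini_integral[OF this]
    have Fub: "(LINT y|lborel. LINT x|lborel. k (x, y) * (fi x * gi y)) =
       (LINT x|lborel. LINT y|lborel. k (x, y) * (fi x * gi y))" by simp
    have Fy: "(LINT x|lborel. k (x, y) * (fi x * gi y)) = F y * gi y - F c * gi y" for y
    proof (cases "y \<in> {c..d}")
      case True
      have "(LINT x|lborel. k (x, y) * (fi x * gi y)) = (LINT x|lborel. (indicator {c..y} x *\<^sub>R f x) * gi y)"
        using True by (intro Bochner_Integration.integral_cong) (auto simp: k_def fi_def indicator_def)
      also have "\<dots> = (LINT x:{c..y}|lborel. f x) * gi y"
        unfolding set_lebesgue_integral_def by (rule integral_mult_left_zero)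
      also have "\<dots> = (F y - F c) * gi y"
        using ac_on_diff[OF F', of c y] True by simp
      finally show ?thesis by (simp add: algebra_simps)
    qed (simp add: gi_def)
    have Gx: "(LINT y|lborel. k (x, y) * (fi x * gi y)) = fi x * G d - fi x * G x" for x
    proof (cases "x \<in> {c..d}")
      case True
      have "(LINT y|lborel. k (x, y) * (fi x * gi y)) = (LINT y|lborel. fi x * (indicator {x..d} y *\<^sub>R g y))"
        using True by (intro Bochner_Integration.integral_cong) (auto simp: k_def gi_def indicator_def)
      also have "\<dots> = fi x * (LINT y:{x..d}|lborel. g y)"
        unfolding set_lebesgue_integral_def by (rule integral_mult_right_zero)
      also have "\<dots> = fi x * (G d - G x)"
        using ac_on_diff[OF G', of x d] True by simp
      finally show ?thesis by (simp add: algebra_simps)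
    qed (simp add: fi_def)
    have fG: "integrable lborel (\<lambda>x. fi x * G x)" and Fg: "integrable lborel (\<lambda>x. F x * gi x)"
      using set_integrable_subset[OF i1, of "{c..d}"] set_integrable_subset[OF i2, of "{c..d}"] that
      by (auto simp: set_integrable_def fi_def[abs_def] gi_def[abs_def])
    have If: "(LINT x|lborel. fi x) = F d - F c" and Ig: "(LINT x|lborel. gi x) = G d - G c"
      using ac_on_diff[OF F', of c d] ac_on_diff[OF G', of c d] that
      by (auto simp: fi_def gi_def set_lebesgue_integral_def)
    have "(LINT y|lborel. F y * gi y - F c * gi y) = (LINT x|lborel. fi x * G d - fi x * G x)"
      using Fub by (simp add: Fy Gx)
    then have "(LINT y|lborel. F y * gi y) - F c * (G d - G c) = (F d - F c) * G d - (LINT x|lborel. fi x * G x)"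
      using fG Fg fi gi by (simp add: If Ig)
    then have "(LINT x|lborel. fi x * G x + F x * gi x) = F d * G d - F c * G c"
      using fG Fg by (simp add: algebra_simps)
    moreover have "(LINT x:{c..d}|lborel. ?h x) = (LINT x|lborel. fi x * G x + F x * gi x)"
      unfolding set_lebesgue_integral_def
      by (intro Bochner_Integration.integral_cong) (auto simp: fi_def gi_def algebra_simps scaleR_add_right)
    ultimately show ?thesis by simp
  qed
  show ?thesis
  proof (rule ac_onI_diff)
    show "set_integrable lborel {a..b} ?h" by (intro set_integral_add i1 i2)
  next
    fix x assume x: "x \<in> {a..b}"
    show "F x * G x - F a * G a = (LINT t:{a..x}|lborel. ?h t)"
      by (rule main[symmetric]) (use x in auto)
  qed
qed

lemma ac_mult:
  assumes "ac F f" "ac G g" shows "ac (\<lambda>x. F x * G x) (\<lambda>x. f x * G x + F x * g x)"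
  using assms unfolding ac_def by (auto intro: ac_product)

lemma ac_cnj: "ac F f \<Longrightarrow> ac (\<lambda>x. cnj (F x)) (\<lambda>x. cnj (f x))"
proof -
  assume F: "ac F f"
  have *: "indicator A x *\<^sub>R cnj z = cnj (indicator A x *\<^sub>R z)" for A :: "real set" and x z
    by simp
  show ?thesis unfolding ac_def
  proof (intro allI impI ac_onI_diff)
    fix a b :: real assume "a \<le> b"
    with F have ab: "ac_on a b F f" by (simp add: ac_def)
    show "set_integrable lborel {a..b} (\<lambda>x. cnj (f x))"
      using ac_on_integrable[OF ab] unfolding set_integrable_def * by (simp only: integrable_cnj)
    fix x assume x: "x \<in> {a..b}"
    have "(LINT t:{a..x}|lborel. cnj (f t)) = cnj (LINT t:{a..x}|lborel. f t)"
      unfolding set_lebesgue_integral_def * by (rule Bochner_Integration.integral_cnj)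
    also have "\<dots> = cnj (F x - F a)" using ac_on_diff[OF ab, of a x] x by simp
    finally show "cnj (F x) - cnj (F a) = (LINT t:{a..x}|lborel. cnj (f t))" by simp
  qed
qed

lemma continuous_AE_zero:
  fixes f :: "real \<Rightarrow> 'a::{real_normed_vector, second_countable_topology}"
  assumes f: "continuous_on UNIV f" and ae: "AE x in lborel. f x = 0"
  shows "f x = 0"
proof (rule ccontr)
  assume "f x \<noteq> 0"
  define U where "U = f -` (- {0})"
  have U: "open U" unfolding U_def
    by (rule open_vimage[OF _ f]) auto
  have "x \<in> U" using \<open>f x \<noteq> 0\<close> by (simp add: U_def)
  then obtain e where e: "0 < e" "ball x e \<subseteq> U" using U by (meson open_contains_ball)
  have "U \<in> null_sets lborel"
  proof (subst AE_iff_null_sets)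
    show "AE x in lborel. x \<notin> U" using ae by eventually_elim (simp add: U_def)
  qed (use U in simp)
  then have "emeasure lborel U = 0" by auto
  moreover have "emeasure lborel {x - e/2 .. x + e/2} \<le> emeasure lborel U"
    using e U by (intro emeasure_mono) (auto simp: dist_real_def subset_eq abs_if)
  ultimately show False using e by simp
qed

lemma integrable_continuous_compact_support:
  fixes f :: "real \<Rightarrow> 'a::{banach, second_countable_topology}"
  assumes "continuous_on {a..b} f" "\<And>x. x \<notin> {a..b} \<Longrightarrow> f x = 0"
  shows "integrable lborel f"
proof -
  have "(\<lambda>x. indicator {a..b} x *\<^sub>R f x) = f" using assms(2) by (auto simp: fun_eq_iff indicator_def)
  then show ?thesis using borel_integrable_atLeastAtMost'[OF assms(1)] by (simp add: set_integrable_def)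
qed

lemma set_integral_eq_integral_support:
  fixes f :: "'a \<Rightarrow> 'b::{banach, second_countable_topology}"
  assumes "\<And>x. x \<notin> A \<Longrightarrow> f x = 0"
  shows "(LINT x:A|M. f x) = (LINT x|M. f x)"
proof -
  have "(\<lambda>x. indicator A x *\<^sub>R f x) = f" using assms by (auto simp: fun_eq_iff indicator_def)
  then show ?thesis by (simp add: set_lebesgue_integral_def)
qed

section \<open>Square-integrable functions with respect to a measure\<close>

definition sq_integrable :: "'a measure \<Rightarrow> ('a \<Rightarrow> complex) set" where
  "sq_integrable M = {f \<in> borel_measurable M. integrable M (\<lambda>x. (cmod (f x))\<^sup>2)}"

lemma L2_eq: "L2 = sq_integrable lborel"
  by (simp add: L2_def sq_integrable_def)

lemma sq_integrable_mult:
  assumes "f \<in> sq_integrable M" "g \<in> sq_integrable M" shows "integrable M (\<lambda>x. f x * g x)"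
proof -
  have [measurable]: "f \<in> borel_measurable M" "g \<in> borel_measurable M"
    and i: "integrable M (\<lambda>x. (cmod (f x))\<^sup>2)" "integrable M (\<lambda>x. (cmod (g x))\<^sup>2)"
    using assms by (auto simp: sq_integrable_def)
  have "integrable M (\<lambda>x. (cmod (f x))\<^sup>2 + (cmod (g x))\<^sup>2)" using i by simp
  then show ?thesis
  proof (rule Bochner_Integration.integrable_bound)
    have "cmod (f x) * cmod (g x) \<le> (cmod (f x))\<^sup>2 + (cmod (g x))\<^sup>2" for x
      using sum_squares_bound[of "cmod (f x)" "cmod (g x)"]
        mult_nonneg_nonneg[OF norm_ge_zero[of "f x"] norm_ge_zero[of "g x"]] by linarith
    then show "AE x in M. norm (f x * g x) \<le> norm ((cmod (f x))\<^sup>2 + (cmod (g x))\<^sup>2)"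
      by (simp add: norm_mult)
  qed measurable
qed

lemma sq_integrable_cnj: "f \<in> sq_integrable M \<Longrightarrow> (\<lambda>x. cnj (f x)) \<in> sq_integrable M"
  by (auto simp: sq_integrable_def intro: measurable_compose[OF _ borel_measurable_continuous_onI]
      continuous_intros)

lemma subspace_sq_integrable: "cfun.subspace (sq_integrable (M :: real measure))"
proof (rule cfun.subspaceI)
  show "0 \<in> sq_integrable M" by (simp add: sq_integrable_def zero_fun_def)
  show "(\<lambda>x. c * f x) \<in> sq_integrable M" if "f \<in> sq_integrable M" for c f
    using that by (auto simp: sq_integrable_def norm_mult power_mult_distrib)
  show "f + g \<in> sq_integrable M" if fg: "f \<in> sq_integrable M" "g \<in> sq_integrable M" for f g
  proof -
    have [measurable]: "f \<in> borel_measurable M" "g \<in> borel_measurable M"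
      and i: "integrable M (\<lambda>x. (cmod (f x))\<^sup>2)" "integrable M (\<lambda>x. (cmod (g x))\<^sup>2)"
      using fg by (auto simp: sq_integrable_def)
    have "integrable M (\<lambda>x. 2 * (cmod (f x))\<^sup>2 + 2 * (cmod (g x))\<^sup>2)" using i by simp
    then have "integrable M (\<lambda>x. (cmod (f x + g x))\<^sup>2)"
    proof (rule Bochner_Integration.integrable_bound)
      have "(cmod (f x + g x))\<^sup>2 \<le> 2 * (cmod (f x))\<^sup>2 + 2 * (cmod (g x))\<^sup>2" for x
      proof -
        have "(cmod (f x + g x))\<^sup>2 \<le> (cmod (f x) + cmod (g x))\<^sup>2"
          by (intro power_mono norm_triangle_ineq) auto
        also have "\<dots> \<le> 2 * (cmod (f x))\<^sup>2 + 2 * (cmod (g x))\<^sup>2"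
          using sum_squares_bound[of "cmod (f x)" "cmod (g x)"] by (simp add: power2_sum)
        finally show ?thesis .
      qed
      then show "AE x in M. norm ((cmod (f x + g x))\<^sup>2) \<le> norm (2 * (cmod (f x))\<^sup>2 + 2 * (cmod (g x))\<^sup>2)"
        by (simp add: abs_of_nonneg)
    qed measurable
    then show ?thesis by (simp add: sq_integrable_def plus_fun_def)
  qed
qed

lemma sq_integrable_inner:
  "\<lbrakk>f \<in> sq_integrable M; g \<in> sq_integrable M\<rbrakk> \<Longrightarrow> integrable M (\<lambda>x. f x * cnj (g x))"
  by (intro sq_integrable_mult sq_integrable_cnj)

lemma integral_norm_square:
  "Re (LINT x|M. f x * cnj (f x)) = (LINT x|M. (cmod (f x))\<^sup>2)"
proof -
  have "(LINT x|M. f x * cnj (f x)) = (LINT x|M. complex_of_real ((cmod (f x))\<^sup>2))"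
    by (simp only: complex_norm_square)
  then show ?thesis by (simp del: of_real_power)
qed

lemma positive_form_sq_integrable:
  fixes M :: "real measure"
  shows "positive_form (\<lambda>c (f::real \<Rightarrow> complex) x. c * f x) (sq_integrable M) (\<lambda>f g. LINT x|M. f x * cnj (g x))"
    (is "positive_form _ _ ?B")
proof -
  interpret hermitian_form "\<lambda>c (f::real \<Rightarrow> complex) x. c * f x" "sq_integrable M" ?B
  proof
    show "cfun.subspace (sq_integrable M)" by (rule subspace_sq_integrable)
    show "?B (x + y) z = ?B x z + ?B y z"
      if "x \<in> sq_integrable M" "y \<in> sq_integrable M" "z \<in> sq_integrable M" for x y z
      using sq_integrable_inner[of x M z] sq_integrable_inner[of y M z] that
      by (simp add: distrib_right)
    show "?B (\<lambda>t. c * x t) z = c * ?B x z" if "x \<in> sq_integrable M" "z \<in> sq_integrable M" for c x z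
      by (simp add: mult.assoc)
    show "?B y x = cnj (?B x y)" for x y
      by (simp add: mult.commute flip: Bochner_Integration.integral_cnj)
  qed
  show ?thesis
    by unfold_locales (simp add: qf_def integral_norm_square)
qed

lemma L2_inner_eq: "L2_inner = (\<lambda>f g. LINT x|lborel. f x * cnj (g x))"
  by (simp add: L2_inner_def fun_eq_iff)

interpretation L2: positive_form "\<lambda>c (f::real \<Rightarrow> complex) x. c * f x" L2 L2_inner
  unfolding L2_eq L2_inner_eq by (rule positive_form_sq_integrable)

lemma L2_qf: "L2.qf f = (LINT x|lborel. (cmod (f x))\<^sup>2)"
  by (simp add: L2.qf_def L2_inner_def integral_norm_square)

lemmas L2_mult_integrable = sq_integrable_mult[where M="lborel :: real measure", folded L2_eq]
lemmas L2_integrable_inner = sq_integrable_inner[where M="lborel :: real measure", folded L2_eq]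

lemma L2_locally_integrable:
  assumes "g \<in> L2" shows "set_integrable lborel {a..b} g"
proof -
  have ind: "(\<lambda>x. indicator {a..b} x :: complex) \<in> L2"
  proof -
    have "(\<lambda>x. (cmod (indicator {a..b} x :: complex))\<^sup>2) = indicator {a..b}"
      by (auto simp: fun_eq_iff indicator_def)
    then show ?thesis by (simp add: L2_def integrable_real_indicator emeasure_lborel_Icc_eq)
  qed
  have "(\<lambda>x. indicator {a..b} x *\<^sub>R g x) = (\<lambda>x. indicator {a..b} x * g x)"
    by (auto simp: fun_eq_iff indicator_def)
  then show ?thesis using L2_mult_integrable[OF ind assms] by (simp add: set_integrable_def)
qed

lemma L2_norm_eq: "L2_norm f = sqrt (L2.qf f)"
  by (simp add: L2_norm_def L2_qf)

text \<open>The Borel sets over which the difference of the densities, cut off to a bounded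
  interval, integrates to 0 form a Dynkin system. It contains the half-lines, which are stable under
  intersection and generate the Borel sets.\<close>

lemma ac_unique:
  assumes f: "ac F f" and g: "ac F g" shows "AE x in lborel. f x = g x"
proof -
  have "AE x in lborel. x \<in> {- real n..real n} \<longrightarrow> f x = g x" for n :: nat
  proof -
    define I where "I = {- real n..real n}"
    define h where "h x = indicator I x *\<^sub>R (f x - g x)" for x
    have fI: "set_integrable lborel {a..b} f" "set_integrable lborel {a..b} g" for a b
      using f g by (auto intro: ac_integrable)
    have hi: "integrable lborel h"
      using set_integral_diff(1)[OF fI(1)[of "-real n" "real n"] fI(2)[of "-real n" "real n"]]
      by (simp add: set_integrable_def h_def[abs_def] I_def)
    have zero: "(LINT x:{a..b}|lborel. f x - g x) = 0" if "a \<le> b" for a b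
    proof -
      have "ac_on a b F f" "ac_on a b F g" using f g that by (auto simp: ac_def)
      from ac_on_diff[OF this(1), of a b] ac_on_diff[OF this(2), of a b] that
      show ?thesis using fI by (simp add: set_integral_diff)
    qed
    let ?G = "range (\<lambda>a::real. {..a})"
    have "(LINT x:A|lborel. h x) = 0" if "A \<in> sets lborel" for A
    proof -
      have "sets (borel :: real measure) = sigma_sets UNIV ?G"
        by (subst borel_eq_atMost) (simp add: sets_measure_of)
      then have A: "A \<in> sigma_sets UNIV ?G" using that by simp
      have sm: "B \<in> sets lborel" if "B \<in> sigma_sets UNIV ?G" for B
        using that \<open>sets borel = sigma_sets UNIV ?G\<close> by simp
      have whole: "(LINT x|lborel. h x) = 0"
        using zero[of "- real n" "real n"] by (simp add: h_def[abs_def] I_def set_lebesgue_integral_def)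
      have hs: "set_integrable lborel B h" if "B \<in> sets lborel" for B
        using integrable_mult_indicator[OF that hi] by (simp add: set_integrable_def)
      have "Int_stable ?G" by (auto simp: Int_stable_def)
      moreover have "?G \<subseteq> Pow UNIV" by simp
      ultimately show ?thesis using A
      proof (induction rule: sigma_sets_induct_disjoint)
        case (basic B)
        then obtain a where B: "B = {..a}" by auto
        show ?case
        proof (cases "a < - real n")
          case True
          then have *: "indicator B x *\<^sub>R h x = 0" for x by (auto simp: h_def I_def B indicator_def)
          show ?thesis unfolding set_lebesgue_integral_def * by simp
        next
          case False
          have "(LINT x:B|lborel. h x) = (LINT x:{- real n..min a (real n)}|lborel. f x - g x)"
            unfolding set_lebesgue_integral_def
            by (intro Bochner_Integration.integral_cong) (auto simp: h_def I_def B indicator_def)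
          also have "\<dots> = 0" using False by (intro zero) auto
          finally show ?thesis .
        qed
      next
        case empty
        then show ?case by (simp add: set_lebesgue_integral_def)
      next
        case (compl B)
        have "(LINT x:UNIV|lborel. h x) = (LINT x:B \<union> (UNIV - B)|lborel. h x)" by (simp add: Un_Diff_cancel)
        also have "\<dots> = (LINT x:B|lborel. h x) + (LINT x:UNIV - B|lborel. h x)"
          using sm[OF compl(1)] by (intro set_integral_Un hs) auto
        finally show ?case using compl whole by (simp add: set_lebesgue_integral_def)
      next
        case (union B)
        have Bm: "B i \<in> sets lborel" for i using union(2) by (intro sm) auto
        have "(LINT x:(\<Union>i. B i)|lborel. h x) = (\<Sum>i. (LINT x:(B i)|lborel. h x))"
          using union(1) Bm by (intro lebesgue_integral_countable_add hs sets.countable_UN)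
             (auto simp: disjoint_family_on_def)
        then show ?case using union by simp
      qed
    qed
    then have "AE x in lborel. h x = 0"
      by (rule sigma_finite_measure.density_zero[OF sigma_finite_lborel hi])
    then show ?thesis
      by eventually_elim (auto simp: h_def I_def)
  qed
  then have "AE x in lborel. \<forall>n::nat. x \<in> {- real n..real n} \<longrightarrow> f x = g x"
    unfolding AE_all_countable by blast
  then show ?thesis
  proof eventually_elim
    case (elim x)
    obtain n :: nat where "\<bar>x\<bar> \<le> real n" using real_arch_simple by blast
    with elim show ?case by (auto simp: abs_le_iff)
  qed
qed

text \<open>With \<open>G\<close> a primitive of \<open>g\<close> and \<open>u = f - G\<close>, the test function with derivative \<open>\<eta> (u - m)\<close>, where \<open>m\<close> is the
  mean of \<open>u\<close> with respect to the weight \<open>\<eta>\<close>, shows that the variance of \<open>u\<close> vanishes.\<close>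

lemma weak_L2_deriv_imp_ac:
  assumes f: "continuous_on UNIV f" and w: "weak_L2_deriv f g"
  shows "ac f g"
proof -
  have gL2: "g \<in> L2" using w by (simp add: weak_L2_deriv_def)
  note gI = L2_locally_integrable[OF gL2]
  have local: "f b - f a = (LINT t:{a..b}|lborel. g t)" if N: "- N < a" "a \<le> b" "b < N" for a b N
  proof -
    define G where "G x = (LINT t:{-N..x}|lborel. g t)" for x
    have pt: "(LINT t:{-N..-N}|lborel. g t) = 0"
      using set_integral_Icc_combine[OF gI, of "-N" "-N" "-N"] by simp
    have G: "ac_on (-N) N G g" by (rule ac_onI_diff[OF gI]) (use pt in \<open>simp add: G_def\<close>)
    \<comment> \<open>Clamping extends \<open>f - G\<close> from \<open>{-N..N}\<close> to a
      continuous function on the whole line.\<close>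
    define cl where "cl x = max (-N) (min N x)" for x
    have clN: "cl x \<in> {-N..N}" for x using N by (auto simp: cl_def)
    have cl_id: "x \<in> {-N..N} \<Longrightarrow> cl x = x" for x by (auto simp: cl_def)
    have cl_cont: "continuous_on UNIV cl" unfolding cl_def by (intro continuous_intros)
    have u_cont: "continuous_on {-N..N} (\<lambda>x. f x - G x)"
      by (intro continuous_intros ac_on_continuous[OF G] continuous_on_subset[OF f]) auto
    define u where "u x = f (cl x) - G (cl x)" for x
    have uc: "continuous_on UNIV u"
      unfolding u_def using continuous_on_compose2[OF u_cont cl_cont] clN by blast
    \<comment> \<open>A continuous function with integral 0 supported in the interval has a
      primitive supported there, which is an admissible test function. Hence \<open>u\<close> is
      orthogonal to all such functions.\<close>
    have test: "(LINT x|lborel. \<psi> x *\<^sub>R u x) = 0"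
      if \<psi>: "continuous_on UNIV \<psi>" and supp: "\<And>x. x \<notin> {-N<..<N} \<Longrightarrow> \<psi> x = 0" and int0: "(LINT x|lborel. \<psi> x) = 0"
      for \<psi> :: "real \<Rightarrow> real"
    proof -
      \<comment> \<open>The base point lies strictly to the left of \<open>-N\<close>, so that
        two-sided derivatives are available around \<open>-N\<close> too.\<close>
      define \<phi> where "\<phi> x = integral {-N-1..x} \<psi>" for x
      have \<psi>I: "\<psi> integrable_on {a..b}" for a b
        by (intro integrable_continuous_real continuous_on_subset[OF \<psi>]) auto
      have \<phi>L: "\<phi> x = (LINT t:{-N-1..x}|lborel. \<psi> t)" for x
        unfolding \<phi>_def by (rule set_borel_integral_eq_integral(2)[symmetric])
          (intro borel_integrable_atLeastAtMost' continuous_on_subset[OF \<psi>], simp)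
      have \<phi>0: "\<phi> x = 0" if "x \<notin> {-N<..<N}" for x
      proof (cases "x \<le> -N")
        case True
        then have *: "indicator {-N-1..x} t *\<^sub>R \<psi> t = 0" for t
          using supp[of t] by (auto simp: indicator_def)
        show ?thesis unfolding \<phi>L set_lebesgue_integral_def * by simp
      next
        case False
        then have *: "indicator {-N-1..x} t *\<^sub>R \<psi> t = \<psi> t" for t
          by (cases "t \<in> {-N<..<N}") (use supp[of t] that False in \<open>auto simp: indicator_def\<close>)
        show ?thesis unfolding \<phi>L set_lebesgue_integral_def * by (rule int0)
      qed
      have d: "(\<phi> has_vector_derivative \<psi> x) (at x)" for x
      proof (cases "-N-1 < x")
        case True
        have "(\<phi> has_vector_derivative \<psi> x) (at x within {-N-1..x+1})"
          unfolding \<phi>_def using True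
          by (intro integral_has_vector_derivative continuous_on_subset[OF \<psi>]) auto
        moreover have "at x within {-N-1..x+1} = at x"
          using True by (intro at_within_interior) auto
        ultimately show ?thesis by simp
      next
        case False
        have "((\<lambda>_. 0) has_vector_derivative 0) (at x)" by simp
        then have "(\<phi> has_vector_derivative 0) (at x)"
          by (rule has_vector_derivative_transform_within_open[of _ _ _ "{..<-N}"])
             (use False \<phi>0 N in auto)
        moreover have "\<psi> x = 0" using False N by (intro supp) auto
        ultimately show ?thesis by simp
      qed
      have C1: "\<phi> C1_differentiable_on UNIV"
        unfolding C1_differentiable_on_def using d \<psi> by blast
      have cp: "compact (closure {x. \<phi> x \<noteq> 0})"
      proof -
        have "{x. \<phi> x \<noteq> 0} \<subseteq> {-N<..<N}" using \<phi>0 by blast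
        then have "bounded {x. \<phi> x \<noteq> 0}" by (rule bounded_subset[rotated]) simp
        then show ?thesis by (simp add: compact_closure)
      qed
      have der: "deriv \<phi> x = \<psi> x" for x
        using d[of x] by (intro DERIV_imp_deriv) (simp add: has_real_derivative_iff_has_vector_derivative)
      have weak: "(LINT x|lborel. \<psi> x *\<^sub>R f x) = - (LINT x|lborel. \<phi> x *\<^sub>R g x)"
      proof -
        have "(LINT x|lborel. deriv \<phi> x *\<^sub>R f x) = - (LINT x|lborel. \<phi> x *\<^sub>R g x)"
          using w C1 cp unfolding weak_L2_deriv_def by blast
        then show ?thesis by (simp only: der)
      qed
      have \<phi>bd: "\<phi> N = 0" "\<phi> (-N) = 0" by (auto intro: \<phi>0)
      have ac\<phi>: "ac_on (-N) N (\<lambda>x. complex_of_real (\<phi> x)) (\<lambda>x. complex_of_real (\<psi> x))"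
      proof (rule ac_on_C1)
        show "((\<lambda>x. complex_of_real (\<phi> x)) has_vector_derivative complex_of_real (\<psi> x)) (at x within {-N..N})" for x
          by (rule bounded_linear.has_vector_derivative[OF bounded_linear_of_real
                has_vector_derivative_at_within[OF d]])
        show "continuous_on {-N..N} (\<lambda>x. complex_of_real (\<psi> x))"
          by (intro continuous_intros continuous_on_subset[OF \<psi>]) auto
      qed
      have NN: "-N \<le> N" using N by simp
      note pr = ac_product[OF NN ac\<phi> G]
      have pr0: "(LINT x:{-N..N}|lborel. of_real (\<psi> x) * G x + of_real (\<phi> x) * g x) = 0"
        using ac_on_diff[OF pr, of "-N" N] NN \<phi>bd by simp
      have i1: "set_integrable lborel {-N..N} (\<lambda>x. of_real (\<psi> x) * G x)"
        by (rule set_integrable_mult_continuous[OF ac_on_integrable[OF ac\<phi>] ac_on_continuous[OF G]])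
      have i2: "set_integrable lborel {-N..N} (\<lambda>x. of_real (\<phi> x) * g x)"
        using set_integrable_mult_continuous[OF gI ac_on_continuous[OF ac\<phi>]] by (simp add: mult.commute)
      have i3: "set_integrable lborel {-N..N} (\<lambda>x. of_real (\<psi> x) * f x)"
        by (rule set_integrable_mult_continuous[OF ac_on_integrable[OF ac\<phi>] continuous_on_subset[OF f]]) simp
      have e1: "(LINT x|lborel. \<psi> x *\<^sub>R f x) = (LINT x:{-N..N}|lborel. of_real (\<psi> x) * f x)"
        using supp by (subst set_integral_eq_integral_support) (auto simp: scaleR_conv_of_real)
      have e2: "(LINT x|lborel. \<phi> x *\<^sub>R g x) = (LINT x:{-N..N}|lborel. of_real (\<phi> x) * g x)"
        using \<phi>0 by (subst set_integral_eq_integral_support) (auto simp: scaleR_conv_of_real \<phi>0)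
      have "(LINT x|lborel. \<psi> x *\<^sub>R u x) = (LINT x:{-N..N}|lborel. \<psi> x *\<^sub>R u x)"
        by (rule set_integral_eq_integral_support[symmetric]) (use supp in auto)
      also have "\<dots> = (LINT x:{-N..N}|lborel. of_real (\<psi> x) * f x - of_real (\<psi> x) * G x)"
        by (rule set_lebesgue_integral_cong) (auto simp: u_def cl_id scaleR_conv_of_real algebra_simps)
      also have "\<dots> = (LINT x:{-N..N}|lborel. of_real (\<psi> x) * f x) - (LINT x:{-N..N}|lborel. of_real (\<psi> x) * G x)"
        by (rule set_integral_diff[OF i3 i1])
      also have "\<dots> = - ((LINT x:{-N..N}|lborel. of_real (\<phi> x) * g x) + (LINT x:{-N..N}|lborel. of_real (\<psi> x) * G x))"
        using weak unfolding e1 e2 by simp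
      also have "\<dots> = 0" using pr0 set_integral_add(2)[OF i1 i2] by (simp add: add.commute)
      finally show ?thesis .
    qed
    \<comment> \<open>A weight that is positive inside and vanishes outside, so that its products
      with continuous functions have the support required in \<open>test\<close>.\<close>
    define \<eta> where "\<eta> x = max 0 (N\<^sup>2 - x\<^sup>2)" for x :: real
    have \<eta>c: "continuous_on UNIV \<eta>" unfolding \<eta>_def by (intro continuous_intros)
    have \<eta>0: "\<eta> x = 0" if "x \<notin> {-N<..<N}" for x
    proof -
      have "\<bar>N\<bar> \<le> \<bar>x\<bar>" using that N by auto
      then have "N\<^sup>2 \<le> x\<^sup>2" by (simp only: abs_le_square_iff)
      then show ?thesis by (simp add: \<eta>_def)
    qed
    have \<eta>pos: "0 < \<eta> x" if "x \<in> {-N<..<N}" for x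
    proof -
      have "\<bar>x\<bar> < \<bar>N\<bar>" using that by auto
      then have "x\<^sup>2 < N\<^sup>2" using power_strict_mono[of "\<bar>x\<bar>" "\<bar>N\<bar>" 2] by simp
      then show ?thesis by (simp add: \<eta>_def)
    qed
    have Iint: "integrable lborel (\<lambda>x. \<eta> x * k x)" if "continuous_on UNIV k" for k :: "real \<Rightarrow> real"
      by (rule integrable_continuous_compact_support[of "-N" N])
         (auto intro!: continuous_intros continuous_on_subset[OF \<eta>c] continuous_on_subset[OF that] simp: \<eta>0)
    have zero: "k x = 0" if k: "continuous_on UNIV k" and nn: "\<And>x. 0 \<le> k x"
      and i: "(LINT x|lborel. \<eta> x * k x) = 0" and x: "x \<in> {-N<..<N}" for k :: "real \<Rightarrow> real" and x
    proof -
      have "AE x in lborel. \<eta> x * k x = 0"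
        using i Iint[OF k] nn by (subst (asm) integral_nonneg_eq_0_iff_AE) (auto simp: \<eta>_def)
      then have "\<eta> x * k x = 0"
        by (rule continuous_AE_zero[rotated]) (intro continuous_intros k \<eta>c)
      then show ?thesis using \<eta>pos[OF x] by simp
    qed
    have const: "v a = v b"
      if v: "continuous_on UNIV v" and tv: "\<And>\<psi>. continuous_on UNIV \<psi> \<Longrightarrow> (\<And>x. x \<notin> {-N<..<N} \<Longrightarrow> \<psi> x = 0)
        \<Longrightarrow> (LINT x|lborel. \<psi> x) = 0 \<Longrightarrow> (LINT x|lborel. \<psi> x * v x) = 0" for v :: "real \<Rightarrow> real"
    proof -
      define I where "I = (LINT x|lborel. \<eta> x)"
      have "I \<noteq> 0"
        using zero[of "\<lambda>_. 1" 0] N by (auto simp: I_def)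
      define m where "m = (LINT x|lborel. \<eta> x * v x) / I"
      define \<psi> where "\<psi> x = \<eta> x * (v x - m)" for x
      have vm: "continuous_on UNIV (\<lambda>x. v x - m)" by (intro continuous_intros v)
      have \<psi>c: "continuous_on UNIV \<psi>" unfolding \<psi>_def by (intro continuous_intros \<eta>c v)
      have "(LINT x|lborel. \<psi> x) = (LINT x|lborel. \<eta> x * v x) - (LINT x|lborel. \<eta> x * m)"
        unfolding \<psi>_def right_diff_distrib
        by (intro Bochner_Integration.integral_diff Iint v) simp
      also have "\<dots> = 0" using \<open>I \<noteq> 0\<close> by (simp add: m_def I_def)
      finally have \<psi>0: "(LINT x|lborel. \<psi> x) = 0" .
      have "(LINT x|lborel. \<psi> x * v x) = 0" by (rule tv[OF \<psi>c _ \<psi>0]) (simp add: \<psi>_def \<eta>0)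
      moreover have "(LINT x|lborel. \<eta> x * (v x - m)\<^sup>2) = (LINT x|lborel. \<psi> x * v x - m * \<psi> x)"
        by (intro Bochner_Integration.integral_cong) (auto simp: \<psi>_def power2_eq_square algebra_simps)
      moreover have "\<dots> = (LINT x|lborel. \<psi> x * v x) - (LINT x|lborel. m * \<psi> x)"
      proof (rule Bochner_Integration.integral_diff)
        have "integrable lborel (\<lambda>x. \<eta> x * ((v x - m) * v x))" by (intro Iint continuous_intros v)
        then show "integrable lborel (\<lambda>x. \<psi> x * v x)" by (simp add: \<psi>_def mult.assoc)
        show "integrable lborel (\<lambda>x. m * \<psi> x)" unfolding \<psi>_def by (intro integrable_mult_right Iint vm)
      qed
      ultimately have "(LINT x|lborel. \<eta> x * (v x - m)\<^sup>2) = 0" using \<psi>0 by simp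
      moreover have "continuous_on UNIV (\<lambda>x. (v x - m)\<^sup>2)" by (intro continuous_intros v)
      ultimately have "(v x - m)\<^sup>2 = 0" if "x \<in> {-N<..<N}" for x
        using zero[of "\<lambda>x. (v x - m)\<^sup>2" x] that by simp
      from this[of a] this[of b] show ?thesis using N by simp
    qed
    \<comment> \<open>The test functions are real, hence real and imaginary parts are treated
      separately.\<close>
    have "u a = u b"
    proof (rule complex_eqI)
      have int: "integrable lborel (\<lambda>x. \<psi> x *\<^sub>R u x)"
        if "continuous_on UNIV \<psi>" "\<And>x. x \<notin> {-N<..<N} \<Longrightarrow> \<psi> x = 0" for \<psi> :: "real \<Rightarrow> real"
        by (rule integrable_continuous_compact_support[of "-N" N])
           (auto intro!: continuous_intros continuous_on_subset[OF that(1)] continuous_on_subset[OF uc] simp: that(2))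
      show "Re (u a) = Re (u b)"
      proof (rule const)
        fix \<psi> :: "real \<Rightarrow> real"
        assume \<psi>: "continuous_on UNIV \<psi>" "\<And>x. x \<notin> {-N<..<N} \<Longrightarrow> \<psi> x = 0" "(LINT x|lborel. \<psi> x) = 0"
        show "(LINT x|lborel. \<psi> x * Re (u x)) = 0"
          using test[OF \<psi>] integral_Re[OF int[OF \<psi>(1,2)]] by simp
      qed (intro continuous_intros uc)
      show "Im (u a) = Im (u b)"
      proof (rule const)
        fix \<psi> :: "real \<Rightarrow> real"
        assume \<psi>: "continuous_on UNIV \<psi>" "\<And>x. x \<notin> {-N<..<N} \<Longrightarrow> \<psi> x = 0" "(LINT x|lborel. \<psi> x) = 0"
        show "(LINT x|lborel. \<psi> x * Im (u x)) = 0"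
          using test[OF \<psi>] integral_Im[OF int[OF \<psi>(1,2)]] by simp
      qed (intro continuous_intros uc)
    qed
    then have "f b - f a = G b - G a" using N by (simp add: u_def cl_id algebra_simps)
    also have "\<dots> = (LINT t:{a..b}|lborel. g t)" using N by (intro ac_on_diff[OF G]) auto
    finally show ?thesis .
  qed
  show ?thesis unfolding ac_def
  proof (intro allI impI ac_onI_diff[OF gI])
    fix a b x :: real assume "x \<in> {a..b}"
    then show "f x - f a = (LINT t:{a..x}|lborel. g t)"
      by (intro local[of "\<bar>a\<bar> + \<bar>x\<bar> + 1"]) auto
  qed
qed

text \<open>Integration by parts on an interval containing the support of the test function; the
  boundary terms vanish there.\<close>

lemma ac_imp_weak_L2_deriv:
  assumes f: "f \<in> L2" and g: "g \<in> L2" and F: "ac f g"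
  shows "weak_L2_deriv f g"
  unfolding weak_L2_deriv_def
proof (intro conjI allI impI g, elim conjE)
  fix \<phi> :: "real \<Rightarrow> real"
  assume C1: "\<phi> C1_differentiable_on UNIV" and cp: "compact (closure {x. \<phi> x \<noteq> 0})"
  obtain \<psi> where \<psi>: "\<And>x. (\<phi> has_vector_derivative \<psi> x) (at x)" "continuous_on UNIV \<psi>"
    using C1 by (auto simp: C1_differentiable_on_def)
  have der: "deriv \<phi> x = \<psi> x" for x
    using \<psi>(1)[of x] by (intro DERIV_imp_deriv) (simp add: has_real_derivative_iff_has_vector_derivative)
  obtain M where M: "\<And>x. \<phi> x \<noteq> 0 \<Longrightarrow> \<bar>x\<bar> \<le> M"
  proof -
    have "bounded {x. \<phi> x \<noteq> 0}" using cp compact_imp_bounded bounded_subset closure_subset by blast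
    then show ?thesis using that by (auto simp: bounded_iff)
  qed
  define N where "N = \<bar>M\<bar> + 1"
  have N: "-N \<le> N" by (simp add: N_def)
  have \<phi>0: "\<phi> x = 0" if "\<bar>x\<bar> > \<bar>M\<bar>" for x
    by (rule ccontr) (use M[of x] that in auto)
  have \<psi>0: "\<psi> x = 0" if "\<bar>x\<bar> > \<bar>M\<bar>" for x
  proof -
    have "((\<lambda>_. 0) has_vector_derivative 0) (at x)" by simp
    then have "(\<phi> has_vector_derivative 0) (at x)"
      by (rule has_vector_derivative_transform_within_open[of _ _ _ "- {-\<bar>M\<bar>..\<bar>M\<bar>}"])
         (use that \<phi>0 in auto)
    then show ?thesis using \<psi>(1) vector_derivative_unique_at by blast
  qed
  have ac\<phi>: "ac_on (-N) N (\<lambda>x. complex_of_real (\<phi> x)) (\<lambda>x. complex_of_real (\<psi> x))"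
  proof (rule ac_on_C1)
    show "((\<lambda>x. complex_of_real (\<phi> x)) has_vector_derivative complex_of_real (\<psi> x)) (at x within {-N..N})" for x
      by (rule bounded_linear.has_vector_derivative[OF bounded_linear_of_real
            has_vector_derivative_at_within[OF \<psi>(1)]])
    show "continuous_on {-N..N} (\<lambda>x. complex_of_real (\<psi> x))"
      by (intro continuous_intros continuous_on_subset[OF \<psi>(2)]) auto
  qed
  have fN: "ac_on (-N) N f g" using F N by (simp add: ac_def)
  have i1: "set_integrable lborel {-N..N} (\<lambda>x. of_real (\<psi> x) * f x)"
    by (rule set_integrable_mult_continuous[OF ac_on_integrable[OF ac\<phi>] ac_on_continuous[OF fN]])
  have i2: "set_integrable lborel {-N..N} (\<lambda>x. of_real (\<phi> x) * g x)"
    using set_integrable_mult_continuous[OF ac_on_integrable[OF fN] ac_on_continuous[OF ac\<phi>]] by (simp add: mult.commute)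
  have "\<phi> N = 0" "\<phi> (-N) = 0" by (auto intro!: \<phi>0 simp: N_def)
  then have "(LINT x:{-N..N}|lborel. of_real (\<psi> x) * f x + of_real (\<phi> x) * g x) = 0"
    using ac_on_diff[OF ac_product[OF N ac\<phi> fN], of "-N" N] N by simp
  then have "(LINT x:{-N..N}|lborel. of_real (\<psi> x) * f x) = - (LINT x:{-N..N}|lborel. of_real (\<phi> x) * g x)"
    using set_integral_add(2)[OF i1 i2] by (simp add: add_eq_0_iff)
  moreover have "(LINT x:{-N..N}|lborel. of_real (\<psi> x) * f x) = (LINT x|lborel. of_real (\<psi> x) * f x)"
    by (rule set_integral_eq_integral_support) (auto simp: \<psi>0 N_def)
  moreover have "(LINT x:{-N..N}|lborel. of_real (\<phi> x) * g x) = (LINT x|lborel. of_real (\<phi> x) * g x)"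
    by (rule set_integral_eq_integral_support) (auto simp: \<phi>0 N_def)
  ultimately show "(LINT x|lborel. deriv \<phi> x *\<^sub>R f x) = - (LINT x|lborel. \<phi> x *\<^sub>R g x)"
    by (simp add: der scaleR_conv_of_real)
qed

section \<open>The Sobolev space\<close>

lemma ac_add: "ac F f \<Longrightarrow> ac G g \<Longrightarrow> ac (F + G) (f + g)"
  unfolding ac_def plus_fun_def
proof (intro allI impI ac_onI_diff)
  fix a b x :: real
  assume F: "\<forall>a b. a \<le> b \<longrightarrow> ac_on a b F f" and G: "\<forall>a b. a \<le> b \<longrightarrow> ac_on a b G g" and ab: "a \<le> b"
  have F': "ac_on a b F f" and G': "ac_on a b G g" using F G ab by auto
  show "set_integrable lborel {a..b} (\<lambda>x. f x + g x)"
    by (intro set_integral_add ac_on_integrable[OF F'] ac_on_integrable[OF G'])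
  assume x: "x \<in> {a..b}"
  have "set_integrable lborel {a..x} f" "set_integrable lborel {a..x} g"
    using F G x by (auto intro: ac_on_integrable[of a x F] ac_on_integrable[of a x G])
  then show "F x + G x - (F a + G a) = (LINT t:{a..x}|lborel. f t + g t)"
    using ac_on_diff[OF F', of a x] ac_on_diff[OF G', of a x] x by (simp add: set_integral_add(2) add_diff_add)
qed

lemma ac_const: "ac (\<lambda>_. c) (\<lambda>_. 0)"
  unfolding ac_def by (intro allI impI ac_on_C1) auto

lemma ac_scale: "ac F f \<Longrightarrow> ac (\<lambda>x. c * F x) (\<lambda>x. c * f x)"
  using ac_mult[OF ac_const[of c], of F f] by simp

lemma H1_deriv: "f \<in> H1 \<Longrightarrow> weak_L2_deriv f (H1_deriv f)"
  using someI_ex[of "weak_L2_deriv f"] by (simp add: H1_deriv_def H1_def)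

lemma H1_L2: "f \<in> H1 \<Longrightarrow> f \<in> L2"
  by (simp add: H1_def)

lemma H1_continuous: "f \<in> H1 \<Longrightarrow> continuous_on UNIV f"
  by (simp add: H1_def)

lemma H1_deriv_L2: "f \<in> H1 \<Longrightarrow> H1_deriv f \<in> L2"
  using H1_deriv by (simp add: weak_L2_deriv_def)

lemma H1_ac: "f \<in> H1 \<Longrightarrow> ac f (H1_deriv f)"
  by (intro weak_L2_deriv_imp_ac H1_continuous H1_deriv)

lemma H1I: "\<lbrakk>f \<in> L2; g \<in> L2; ac f g\<rbrakk> \<Longrightarrow> f \<in> H1"
  unfolding H1_def using ac_continuous ac_imp_weak_L2_deriv by blast

text \<open>Densities are unique almost everywhere, so the arbitrary choice made by
  \<open>H1_deriv\<close> agrees with any explicitly known derivative under Lebesgue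
  integrals.\<close>

lemma H1_deriv_AE: "\<lbrakk>f \<in> L2; g \<in> L2; ac f g\<rbrakk> \<Longrightarrow> AE x in lborel. H1_deriv f x = g x"
  by (rule ac_unique[OF H1_ac[OF H1I]])

lemma subspace_H1: "cfun.subspace H1"
proof (rule cfun.subspaceI)
  show "0 \<in> H1" using H1I[OF L2.V_closed(1) L2.V_closed(1)] ac_const[of 0] by (simp add: zero_fun_def)
  show "f + g \<in> H1" if "f \<in> H1" "g \<in> H1" for f g
    using that by (intro H1I[OF _ _ ac_add[OF H1_ac H1_ac]]) (auto intro: H1_L2 H1_deriv_L2)
  show "(\<lambda>x. c * f x) \<in> H1" if "f \<in> H1" for c f
    using H1I[OF L2.V_closed(3) L2.V_closed(3)] ac_scale[OF H1_ac, of f c] that H1_L2 H1_deriv_L2 by blast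
qed

lemma H1_deriv_add:
  assumes "f \<in> H1" "g \<in> H1" shows "AE x in lborel. H1_deriv (f + g) x = H1_deriv f x + H1_deriv g x"
  using H1_deriv_AE[OF _ _ ac_add[OF H1_ac[OF assms(1)] H1_ac[OF assms(2)]]] assms
  by (simp add: H1_L2 H1_deriv_L2 L2.V_closed(2))

lemma H1_deriv_scale:
  assumes "f \<in> H1" shows "AE x in lborel. H1_deriv (\<lambda>x. c * f x) x = c * H1_deriv f x"
  using H1_deriv_AE[OF L2.V_closed(3) L2.V_closed(3)] ac_scale[OF H1_ac, of f c] assms H1_L2 H1_deriv_L2 by blast

lemma L2_inner_cong_AE:
  assumes "f \<in> L2" "f' \<in> L2" "g \<in> L2" "g' \<in> L2"
    and "AE x in lborel. f x = f' x" "AE x in lborel. g x = g' x"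
  shows "L2_inner f g = L2_inner f' g'"
  unfolding L2_inner_def
proof (rule integral_cong_AE)
  show "(\<lambda>x. f x * cnj (g x)) \<in> borel_measurable lborel" "(\<lambda>x. f' x * cnj (g' x)) \<in> borel_measurable lborel"
    by (rule borel_measurable_integrable[OF L2_integrable_inner[OF assms(1,3)]],
        rule borel_measurable_integrable[OF L2_integrable_inner[OF assms(2,4)]])
  show "AE x in lborel. f x * cnj (g x) = f' x * cnj (g' x)" using assms(5,6) by eventually_elim simp
qed

lemma L2_qf_cong_AE:
  "\<lbrakk>f \<in> L2; g \<in> L2; AE x in lborel. f x = g x\<rbrakk> \<Longrightarrow> L2.qf f = L2.qf g"
  by (simp add: L2.qf_def L2_inner_cong_AE[of f g f g])

interpretation H1D: hermitian_form "\<lambda>c (f::real \<Rightarrow> complex) x. c * f x" H1 "\<lambda>f g. L2_inner (H1_deriv f) (H1_deriv g)"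
proof
  show "cfun.subspace H1" by (rule subspace_H1)
  note S = cfun.subspace_add[OF subspace_H1] cfun.subspace_scale[OF subspace_H1]
  show "L2_inner (H1_deriv (x + y)) (H1_deriv z) = L2_inner (H1_deriv x) (H1_deriv z) + L2_inner (H1_deriv y) (H1_deriv z)"
    if "x \<in> H1" "y \<in> H1" "z \<in> H1" for x y z
  proof -
    have "L2_inner (H1_deriv (x + y)) (H1_deriv z) = L2_inner (H1_deriv x + H1_deriv y) (H1_deriv z)"
      using that H1_deriv_add[of x y] by (intro L2_inner_cong_AE) (auto intro: H1_deriv_L2 S)
    then show ?thesis using that by (simp add: L2.sesqui H1_deriv_L2)
  qed
  show "L2_inner (H1_deriv (\<lambda>t. c * x t)) (H1_deriv z) = c * L2_inner (H1_deriv x) (H1_deriv z)"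
    if "x \<in> H1" "z \<in> H1" for c x z
  proof -
    have "L2_inner (H1_deriv (\<lambda>t. c * x t)) (H1_deriv z) = L2_inner (\<lambda>t. c * H1_deriv x t) (H1_deriv z)"
      using that H1_deriv_scale[of x c] by (intro L2_inner_cong_AE) (auto intro: H1_deriv_L2 S)
    then show ?thesis using that by (simp add: L2.scale_left H1_deriv_L2)
  qed
  show "L2_inner (H1_deriv y) (H1_deriv x) = cnj (L2_inner (H1_deriv x) (H1_deriv y))"
    if "x \<in> H1" "y \<in> H1" for x y
    using that by (intro L2.hermitian H1_deriv_L2)
qed

lemma H1D_qf: "H1D.qf f = L2.qf (H1_deriv f)"
  by (simp add: H1D.qf_def L2.qf_def)

lemma H1D_nonneg: "f \<in> H1 \<Longrightarrow> 0 \<le> H1D.qf f"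
  by (simp add: H1D_qf L2_qf)

lemma AE_zero_H1:
  assumes f: "f \<in> H1" and "L2_inner f f = 0" shows "f = 0"
proof -
  have "(LINT x|lborel. (cmod (f x))\<^sup>2) = 0" using assms(2) L2_qf[of f] by (simp add: L2.qf_def)
  moreover have "integrable lborel (\<lambda>x. (cmod (f x))\<^sup>2)" using H1_L2[OF f] by (simp add: L2_def)
  ultimately have "AE x in lborel. (cmod (f x))\<^sup>2 = 0"
    by (subst (asm) integral_nonneg_eq_0_iff_AE) auto
  then have "AE x in lborel. f x = 0" by simp
  then have "f x = 0" for x by (rule continuous_AE_zero[OF H1_continuous[OF f]])
  then show ?thesis by (simp add: fun_eq_iff)
qed

text \<open>The quadratic form of \<open>-d\<^sup>2/dx\<^sup>2 + k\<^sup>2\<close>. It is also the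
  squared norm of \<open>f' + k f\<close>, by \<open>H1_energy_eq\<close>.\<close>

definition H1_energy :: "real \<Rightarrow> (real \<Rightarrow> complex) \<Rightarrow> real" where
  "H1_energy k f = H1D.qf f + k\<^sup>2 * L2.qf f"

context
  fixes f :: "real \<Rightarrow> complex"
  assumes f: "f \<in> H1"
begin

private abbreviation (input) "g \<equiv> H1_deriv f"
private abbreviation (input) "h \<equiv> \<lambda>x. H1_deriv f x * cnj (f x) + f x * cnj (H1_deriv f x)"

lemma H1_square_ac: "ac (\<lambda>x. f x * cnj (f x)) h"
  by (intro ac_mult ac_cnj H1_ac f)

lemma H1_square_deriv_integrable: "integrable lborel h"
  by (intro Bochner_Integration.integrable_add L2_integrable_inner H1_L2 H1_deriv_L2 f)

text \<open>The derivative of the squared modulus is a sum of products of two square-integrable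
  functions, so the squared modulus varies by at most the L1 norm of this derivative.\<close>

lemma H1_bounded: "\<exists>M. \<forall>x. cmod (f x) \<le> M"
proof -
  define M where "M = (cmod (f 0))\<^sup>2 + (LINT x|lborel. cmod (h x))"
  have diff: "cmod (f b * cnj (f b) - f a * cnj (f a)) \<le> (LINT x|lborel. cmod (h x))" if "a \<le> b" for a b
  proof -
    have ab: "ac_on a b (\<lambda>x. f x * cnj (f x)) h" using H1_square_ac that by (simp add: ac_def)
    have "f b * cnj (f b) - f a * cnj (f a) = (LINT x:{a..b}|lborel. h x)"
      using ac_on_diff[OF ab, of a b] that by simp
    also have "cmod \<dots> \<le> (LINT x|lborel. cmod (indicator {a..b} x *\<^sub>R h x))"
      unfolding set_lebesgue_integral_def by (rule integral_norm_bound)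
    also have "\<dots> \<le> (LINT x|lborel. cmod (h x))"
    proof (rule integral_mono)
      show "integrable lborel (\<lambda>x. cmod (indicator {a..b} x *\<^sub>R h x))"
        by (intro integrable_norm integrable_mult_indicator H1_square_deriv_integrable) simp
      show "integrable lborel (\<lambda>x. cmod (h x))" by (rule integrable_norm[OF H1_square_deriv_integrable])
    qed (auto simp: indicator_def)
    finally show ?thesis .
  qed
  have sq: "f x * cnj (f x) = complex_of_real ((cmod (f x))\<^sup>2)" for x by (simp add: complex_norm_square del: of_real_power)
  have "(cmod (f x))\<^sup>2 \<le> M" for x
  proof -
    have "cmod (f x * cnj (f x) - f 0 * cnj (f 0)) \<le> (LINT x|lborel. cmod (h x))"
      using diff[of 0 x] diff[of x 0] by (cases "0 \<le> x") (auto simp: norm_minus_commute)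
    then have "\<bar>(cmod (f x))\<^sup>2 - (cmod (f 0))\<^sup>2\<bar> \<le> (LINT x|lborel. cmod (h x))"
      unfolding sq by (metis norm_of_real of_real_diff)
    then show ?thesis by (simp add: M_def)
  qed
  then have "cmod (f x) \<le> sqrt M" for x by (intro real_le_rsqrt)
  then show ?thesis by blast
qed

text \<open>The weights \<open>1 - (x / n)\<^sup>2\<close> vanish at the ends of
  \<open>{-n..n}\<close> and have slope at most \<open>2 / n\<close>. Integration by parts against
  them leaves no boundary terms, and the remaining integral is at most \<open>2 / n\<close> times
  the squared norm of \<open>f\<close>.\<close>

lemma H1_square_deriv_integral: "(LINT x|lborel. h x) = 0"
proof -
  define w where "w n x = complex_of_real (1 - (x / real n)\<^sup>2)" for n :: nat and x
  define w' where "w' n x = complex_of_real (- (2 * x / (real n)\<^sup>2))" for n :: nat and x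
  define I where "I n = {- real n..real n}" for n :: nat
  have w: "ac_on (- real n) (real n) (w n) (w' n)" for n
  proof (rule ac_on_C1)
    fix x
    have "((\<lambda>x. 1 - (x / real n)\<^sup>2) has_vector_derivative - (2 * x / (real n)\<^sup>2)) (at x)"
      unfolding has_real_derivative_iff_has_vector_derivative[symmetric]
      by (cases "n = 0") (auto intro!: derivative_eq_intros simp: power2_eq_square)
    from bounded_linear.has_vector_derivative[OF bounded_linear_of_real
        has_vector_derivative_at_within[OF this]]
    show "(w n has_vector_derivative w' n x) (at x within {- real n..real n})"
      unfolding w_def[abs_def] w'_def[abs_def] .
    show "continuous_on {- real n..real n} (w' n)"
      by (cases "n = 0") (auto intro!: continuous_intros simp: w'_def[abs_def])
  qed
  have eq: "(LINT x:I n|lborel. w n x * h x) = - (LINT x:I n|lborel. w' n x * (f x * cnj (f x)))" if n: "0 < n" for n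
  proof -
    have A: "ac_on (- real n) (real n) (\<lambda>x. f x * cnj (f x)) h" using H1_square_ac by (simp add: ac_def)
    have i1: "set_integrable lborel (I n) (\<lambda>x. w' n x * (f x * cnj (f x)))"
      unfolding I_def by (rule set_integrable_mult_continuous[OF ac_on_integrable[OF w] ac_on_continuous[OF A]])
    have i2: "set_integrable lborel (I n) (\<lambda>x. w n x * h x)"
      unfolding I_def using set_integrable_mult_continuous[OF ac_on_integrable[OF A] ac_on_continuous[OF w]]
      by (simp add: mult.commute)
    have "(LINT x:I n|lborel. w' n x * (f x * cnj (f x)) + w n x * h x) = 0"
      using ac_on_diff[OF ac_product[OF _ w A], where x="- real n" and y="real n"] n by (simp add: I_def w_def)
    then show ?thesis using set_integral_add(2)[OF i1 i2] by (simp add: add_eq_0_iff2)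
  qed
  have w1: "cmod (w n x) \<le> 1" if "x \<in> I n" for n x
  proof -
    have "\<bar>x / real n\<bar> \<le> 1" using that by (cases "n = 0") (auto simp: I_def abs_le_iff field_simps)
    then have "(x / real n)\<^sup>2 \<le> 1" by (simp add: abs_square_le_1)
    then have "\<bar>1 - (x / real n)\<^sup>2\<bar> \<le> 1" by (simp add: abs_le_iff)
    then show ?thesis unfolding w_def norm_of_real .
  qed
  have lim1: "(\<lambda>n. LINT x:I n|lborel. w n x * h x) \<longlonglongrightarrow> (LINT x|lborel. h x)"
    unfolding set_lebesgue_integral_def
  proof (rule integral_dominated_convergence[where w="\<lambda>x. cmod (h x)"])
    have [measurable]: "f \<in> borel_measurable borel" "H1_deriv f \<in> borel_measurable borel"
      using H1_L2[OF f] H1_deriv_L2[OF f] by (auto simp: L2_def)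
    have hm: "h \<in> borel_measurable lborel" using H1_square_deriv_integrable by auto
    have [measurable]: "w n \<in> borel_measurable borel" for n
      unfolding w_def[abs_def] by measurable
    have [measurable]: "h \<in> borel_measurable borel" using hm by simp
    show "(\<lambda>x. indicator (I n) x *\<^sub>R (w n x * h x)) \<in> borel_measurable lborel" for n
      unfolding I_def by measurable
    show "h \<in> borel_measurable lborel" by (rule hm)
    show "integrable lborel (\<lambda>x. cmod (h x))" by (rule integrable_norm[OF H1_square_deriv_integrable])
    show "AE x in lborel. norm (indicator (I n) x *\<^sub>R (w n x * h x)) \<le> cmod (h x)" for n
    proof (rule AE_I2)
      fix x
      show "norm (indicator (I n) x *\<^sub>R (w n x * h x)) \<le> cmod (h x)"
        using w1[of x n] mult_right_mono[of "cmod (w n x)" 1 "cmod (h x)"]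
        by (cases "x \<in> I n") (auto simp: norm_mult)
    qed
    show "AE x in lborel. (\<lambda>n. indicator (I n) x *\<^sub>R (w n x * h x)) \<longlonglongrightarrow> h x"
    proof (rule AE_I2)
      fix x
      obtain m :: nat where m: "\<bar>x\<bar> \<le> real m" using real_arch_simple by blast
      have "(\<lambda>n. 1 - (x / real n)\<^sup>2) \<longlonglongrightarrow> 1 - 0\<^sup>2"
        by (intro tendsto_intros lim_const_over_n)
      then have "(\<lambda>n. w n x) \<longlonglongrightarrow> complex_of_real (1 - 0\<^sup>2)"
        unfolding w_def by (rule tendsto_of_real)
      then have "(\<lambda>n. w n x * h x) \<longlonglongrightarrow> complex_of_real (1 - 0\<^sup>2) * h x"
        by (rule tendsto_mult_right)
      moreover have "\<forall>\<^sub>F n in sequentially. w n x * h x = indicator (I n) x *\<^sub>R (w n x * h x)"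
        using eventually_ge_at_top[of m] by eventually_elim (use m in \<open>auto simp: I_def indicator_def\<close>)
      ultimately show "(\<lambda>n. indicator (I n) x *\<^sub>R (w n x * h x)) \<longlonglongrightarrow> h x"
        using Lim_transform_eventually by force
    qed
  qed
  moreover have "(\<lambda>n. LINT x:I n|lborel. w n x * h x) \<longlonglongrightarrow> 0"
  proof (rule Lim_null_comparison)
    show "\<forall>\<^sub>F n in sequentially. norm (LINT x:I n|lborel. w n x * h x) \<le> 2 * L2.qf f / real n"
    proof (rule eventually_sequentiallyI[of 1])
      fix n :: nat assume n: "1 \<le> n"
      have "norm (LINT x:I n|lborel. w n x * h x) = norm (LINT x:I n|lborel. w' n x * (f x * cnj (f x)))"
        using eq[of n] n by simp
      also have "\<dots> \<le> (LINT x|lborel. 2 / real n * (cmod (f x))\<^sup>2)"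
        unfolding set_lebesgue_integral_def
      proof (rule Bochner_Integration.integral_norm_bound_integral)
        have A: "ac_on (- real n) (real n) (\<lambda>x. f x * cnj (f x)) h" using H1_square_ac by (simp add: ac_def)
        show "integrable lborel (\<lambda>x. indicator (I n) x *\<^sub>R (w' n x * (f x * cnj (f x))))"
          using set_integrable_mult_continuous[OF ac_on_integrable[OF w] ac_on_continuous[OF A]]
          by (simp add: I_def set_integrable_def)
        show "integrable lborel (\<lambda>x. 2 / real n * (cmod (f x))\<^sup>2)" using H1_L2[OF f] by (simp add: L2_def)
        fix x
        show "norm (indicator (I n) x *\<^sub>R (w' n x * (f x * cnj (f x)))) \<le> 2 / real n * (cmod (f x))\<^sup>2"
        proof (cases "x \<in> I n")
          case True
          have "cmod (w' n x) = 2 * \<bar>x\<bar> / (real n)\<^sup>2" unfolding w'_def norm_of_real by (simp add: abs_mult)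
          also have "\<dots> \<le> 2 * real n / (real n)\<^sup>2"
            using True by (intro divide_right_mono) (auto simp: I_def)
          also have "\<dots> = 2 / real n" using n by (simp add: power2_eq_square)
          finally have "cmod (w' n x) * (cmod (f x))\<^sup>2 \<le> 2 / real n * (cmod (f x))\<^sup>2"
            by (rule mult_right_mono) simp
          then show ?thesis using True by (simp add: norm_mult power2_eq_square)
        qed simp
      qed
      also have "\<dots> = 2 * L2.qf f / real n" by (simp add: L2_qf)
      finally show "norm (LINT x:I n|lborel. w n x * h x) \<le> 2 * L2.qf f / real n" .
    qed
    show "(\<lambda>n. 2 * L2.qf f / real n) \<longlonglongrightarrow> 0" by (rule lim_const_over_n)
  qed
  ultimately show ?thesis by (rule LIMSEQ_unique)
qed

text \<open>The cross term vanishes, being \<open>k\<close> times the integral of the derivative of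
  the squared modulus of \<open>f\<close>.\<close>

lemma H1_energy_eq: "L2.qf (\<lambda>x. H1_deriv f x + of_real k * f x) = H1_energy k f"
proof -
  have L: "H1_deriv f \<in> L2" "f \<in> L2" "(\<lambda>x. of_real k * f x) \<in> L2"
    using H1_deriv_L2[OF f] H1_L2[OF f] L2.V_closed(3) by auto
  have "L2_inner (H1_deriv f) f + cnj (L2_inner (H1_deriv f) f) = 0"
  proof -
    have "(LINT x|lborel. h x) = L2_inner (H1_deriv f) f + L2_inner f (H1_deriv f)"
      unfolding L2_inner_def by (intro Bochner_Integration.integral_add L2_integrable_inner L)
    then show ?thesis using H1_square_deriv_integral L2.hermitian[OF L(1,2)] by simp
  qed
  then have "Re (L2_inner (H1_deriv f) f + cnj (L2_inner (H1_deriv f) f)) = 0" by simp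
  then have "Re (L2_inner (H1_deriv f) f) = 0" by simp
  then show ?thesis
    using L2.qf_add[OF L(1,3)] L2.scale_right[OF L(2,1), of "of_real k"] L2.qf_scale[OF L(2), of "of_real k"]
    by (simp add: H1_energy_def plus_fun_def H1D_qf)
qed

end

subsection \<open>Representation by a one-sided exponential kernel\<close>

text \<open>Green function of the first-order operator \<open>d/dx + k\<close>. The kernel of
  \<open>L\<^sub>k\<close> factors through it, see \<open>integral_kern_kern\<close>.\<close>

definition kern :: "real \<Rightarrow> real \<Rightarrow> real \<Rightarrow> real" where
  "kern k x z = (if z \<le> x then exp (- k * (x - z)) else 0)"

lemma kern_nonneg: "0 \<le> kern k x z"
  by (simp add: kern_def)

lemma kern_le_1: "0 \<le> k \<Longrightarrow> kern k x z \<le> 1"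
  by (simp add: kern_def)

lemma kern_measurable [measurable]:
  "(\<lambda>p. kern k (fst p) (snd p)) \<in> borel_measurable (borel \<Otimes>\<^sub>M borel)"
  "kern k x \<in> borel_measurable borel" "(\<lambda>x. kern k x z) \<in> borel_measurable borel"
  unfolding kern_def[abs_def] by measurable

lemma nn_integral_kern:
  assumes k: "0 < k" shows "(\<integral>\<^sup>+z. ennreal (kern k x z) \<partial>lborel) = ennreal (1 / k)"
proof -
  have "(\<integral>\<^sup>+z. ennreal (kern k x z) \<partial>lborel) = ennreal \<bar>-1\<bar> * (\<integral>\<^sup>+t. ennreal (kern k x (x + (-1) * t)) \<partial>lborel)"
    by (subst nn_integral_real_affine[where c="-1" and t=x]) auto
  also have "\<dots> = (\<integral>\<^sup>+t. ennreal (exp (- k * t)) * indicator {0..} t \<partial>lborel)"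
    by (auto simp: kern_def indicator_def intro!: nn_integral_cong)
  also have "\<dots> = ennreal (0 - (- exp (- k * 0) / k))"
  proof (rule nn_integral_FTC_atLeast)
    show "DERIV (\<lambda>t. - exp (- k * t) / k) t :> exp (- k * t)" for t
      using k by (auto intro!: derivative_eq_intros)
    have "LIM t at_top. k * t :> at_top"
      using k by (intro filterlim_tendsto_pos_mult_at_top[OF tendsto_const]) (auto simp: filterlim_ident)
    then have "((\<lambda>t. exp (- (k * t))) \<longlongrightarrow> 0) at_top"
      by (intro filterlim_compose[OF exp_at_bot] filterlim_uminus_at_top[THEN iffD1])
    then have "((\<lambda>t. - exp (- k * t) / k) \<longlongrightarrow> - 0 / k) at_top"
      using k by (intro tendsto_intros) auto
    then show "((\<lambda>t. - exp (- k * t) / k) \<longlongrightarrow> 0) at_top" by simp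
  qed auto
  finally show ?thesis by simp
qed

lemma has_integral_kern:
  assumes k: "0 < k"
  shows "integrable lborel (kern k x)" "(LINT z|lborel. kern k x z) = 1 / k"
proof -
  show "integrable lborel (kern k x)"
    by (rule integrableI_nonneg) (auto simp: kern_nonneg nn_integral_kern[OF k])
  then have "ennreal (LINT z|lborel. kern k x z) = ennreal (1 / k)"
    using nn_integral_kern[OF k, of x] by (subst nn_integral_eq_integral[symmetric]) (auto simp: kern_nonneg)
  then show "(LINT z|lborel. kern k x z) = 1 / k"
    using k by (subst (asm) ennreal_inj) (auto intro!: integral_nonneg_AE simp: kern_nonneg)
qed

lemma kern_power2: "(kern k x z)\<^sup>2 = kern (2 * k) x z"
  by (simp add: kern_def power2_eq_square flip: exp_add)

lemma kern_L2:
  assumes k: "0 < k"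
  shows "(\<lambda>z. complex_of_real (kern k x z)) \<in> L2" "L2.qf (\<lambda>z. complex_of_real (kern k x z)) = 1 / (2 * k)"
  using has_integral_kern[of "2 * k" x] k by (auto simp: L2_def L2_qf kern_power2)

context
  fixes f :: "real \<Rightarrow> complex" and k :: real
  assumes f: "f \<in> H1" and k: "0 < k"
begin

private abbreviation (input) "p \<equiv> \<lambda>z. H1_deriv f z + complex_of_real k * f z"

lemma H1_symbol_L2: "p \<in> L2"
  using L2.V_closed(2)[OF H1_deriv_L2[OF f] L2.V_closed(3)[OF H1_L2[OF f]], of "of_real k"]
  by (simp add: plus_fun_def)

text \<open>Variation of constants: \<open>exp (k * z) * f z\<close> has the derivative
  \<open>exp (k * z) * (f' z + k * f z)\<close>. On integrating from \<open>-n\<close> to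
  \<open>x\<close>, the term at \<open>-n\<close> decays because \<open>f\<close> is
  bounded.\<close>

lemma H1_representation: "f x = (LINT z|lborel. complex_of_real (kern k x z) * p z)"
proof -
  define e where "e z = complex_of_real (exp (k * z))" for z
  define e' where "e' z = complex_of_real (k * exp (k * z))" for z
  have E: "ac e e'" unfolding ac_def
  proof (intro allI impI ac_on_C1)
    fix a b z :: real
    have "((\<lambda>z. exp (k * z)) has_vector_derivative k * exp (k * z)) (at z)"
      unfolding has_real_derivative_iff_has_vector_derivative[symmetric]
      by (auto intro!: derivative_eq_intros)
    from bounded_linear.has_vector_derivative[OF bounded_linear_of_real has_vector_derivative_at_within[OF this]]
    show "(e has_vector_derivative e' z) (at z within {a..b})"
      unfolding e_def[abs_def] e'_def[abs_def] .
    show "continuous_on {a..b} e'" unfolding e'_def[abs_def] by (intro continuous_intros)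
  qed
  define I where "I n = {- real n..x}" for n :: nat
  have eq: "e x * f x - e (- real n) * f (- real n) = (LINT z|lborel. indicator (I n) z *\<^sub>R (e z * p z))"
    if "- real n \<le> x" for n
  proof -
    have ac: "ac_on (- real n) x (\<lambda>z. e z * f z) (\<lambda>z. e' z * f z + e z * H1_deriv f z)"
      using ac_mult[OF E H1_ac[OF f]] that by (simp add: ac_def)
    have "(\<lambda>z. e' z * f z + e z * H1_deriv f z) = (\<lambda>z. e z * p z)"
      by (auto simp: fun_eq_iff e_def e'_def algebra_simps)
    with ac_on_diff[OF ac, of "- real n" x] that show ?thesis
      by (simp add: I_def set_lebesgue_integral_def)
  qed
  have ep: "indicator {..x} z *\<^sub>R (e z * p z) = e x * (complex_of_real (kern k x z) * p z)" for z
  proof (cases "z \<le> x")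
    case True
    have "e z = e x * complex_of_real (kern k x z)"
      using True unfolding e_def kern_def of_real_mult[symmetric] by (simp add: algebra_simps flip: exp_add)
    then show ?thesis using True by simp
  qed (simp add: kern_def)
  have int: "integrable lborel (\<lambda>z. indicator {..x} z *\<^sub>R (e z * p z))"
    unfolding ep by (intro integrable_mult_right L2_mult_integrable kern_L2[OF k] H1_symbol_L2)
  have [measurable]: "p \<in> borel_measurable borel" using H1_symbol_L2 by (simp add: L2_def)
  have [measurable]: "e \<in> borel_measurable borel" unfolding e_def[abs_def] by measurable
  have "(\<lambda>n. LINT z|lborel. indicator (I n) z *\<^sub>R (e z * p z)) \<longlonglongrightarrow> (LINT z|lborel. indicator {..x} z *\<^sub>R (e z * p z))"
  proof (rule integral_dominated_convergence[where w="\<lambda>z. cmod (indicator {..x} z *\<^sub>R (e z * p z))"])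
    show "integrable lborel (\<lambda>z. cmod (indicator {..x} z *\<^sub>R (e z * p z)))" by (rule integrable_norm[OF int])
    show "AE z in lborel. (\<lambda>n. indicator (I n) z *\<^sub>R (e z * p z)) \<longlonglongrightarrow> indicator {..x} z *\<^sub>R (e z * p z)"
    proof (rule AE_I2)
      fix z
      obtain m :: nat where m: "\<bar>z\<bar> \<le> real m" using real_arch_simple by blast
      have "\<forall>\<^sub>F n in sequentially. indicator {..x} z *\<^sub>R (e z * p z) = indicator (I n) z *\<^sub>R (e z * p z)"
        using eventually_ge_at_top[of m] by eventually_elim (use m in \<open>auto simp: I_def indicator_def\<close>)
      then show "(\<lambda>n. indicator (I n) z *\<^sub>R (e z * p z)) \<longlonglongrightarrow> indicator {..x} z *\<^sub>R (e z * p z)"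
        by (rule Lim_transform_eventually[OF tendsto_const])
    qed
    show "AE z in lborel. norm (indicator (I n) z *\<^sub>R (e z * p z)) \<le> cmod (indicator {..x} z *\<^sub>R (e z * p z))" for n
      by (intro AE_I2) (auto simp: I_def indicator_def)
  qed (use int in \<open>auto simp: I_def\<close>)
  moreover have "(\<lambda>n. LINT z|lborel. indicator (I n) z *\<^sub>R (e z * p z)) \<longlonglongrightarrow> e x * f x"
  proof -
    obtain M where M: "\<And>x. cmod (f x) \<le> M" using H1_bounded[OF f] by blast
    have "(\<lambda>n. e (- real n) * f (- real n)) \<longlonglongrightarrow> 0"
    proof (rule Lim_null_comparison[OF always_eventually[OF allI]])
      fix n
      show "norm (e (- real n) * f (- real n)) \<le> exp (- k) ^ n * M"
        using M[of "- real n"] by (simp add: norm_mult e_def exp_of_nat_mult[symmetric] mult.commute mult_left_mono)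
      have "(\<lambda>n. exp (- k) ^ n * M) \<longlonglongrightarrow> 0 * M"
        using k by (intro tendsto_mult LIMSEQ_realpow_zero) auto
      then show "(\<lambda>n. exp (- k) ^ n * M) \<longlonglongrightarrow> 0" by simp
    qed
    then have "(\<lambda>n. e x * f x - e (- real n) * f (- real n)) \<longlonglongrightarrow> e x * f x - 0"
      by (intro tendsto_intros)
    moreover obtain m :: nat where m: "\<bar>x\<bar> \<le> real m" using real_arch_simple by blast
    have "\<forall>\<^sub>F n in sequentially. e x * f x - e (- real n) * f (- real n) = (LINT z|lborel. indicator (I n) z *\<^sub>R (e z * p z))"
      using eventually_ge_at_top[of m]
    proof eventually_elim
      case (elim n)
      then have "- real n \<le> x" using m by (simp add: abs_le_iff)
      then show ?case by (rule eq)
    qed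
    ultimately show ?thesis using Lim_transform_eventually by force
  qed
  ultimately have "e x * f x = (LINT z|lborel. indicator {..x} z *\<^sub>R (e z * p z))" by (rule LIMSEQ_unique[rotated])
  also have "\<dots> = e x * (LINT z|lborel. complex_of_real (kern k x z) * p z)"
    unfolding ep by (rule integral_mult_right_zero)
  finally show ?thesis by (simp add: e_def)
qed

lemma H1_sup_bound: "(cmod (f x))\<^sup>2 \<le> H1_energy k f / (2 * k)"
proof -
  have "f x = L2_inner p (\<lambda>z. complex_of_real (kern k x z))"
    unfolding L2_inner_def by (subst H1_representation) (simp add: mult.commute)
  then have "(cmod (f x))\<^sup>2 \<le> L2.qf p * L2.qf (\<lambda>z. complex_of_real (kern k x z))"
    using L2.Cauchy_Schwarz[OF H1_symbol_L2 kern_L2(1)[OF k]] by simp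
  then show ?thesis by (simp add: kern_L2(2)[OF k] H1_energy_eq[OF f])
qed

text \<open>Cauchy-Schwarz after splitting the kernel into two equal factors
  \<open>kern (k/2)\<close>. One of them stays with \<open>p\<close>, which leaves an expression
  that can be integrated in \<open>x\<close> with respect to \<open>\<mu>\<close>.\<close>

lemma H1_weighted_bound:
  "ennreal ((cmod (f x))\<^sup>2) \<le> ennreal (1 / k) * (\<integral>\<^sup>+z. ennreal (kern k x z) * ennreal ((cmod (p z))\<^sup>2) \<partial>lborel)"
proof -
  define r where "r z = complex_of_real (kern (k/2) x z)" for z
  have r: "r \<in> L2" "L2.qf r = 1 / k" using kern_L2[of "k/2" x] k by (auto simp: r_def[abs_def])
  have [measurable]: "p \<in> borel_measurable borel" using H1_symbol_L2 by (simp add: L2_def)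
  have rm [measurable]: "r \<in> borel_measurable borel" using r by (simp add: L2_def)
  have sq: "(cmod (r z * p z))\<^sup>2 = kern k x z * (cmod (p z))\<^sup>2" for z
    using kern_power2[of "k/2" x z] by (simp add: r_def norm_mult power_mult_distrib)
  have int: "integrable lborel (\<lambda>z. kern k x z * (cmod (p z))\<^sup>2)"
  proof (rule Bochner_Integration.integrable_bound)
    show "integrable lborel (\<lambda>z. (cmod (p z))\<^sup>2)" using H1_symbol_L2 by (simp add: L2_def)
    show "AE z in lborel. norm (kern k x z * (cmod (p z))\<^sup>2) \<le> norm ((cmod (p z))\<^sup>2)"
      using k by (intro AE_I2) (simp add: kern_nonneg kern_le_1 mult_left_le_one_le)
  qed measurable
  have rp: "(\<lambda>z. r z * p z) \<in> L2" using int by (simp add: L2_def sq)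
  have "f x = L2_inner (\<lambda>z. r z * p z) r"
    unfolding L2_inner_def H1_representation[of x]
  proof (rule Bochner_Integration.integral_cong)
    fix z
    have "complex_of_real (kern k x z) = r z * cnj (r z)"
      using kern_power2[of "k/2" x z] by (simp add: r_def power2_eq_square flip: of_real_mult)
    then show "complex_of_real (kern k x z) * p z = r z * p z * cnj (r z)" by (simp add: mult_ac)
  qed simp
  then have "(cmod (f x))\<^sup>2 \<le> L2.qf (\<lambda>z. r z * p z) * (1 / k)"
    using L2.Cauchy_Schwarz[OF rp r(1)] by (simp add: r(2))
  then have "ennreal ((cmod (f x))\<^sup>2) \<le> ennreal (1 / k * L2.qf (\<lambda>z. r z * p z))"
    by (intro ennreal_leI) (simp add: mult.commute)
  also have "\<dots> = ennreal (1 / k) * ennreal (L2.qf (\<lambda>z. r z * p z))"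
    using k by (intro ennreal_mult) (auto simp: L2_qf)
  also have "ennreal (L2.qf (\<lambda>z. r z * p z)) = (\<integral>\<^sup>+z. ennreal (kern k x z * (cmod (p z))\<^sup>2) \<partial>lborel)"
    unfolding L2_qf sq by (rule nn_integral_eq_integral[symmetric, OF int]) (simp add: kern_nonneg)
  also have "\<dots> = (\<integral>\<^sup>+z. ennreal (kern k x z) * ennreal ((cmod (p z))\<^sup>2) \<partial>lborel)"
    by (intro nn_integral_cong ennreal_mult) (auto simp: kern_nonneg)
  finally show ?thesis .
qed

end

text \<open>With each unit step to the right of \<open>z\<close> the kernel shrinks at least by the
  factor \<open>exp (-1)\<close>, hence by one half, and every unit interval has mass at most
  \<open>C\<close>. The geometric series gives \<open>2 * C\<close>.\<close>

lemma brinck_kern_bound: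
  assumes sets: "sets \<mu> = sets borel" and C: "0 < C" "\<And>x. emeasure \<mu> {x..x+1} \<le> ennreal C" and k: "1 \<le> k"
  shows "(\<integral>\<^sup>+x. ennreal (kern k x z) \<partial>\<mu>) \<le> ennreal (2 * C)"
proof -
  have half: "exp (- 1) \<le> (1/2 :: real)"
    using exp_ge_add_one_self[of 1] by (simp add: exp_minus field_simps)
  define A where "A n = {z + real n..z + real n + 1}" for n :: nat
  have "ennreal (kern k x z) \<le> (\<Sum>n. ennreal ((1/2) ^ n) * indicator (A n) x)" for x
  proof (cases "z \<le> x")
    case False
    then show ?thesis by (simp add: kern_def)
  next
    case True
    define n where "n = nat \<lfloor>x - z\<rfloor>"
    have n: "real n \<le> x - z" "x - z < real n + 1" using True by (auto simp: n_def)
    have "kern k x z \<le> exp (- real n)"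
    proof -
      have "real n \<le> k * (x - z)" using n(1) k True mult_right_mono[of 1 k "x - z"] by simp
      then show ?thesis using True by (simp add: kern_def)
    qed
    also have "\<dots> = exp (- 1) ^ n" by (simp add: exp_of_nat_mult[symmetric])
    also have "\<dots> \<le> (1/2) ^ n" using half by (intro power_mono) auto
    finally have "ennreal (kern k x z) \<le> ennreal ((1/2) ^ n) * indicator (A n) x"
      using n by (auto simp: A_def indicator_def intro!: ennreal_leI)
    also have "\<dots> \<le> (\<Sum>n. ennreal ((1/2) ^ n) * indicator (A n) x)"
    proof -
      define g where "g n = ennreal ((1/2) ^ n) * indicator (A n) x" for n
      have "sum g {n} \<le> suminf g" by (rule sum_le_suminf) auto
      then have "g n \<le> suminf g" by simp
      then show ?thesis unfolding g_def[abs_def] .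
    qed
    finally show ?thesis .
  qed
  then have "(\<integral>\<^sup>+x. ennreal (kern k x z) \<partial>\<mu>) \<le> (\<integral>\<^sup>+x. (\<Sum>n. ennreal ((1/2) ^ n) * indicator (A n) x) \<partial>\<mu>)"
    by (intro nn_integral_mono)
  also have "\<dots> = (\<Sum>n. \<integral>\<^sup>+x. ennreal ((1/2) ^ n) * indicator (A n) x \<partial>\<mu>)"
    by (rule nn_integral_suminf)
      (intro borel_measurable_times_ennreal borel_measurable_const borel_measurable_indicator, simp add: A_def sets)
  also have "\<dots> = (\<Sum>n. ennreal ((1/2) ^ n) * emeasure \<mu> (A n))"
    by (subst nn_integral_cmult_indicator) (auto simp: A_def sets)
  also have "\<dots> \<le> (\<Sum>n. ennreal ((1/2) ^ n) * ennreal C)"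
    by (intro suminf_le mult_left_mono) (auto simp: A_def C)
  also have "\<dots> = (\<Sum>n. ennreal ((1/2) ^ n * C))"
    using C by (simp add: ennreal_mult)
  also have "\<dots> = ennreal (\<Sum>n. (1/2) ^ n * C)"
    using C by (intro suminf_ennreal2 summable_mult2 summable_geometric) auto
  also have "(\<Sum>n. (1/2) ^ n * C) = 2 * C"
    by (subst suminf_mult2[symmetric]) (auto simp: suminf_geometric)
  finally show ?thesis .
qed

text \<open>Integrating the weighted pointwise bound over \<open>\<mu>\<close> and exchanging the
  integrals leaves the \<open>\<mu>\<close>-integral of the kernel. The factor
  \<open>2 * C / k\<close> becomes arbitrarily small for large \<open>k\<close>, so
  \<open>\<mu>\<close> is a small perturbation of the Dirichlet form.\<close>

lemma form_bound:
  assumes sets: "sets \<mu> = sets borel" and sf: "sigma_finite_measure \<mu>"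
    and C: "0 < C" "\<And>x. emeasure \<mu> {x..x+1} \<le> ennreal C" and k: "1 \<le> k" and f: "f \<in> H1"
  shows "integrable \<mu> (\<lambda>x. (cmod (f x))\<^sup>2)" "(LINT x|\<mu>. (cmod (f x))\<^sup>2) \<le> 2 * C / k * H1_energy k f"
proof -
  have k0: "0 < k" using k by simp
  define p where "p = (\<lambda>z. H1_deriv f z + complex_of_real k * f z)"
  have pL2: "p \<in> L2" unfolding p_def by (rule H1_symbol_L2[OF f k0])
  have [measurable]: "p \<in> borel_measurable borel" using pL2 by (simp add: L2_def)
  have [measurable]: "f \<in> borel_measurable borel" using H1_L2[OF f] by (simp add: L2_def)
  interpret pair_sigma_finite \<mu> "lborel :: real measure"
    using sf by (simp add: pair_sigma_finite_def sigma_finite_lborel)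
  have ms: "measurable (\<mu> \<Otimes>\<^sub>M lborel) M = measurable (borel \<Otimes>\<^sub>M borel) M" for M :: "ennreal measure"
    by (intro measurable_cong_sets sets_pair_measure_cong) (auto simp: sets)
  have "(\<integral>\<^sup>+x. ennreal ((cmod (f x))\<^sup>2) \<partial>\<mu>) \<le>
      (\<integral>\<^sup>+x. ennreal (1 / k) * (\<integral>\<^sup>+z. ennreal (kern k x z) * ennreal ((cmod (p z))\<^sup>2) \<partial>lborel) \<partial>\<mu>)"
    unfolding p_def by (intro nn_integral_mono H1_weighted_bound[OF f k0])
  also have "\<dots> = ennreal (1 / k) * (\<integral>\<^sup>+x. (\<integral>\<^sup>+z. ennreal (kern k x z) * ennreal ((cmod (p z))\<^sup>2) \<partial>lborel) \<partial>\<mu>)"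
  proof (rule nn_integral_cmult)
    have "(\<lambda>(x, z). ennreal (kern k x z) * ennreal ((cmod (p z))\<^sup>2)) \<in> borel_measurable (\<mu> \<Otimes>\<^sub>M lborel)"
      unfolding ms by (simp add: split_beta')
    then show "(\<lambda>x. \<integral>\<^sup>+z. ennreal (kern k x z) * ennreal ((cmod (p z))\<^sup>2) \<partial>lborel) \<in> borel_measurable \<mu>"
      using lborel.borel_measurable_nn_integral_fst by fastforce
  qed
  also have "(\<integral>\<^sup>+x. (\<integral>\<^sup>+z. ennreal (kern k x z) * ennreal ((cmod (p z))\<^sup>2) \<partial>lborel) \<partial>\<mu>) =
     (\<integral>\<^sup>+z. (\<integral>\<^sup>+x. ennreal (kern k x z) * ennreal ((cmod (p z))\<^sup>2) \<partial>\<mu>) \<partial>lborel)"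
    by (rule Fubini'[symmetric]) (unfold ms, simp add: split_beta')
  also have "\<dots> = (\<integral>\<^sup>+z. ennreal ((cmod (p z))\<^sup>2) * (\<integral>\<^sup>+x. ennreal (kern k x z) \<partial>\<mu>) \<partial>lborel)"
  proof (rule nn_integral_cong)
    fix z
    have "(\<lambda>x. ennreal (kern k x z)) \<in> borel_measurable \<mu>" by (simp add: measurable_cong_sets[OF sets refl])
    then show "(\<integral>\<^sup>+x. ennreal (kern k x z) * ennreal ((cmod (p z))\<^sup>2) \<partial>\<mu>) = ennreal ((cmod (p z))\<^sup>2) * (\<integral>\<^sup>+x. ennreal (kern k x z) \<partial>\<mu>)"
      by (subst mult.commute) (rule nn_integral_cmult)
  qed
  also have "\<dots> \<le> (\<integral>\<^sup>+z. ennreal ((cmod (p z))\<^sup>2) * ennreal (2 * C) \<partial>lborel)"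
    by (intro nn_integral_mono mult_left_mono brinck_kern_bound[OF sets C k]) auto
  also have "\<dots> = (\<integral>\<^sup>+z. ennreal ((cmod (p z))\<^sup>2) \<partial>lborel) * ennreal (2 * C)"
    by (rule nn_integral_multc) measurable
  also have "(\<integral>\<^sup>+z. ennreal ((cmod (p z))\<^sup>2) \<partial>lborel) = ennreal (H1_energy k f)"
    using pL2 H1_energy_eq[OF f, of k] by (subst nn_integral_eq_integral) (auto simp: L2_def L2_qf p_def)
  also have "ennreal (1 / k) * (ennreal (H1_energy k f) * ennreal (2 * C)) = ennreal (2 * C / k * H1_energy k f)"
  proof -
    have "0 \<le> H1_energy k f" using H1_energy_eq[OF f, of k] by (simp flip: H1_energy_eq[OF f] add: L2_qf)
    then show ?thesis using C k0 by (simp add: ennreal_mult[symmetric] field_simps)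
  qed
  finally have bd: "(\<integral>\<^sup>+x. ennreal ((cmod (f x))\<^sup>2) \<partial>\<mu>) \<le> ennreal (2 * C / k * H1_energy k f)"
    by (simp add: mult_left_mono)
  show i: "integrable \<mu> (\<lambda>x. (cmod (f x))\<^sup>2)"
    by (rule integrableI_nonneg) (use bd in \<open>auto simp: measurable_cong_sets[OF sets refl] order_le_less_trans\<close>)
  have "ennreal (LINT x|\<mu>. (cmod (f x))\<^sup>2) \<le> ennreal (2 * C / k * H1_energy k f)"
    using bd nn_integral_eq_integral[OF i] by simp
  moreover have "0 \<le> 2 * C / k * H1_energy k f"
    using C k0 H1_energy_eq[OF f, of k] by (simp flip: H1_energy_eq[OF f] add: L2_qf)
  ultimately show "(LINT x|\<mu>. (cmod (f x))\<^sup>2) \<le> 2 * C / k * H1_energy k f"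
    by (simp add: ennreal_le_iff)
qed

section \<open>The operator associated with a form-bounded measure\<close>

text \<open>Fatou's lemma for the differences \<open>u m - u n\<close> with \<open>m\<close> tending
  to infinity.\<close>

lemma L2_Fatou:
  assumes u: "\<And>n. u n \<in> L2" and v [measurable]: "v \<in> borel_measurable borel"
    and lim: "AE x in lborel. (\<lambda>n. u n x) \<longlonglongrightarrow> v x"
    and \<epsilon>: "\<And>m. n \<le> m \<Longrightarrow> L2.qf (u m - u n) \<le> \<epsilon>"
  shows "u n - v \<in> L2" "L2.qf (u n - v) \<le> \<epsilon>"
proof -
  have um [measurable]: "u n \<in> borel_measurable borel" for n using u[of n] by (simp add: L2_def)
  have "(\<integral>\<^sup>+x. ennreal ((cmod (u n x - v x))\<^sup>2) \<partial>lborel) \<le>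
      (\<integral>\<^sup>+x. liminf (\<lambda>m. ennreal ((cmod (u m x - u n x))\<^sup>2)) \<partial>lborel)"
  proof (rule nn_integral_mono_AE)
    show "AE x in lborel. ennreal ((cmod (u n x - v x))\<^sup>2) \<le> liminf (\<lambda>m. ennreal ((cmod (u m x - u n x))\<^sup>2))"
      using lim
    proof eventually_elim
      case (elim x)
      then have "(\<lambda>m. ennreal ((cmod (u m x - u n x))\<^sup>2)) \<longlonglongrightarrow> ennreal ((cmod (v x - u n x))\<^sup>2)"
        by (intro tendsto_intros tendsto_ennrealI)
      from lim_imp_Liminf[OF sequentially_bot this] show ?case by (simp add: norm_minus_commute)
    qed
  qed
  also have "\<dots> \<le> liminf (\<lambda>m. \<integral>\<^sup>+x. ennreal ((cmod (u m x - u n x))\<^sup>2) \<partial>lborel)"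
    by (rule nn_integral_liminf) measurable
  also have "\<dots> \<le> limsup (\<lambda>m. \<integral>\<^sup>+x. ennreal ((cmod (u m x - u n x))\<^sup>2) \<partial>lborel)"
    by (rule Liminf_le_Limsup) simp
  also have "\<dots> \<le> ennreal \<epsilon>"
  proof (rule Limsup_bounded[OF eventually_sequentiallyI[of n]])
    fix m assume m: "n \<le> m"
    have "u m - u n \<in> L2" using u by (intro L2.V_closed(4))
    then have "integrable lborel (\<lambda>x. (cmod (u m x - u n x))\<^sup>2)" by (simp add: L2_def)
    then have "(\<integral>\<^sup>+x. ennreal ((cmod (u m x - u n x))\<^sup>2) \<partial>lborel) = ennreal (L2.qf (u m - u n))"
      by (simp add: nn_integral_eq_integral L2_qf)
    also have "\<dots> \<le> ennreal \<epsilon>" by (intro ennreal_leI \<epsilon> m)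
    finally show "(\<integral>\<^sup>+x. ennreal ((cmod (u m x - u n x))\<^sup>2) \<partial>lborel) \<le> ennreal \<epsilon>" .
  qed
  finally have bd: "(\<integral>\<^sup>+x. ennreal ((cmod (u n x - v x))\<^sup>2) \<partial>lborel) \<le> ennreal \<epsilon>" .
  have i: "integrable lborel (\<lambda>x. (cmod (u n x - v x))\<^sup>2)"
    by (rule integrableI_nonneg) (use bd in \<open>auto simp: order_le_less_trans\<close>)
  have "0 \<le> L2.qf (u n - u n)" by (simp add: L2_qf)
  also have "\<dots> \<le> \<epsilon>" by (rule \<epsilon>) simp
  finally have "0 \<le> \<epsilon>" .
  have "(\<lambda>x. u n x - v x) \<in> borel_measurable borel" by measurable
  with i show "u n - v \<in> L2" by (simp add: L2_def fun_diff_def)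
  have "ennreal (L2.qf (u n - v)) \<le> ennreal \<epsilon>" using bd nn_integral_eq_integral[OF i] by (simp add: L2_qf)
  then show "L2.qf (u n - v) \<le> \<epsilon>" using \<open>0 \<le> \<epsilon>\<close> by (simp add: ennreal_le_iff)
qed

lemma Riesz_Fischer:
  assumes u: "\<And>n. u n \<in> L2" and K: "\<And>n. L2.qf (u (Suc n) - u n) \<le> K * (1/16) ^ n"
  obtains v where "v \<in> L2" "AE x in lborel. (\<lambda>n. u n x) \<longlonglongrightarrow> v x" "(\<lambda>n. L2.qf (u n - v)) \<longlonglongrightarrow> 0"
proof -
  have um [measurable]: "u n \<in> borel_measurable borel" for n using u[of n] by (simp add: L2_def)
  have "0 \<le> L2.qf (u (Suc 0) - u 0)" by (simp add: L2_qf)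
  then have K0: "0 \<le> K" using K[of 0] by simp
  have diff: "u m - u n \<in> L2" for m n using u by (intro L2.V_closed(4))
  \<comment> \<open>The weights \<open>4 ^ n\<close> leave integrals of order
    \<open>(1/4) ^ n\<close>, while finiteness of the weighted sum at \<open>x\<close> bounds the
    increments there by a multiple of \<open>(1/2) ^ n\<close>.\<close>
  have "AE x in lborel. (\<Sum>n. ennreal (4 ^ n * (cmod (u (Suc n) x - u n x))\<^sup>2)) \<noteq> \<infinity>"
  proof (rule nn_integral_PInf_AE)
    have "(\<integral>\<^sup>+x. (\<Sum>n. ennreal (4 ^ n * (cmod (u (Suc n) x - u n x))\<^sup>2)) \<partial>lborel) =
       (\<Sum>n. \<integral>\<^sup>+x. ennreal (4 ^ n * (cmod (u (Suc n) x - u n x))\<^sup>2) \<partial>lborel)"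
      by (rule nn_integral_suminf) measurable
    also have "\<dots> \<le> (\<Sum>n. ennreal (K * (1/4) ^ n))"
    proof (rule suminf_le)
      fix n
      have i: "integrable lborel (\<lambda>x. 4 ^ n * (cmod (u (Suc n) x - u n x))\<^sup>2)"
        using diff[of "Suc n" n] by (intro integrable_mult_right) (simp add: L2_def)
      have "(\<integral>\<^sup>+x. ennreal (4 ^ n * (cmod (u (Suc n) x - u n x))\<^sup>2) \<partial>lborel) = ennreal (4 ^ n * L2.qf (u (Suc n) - u n))"
        using nn_integral_eq_integral[OF i] by (simp add: L2_qf)
      also have "\<dots> \<le> ennreal (4 ^ n * (K * (1/16) ^ n))" by (intro ennreal_leI mult_left_mono K) simp
      also have "4 ^ n * (K * (1/16) ^ n) = K * (1/4) ^ n"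
        by (simp add: mult.left_commute power_mult_distrib[symmetric])
      finally show "(\<integral>\<^sup>+x. ennreal (4 ^ n * (cmod (u (Suc n) x - u n x))\<^sup>2) \<partial>lborel) \<le> ennreal (K * (1/4) ^ n)" .
    qed auto
    also have "\<dots> = ennreal (\<Sum>n. K * (1/4) ^ n)"
      using K0 by (intro suminf_ennreal2 summable_mult summable_geometric) auto
    finally show "(\<integral>\<^sup>+x. (\<Sum>n. ennreal (4 ^ n * (cmod (u (Suc n) x - u n x))\<^sup>2)) \<partial>lborel) \<noteq> \<infinity>"
      by (auto simp: top_unique)
  qed measurable
  then have conv: "AE x in lborel. convergent (\<lambda>n. u n x)"
  proof eventually_elim
    case (elim x)
    define g where "g n = ennreal (4 ^ n * (cmod (u (Suc n) x - u n x))\<^sup>2)" for n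
    obtain S where S: "suminf g = ennreal S" "0 \<le> S" using elim by (cases "suminf g") (auto simp: g_def[abs_def])
    have "norm (u (Suc n) x - u n x) \<le> sqrt S * (1/2) ^ n" for n
    proof -
      have "sum g {n} \<le> suminf g" by (rule sum_le_suminf) auto
      then have "ennreal (4 ^ n * (cmod (u (Suc n) x - u n x))\<^sup>2) \<le> ennreal S" by (simp add: S(1) g_def)
      then have "4 ^ n * (cmod (u (Suc n) x - u n x))\<^sup>2 \<le> S" using S(2) by (simp add: ennreal_le_iff)
      then have "(2 ^ n * cmod (u (Suc n) x - u n x))\<^sup>2 \<le> S"
      proof -
        have "(2 :: real) ^ n * 2 ^ n = 4 ^ n" by (simp flip: power_mult_distrib)
        then have "((2 :: real) ^ n)\<^sup>2 = 4 ^ n" by (simp only: power2_eq_square)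
        then have "(2 ^ n * cmod (u (Suc n) x - u n x))\<^sup>2 = 4 ^ n * (cmod (u (Suc n) x - u n x))\<^sup>2"
          by (simp only: power_mult_distrib)
        then show ?thesis using \<open>4 ^ n * _ \<le> S\<close> by simp
      qed
      then have "2 ^ n * cmod (u (Suc n) x - u n x) \<le> sqrt S" by (rule real_le_rsqrt)
      then show ?thesis by (simp add: field_simps power_divide)
    qed
    then have "summable (\<lambda>n. u (Suc n) x - u n x)"
      by (intro summable_comparison_test[OF _ summable_mult[OF summable_geometric[of "1/2"]]]) auto
    then have "convergent (\<lambda>n. (\<Sum>i<n. u (Suc i) x - u i x))" by (simp add: summable_iff_convergent)
    then have "convergent (\<lambda>n. u n x - u 0 x)"
      using sum_lessThan_telescope[of "\<lambda>n. u n x"] by simp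
    then have "convergent (\<lambda>n. (u n x - u 0 x) + u 0 x)" by (intro convergent_add convergent_const)
    then show ?case by simp
  qed
  define v where "v x = lim (\<lambda>n. u n x)" for x
  have vm: "v \<in> borel_measurable borel" unfolding v_def[abs_def] by (rule borel_measurable_lim_metric) measurable
  have vlim: "AE x in lborel. (\<lambda>n. u n x) \<longlonglongrightarrow> v x"
    using conv by eventually_elim (simp add: v_def convergent_LIMSEQ_iff)
  \<comment> \<open>The increments have norm at most \<open>sqrt K * (1/4) ^ n\<close>, and 4/3 is
    the sum of the geometric series of ratio 1/4.\<close>
  have tri: "sqrt (L2.qf (u (n + j) - u n)) \<le> 4/3 * sqrt K * ((1/4) ^ n - (1/4) ^ (n + j))" for n j
  proof (induction j)
    case 0
    then show ?case by (simp add: L2_qf)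
  next
    case (Suc j)
    have "sqrt (L2.qf (u (Suc (n + j)) - u (n + j))) \<le> sqrt (K * (1/16) ^ (n + j))" by (intro real_sqrt_le_mono K)
    also have "\<dots> = sqrt K * (1/4) ^ (n + j)"
    proof -
      have "(1/16 :: real) ^ (n + j) = ((1/4) ^ (n + j))\<^sup>2" by (simp add: power2_eq_square flip: power_mult_distrib)
      then show ?thesis by (simp add: real_sqrt_mult)
    qed
    finally have 1: "sqrt (L2.qf (u (Suc (n + j)) - u (n + j))) \<le> sqrt K * (1/4) ^ (n + j)" .
    have "u (n + Suc j) - u n = (u (Suc (n + j)) - u (n + j)) + (u (n + j) - u n)" by simp
    then have "sqrt (L2.qf (u (n + Suc j) - u n)) \<le> sqrt (L2.qf (u (Suc (n + j)) - u (n + j))) + sqrt (L2.qf (u (n + j) - u n))"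
      using L2.sqrt_qf_triangle[OF diff diff, of "Suc (n + j)" "n + j" "n + j" n] by simp
    also have "\<dots> \<le> sqrt K * (1/4) ^ (n + j) + 4/3 * sqrt K * ((1/4) ^ n - (1/4) ^ (n + j))"
      by (intro add_mono 1 Suc)
    also have "\<dots> = 4/3 * sqrt K * ((1/4) ^ n - (1/4) ^ (n + Suc j))" by (simp add: algebra_simps)
    finally show ?case .
  qed
  define \<epsilon> where "\<epsilon> n = (4/3 * sqrt K * (1/4) ^ n)\<^sup>2" for n :: nat
  have \<epsilon>: "L2.qf (u m - u n) \<le> \<epsilon> n" if "n \<le> m" for n m
  proof -
    have "sqrt (L2.qf (u m - u n)) \<le> 4/3 * sqrt K * ((1/4) ^ n - (1/4) ^ m)"
      using tri[of n "m - n"] that by simp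
    also have "\<dots> \<le> 4/3 * sqrt K * (1/4) ^ n" using K0 by (intro mult_left_mono) auto
    finally have "(sqrt (L2.qf (u m - u n)))\<^sup>2 \<le> \<epsilon> n" unfolding \<epsilon>_def by (rule power_mono) (simp add: L2_qf)
    then show ?thesis by (simp add: L2_qf)
  qed
  note F = L2_Fatou[OF u vm vlim \<epsilon>]
  have "v = u 0 - (u 0 - v)" by simp
  then have vL2: "v \<in> L2" using L2.V_closed(4)[OF u[of 0] F(1)[of 0]] by metis
  have "(\<lambda>n. L2.qf (u n - v)) \<longlonglongrightarrow> 0"
  proof (rule tendsto_sandwich[OF _ _ tendsto_const])
    show "\<forall>\<^sub>F n in sequentially. 0 \<le> L2.qf (u n - v)" by (simp add: L2_qf)
    show "\<forall>\<^sub>F n in sequentially. L2.qf (u n - v) \<le> \<epsilon> n" by (intro always_eventually allI F(2))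
    have "(\<lambda>n. (4/3 * sqrt K * (1/4) ^ n)\<^sup>2) \<longlonglongrightarrow> (4/3 * sqrt K * 0)\<^sup>2"
      by (intro tendsto_intros LIMSEQ_realpow_zero) auto
    then show "\<epsilon> \<longlonglongrightarrow> 0" by (simp add: \<epsilon>_def[abs_def])
  qed
  with vL2 vlim show ?thesis by (rule that)
qed

lemma (in positive_form) tendsto_form_left:
  assumes u: "\<And>n. u n \<in> V" and v: "v \<in> V" and g: "g \<in> V" and lim: "(\<lambda>n. qf (u n - v)) \<longlonglongrightarrow> 0"
  shows "(\<lambda>n. B (u n) g) \<longlonglongrightarrow> B v g"
proof -
  have "(\<lambda>n. B (u n) g - B v g) \<longlonglongrightarrow> 0"
  proof (rule Lim_null_comparison[OF always_eventually[OF allI]])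
    fix n
    show "norm (B (u n) g - B v g) \<le> sqrt (qf (u n - v)) * sqrt (qf g)"
      using Cauchy_Schwarz_sqrt[of "u n - v" g] u v g by (simp add: diff_left)
    have "(\<lambda>n. sqrt (qf (u n - v)) * sqrt (qf g)) \<longlonglongrightarrow> sqrt 0 * sqrt (qf g)"
      by (intro tendsto_intros lim)
    then show "(\<lambda>n. sqrt (qf (u n - v)) * sqrt (qf g)) \<longlonglongrightarrow> 0" by simp
  qed
  then show ?thesis by (simp add: LIM_zero_iff)
qed

text \<open>By the pointwise bound \<open>H1_sup_bound\<close> the sequence converges everywhere,
  which singles out the continuous representative of the limit. Its density is the limit of the
  derivatives, as integration over an interval is an inner product with an indicator.\<close>

lemma H1_complete:
  assumes p: "\<And>n. p n \<in> H1" and 1: "\<And>n. L2.qf (p (Suc n) - p n) \<le> K * (1/16) ^ n"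
    and 2: "\<And>n. H1D.qf (p (Suc n) - p n) \<le> K * (1/16) ^ n"
  obtains q where "q \<in> H1" "(\<lambda>n. L2.qf (p n - q)) \<longlonglongrightarrow> 0" "(\<lambda>n. H1D.qf (p n - q)) \<longlonglongrightarrow> 0"
proof -
  obtain v where v: "v \<in> L2" "AE x in lborel. (\<lambda>n. p n x) \<longlonglongrightarrow> v x" "(\<lambda>n. L2.qf (p n - v)) \<longlonglongrightarrow> 0"
    using Riesz_Fischer[OF H1_L2[OF p] 1] by blast
  have dp: "p m - p n \<in> H1" for m n by (rule H1D.V_closed(4)[OF p p])
  have Ddiff: "AE x in lborel. H1_deriv (f - g) x = (H1_deriv f - H1_deriv g) x" if "f \<in> H1" "g \<in> H1" for f g
  proof -
    have "AE x in lborel. H1_deriv f x = H1_deriv (f - g) x + H1_deriv g x"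
      using H1_deriv_add[OF H1D.V_closed(4)[OF that] that(2)] by simp
    then show ?thesis by eventually_elim simp
  qed
  have Dqf: "H1D.qf (f - g) = L2.qf (H1_deriv f - H1_deriv g)" if "f \<in> H1" "g \<in> H1" for f g
    unfolding H1D_qf
    by (rule L2_qf_cong_AE[OF H1_deriv_L2[OF H1D.V_closed(4)[OF that]]
        L2.V_closed(4)[OF H1_deriv_L2[OF that(1)] H1_deriv_L2[OF that(2)]] Ddiff[OF that]])
  have "L2.qf (H1_deriv (p (Suc n)) - H1_deriv (p n)) \<le> K * (1/16) ^ n" for n
    using 2[of n] Dqf[OF p p] by simp
  then obtain w where w: "w \<in> L2" "(\<lambda>n. L2.qf (H1_deriv (p n) - w)) \<longlonglongrightarrow> 0"
    using Riesz_Fischer[of "\<lambda>n. H1_deriv (p n)" K, OF H1_deriv_L2[OF p]] by blast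
  have "0 \<le> L2.qf (p (Suc 0) - p 0)" by (simp add: L2_qf)
  then have K0: "0 \<le> K" using 1[of 0] by simp
  have conv: "convergent (\<lambda>n. p n x)" for x
  proof -
    have "norm (p (Suc n) x - p n x) \<le> sqrt K * (1/4) ^ n" for n
    proof -
      have "(cmod (p (Suc n) x - p n x))\<^sup>2 \<le> H1_energy 1 (p (Suc n) - p n) / 2"
        using H1_sup_bound[OF dp[of "Suc n" n], of 1 x] by simp
      also have "\<dots> \<le> K * (1/16) ^ n" using 1[of n] 2[of n] by (simp add: H1_energy_def)
      also have "\<dots> = (sqrt K * (1/4) ^ n)\<^sup>2"
      proof -
        have "(1/16 :: real) ^ n = ((1/4) ^ n)\<^sup>2" by (simp add: power2_eq_square flip: power_mult_distrib)
        then show ?thesis using K0 by (simp add: power_mult_distrib)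
      qed
      finally show ?thesis by (rule power2_le_imp_le) (use K0 in simp)
    qed
    then have "summable (\<lambda>n. p (Suc n) x - p n x)"
      by (intro summable_comparison_test[OF _ summable_mult[OF summable_geometric[of "1/4"]]]) auto
    then have "convergent (\<lambda>n. (\<Sum>i<n. p (Suc i) x - p i x))" by (simp add: summable_iff_convergent)
    then have "convergent (\<lambda>n. p n x - p 0 x)"
      using sum_lessThan_telescope[of "\<lambda>n. p n x"] by simp
    then have "convergent (\<lambda>n. (p n x - p 0 x) + p 0 x)" by (intro convergent_add convergent_const)
    then show ?thesis by simp
  qed
  define q where "q x = lim (\<lambda>n. p n x)" for x
  have q: "(\<lambda>n. p n x) \<longlonglongrightarrow> q x" for x using conv[of x] by (simp add: q_def convergent_LIMSEQ_iff)
  have qv: "AE x in lborel. q x = v x" using v(2) by eventually_elim (rule LIMSEQ_unique[OF q])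
  have acq: "ac q w" unfolding ac_def
  proof (intro allI impI ac_onI_diff L2_locally_integrable w(1))
    fix a b x :: real assume x: "x \<in> {a..b}"
    define i where "i = (\<lambda>t. indicator {a..x} t :: complex)"
    have i: "i \<in> L2"
    proof -
      have "(\<lambda>t. (cmod (i t))\<^sup>2) = indicator {a..x}" by (auto simp: fun_eq_iff indicator_def i_def)
      then show ?thesis by (simp add: L2_def integrable_real_indicator emeasure_lborel_Icc_eq i_def)
    qed
    have I: "(LINT t:{a..x}|lborel. g t) = L2_inner g i" for g
      unfolding set_lebesgue_integral_def L2_inner_def
      by (intro Bochner_Integration.integral_cong) (auto simp: i_def indicator_def)
    have "(\<lambda>n. L2_inner (H1_deriv (p n)) i) \<longlonglongrightarrow> L2_inner w i"
      by (rule L2.tendsto_form_left[OF H1_deriv_L2[OF p] w(1) i w(2)])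
    moreover have "L2_inner (H1_deriv (p n)) i = p n x - p n a" for n
    proof -
      have ab: "ac_on a b (p n) (H1_deriv (p n))" using H1_ac[OF p[of n]] x by (simp add: ac_def)
      show ?thesis using ac_on_diff[OF ab, of a x] x by (simp add: I)
    qed
    moreover have "(\<lambda>n. p n x - p n a) \<longlonglongrightarrow> q x - q a" by (intro tendsto_intros q)
    ultimately show "q x - q a = (LINT t:{a..x}|lborel. w t)" unfolding I by (simp add: LIMSEQ_unique)
  qed
  have qm: "q \<in> borel_measurable borel" using ac_continuous[OF acq] by (rule borel_measurable_continuous_onI)
  have qL2: "q \<in> L2"
  proof -
    have "integrable lborel (\<lambda>x. (cmod (v x))\<^sup>2)" using v(1) by (simp add: L2_def)
    then have "integrable lborel (\<lambda>x. (cmod (q x))\<^sup>2)"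
      by (rule integrable_cong_AE_imp) (use qm qv in \<open>auto elim: eventually_mono\<close>)
    then show ?thesis using qm by (simp add: L2_def)
  qed
  have qH: "q \<in> H1" by (rule H1I[OF qL2 w(1) acq])
  have "L2.qf (p n - q) = L2.qf (p n - v)" for n
    using qv by (intro L2_qf_cong_AE L2.V_closed(4) H1_L2 p qL2 v(1)) (auto elim: eventually_mono)
  then have "(\<lambda>n. L2.qf (p n - q)) \<longlonglongrightarrow> 0" using v(3) by simp
  moreover have "H1D.qf (p n - q) = L2.qf (H1_deriv (p n) - w)" for n
    unfolding Dqf[OF p qH] using H1_deriv_AE[OF qL2 w(1) acq]
    by (intro L2_qf_cong_AE L2.V_closed(4) H1_deriv_L2 p qH w(1)) (auto elim: eventually_mono)
  then have "(\<lambda>n. H1D.qf (p n - q)) \<longlonglongrightarrow> 0" using w(2) by simp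
  ultimately show ?thesis using qH by (intro that)
qed

text \<open>The relative bound 1/2 is less than 1, so half of the Dirichlet integral absorbs the
  negative part: the form is semibounded and closed on all of \<open>H1\<close>.\<close>

locale form_bounded_measure =
  fixes \<mu> :: "real measure" and K :: real
  assumes sets_mu: "sets \<mu> = sets borel" and K_nonneg: "0 \<le> K"
    and mu_integrable: "f \<in> H1 \<Longrightarrow> integrable \<mu> (\<lambda>x. (cmod (f x))\<^sup>2)"
    and mu_bound: "f \<in> H1 \<Longrightarrow> (LINT x|\<mu>. (cmod (f x))\<^sup>2) \<le> 1/2 * H1D.qf f + K * L2.qf f"
begin

lemma form_dom_eq: "form_dom \<mu> = H1"
  using mu_integrable by (auto simp: form_dom_def)

lemma H1_sq_integrable: "f \<in> H1 \<Longrightarrow> f \<in> sq_integrable \<mu>"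
  using H1_L2[of f] mu_integrable[of f]
  by (simp add: sq_integrable_def L2_def measurable_cong_sets[OF sets_mu refl])

sublocale mu: positive_form "\<lambda>c (f::real \<Rightarrow> complex) x. c * f x" "sq_integrable \<mu>"
  "\<lambda>f g. LINT x|\<mu>. f x * cnj (g x)"
  by (rule positive_form_sq_integrable)

lemma mu_qf: "mu.qf f = (LINT x|\<mu>. (cmod (f x))\<^sup>2)"
  by (simp add: mu.qf_def integral_norm_square)

lemma form_eq: "form \<mu> f g = L2_inner (H1_deriv f) (H1_deriv g) - (LINT x|\<mu>. f x * cnj (g x))"
  by (simp add: form_def L2_inner_def)

sublocale fm: hermitian_form "\<lambda>c (f::real \<Rightarrow> complex) x. c * f x" H1 "form \<mu>"
proof
  show "cfun.subspace H1" by (rule subspace_H1)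
  show "form \<mu> (x + y) z = form \<mu> x z + form \<mu> y z" if "x \<in> H1" "y \<in> H1" "z \<in> H1" for x y z
    using that H1D.add_left[of x y z] mu.add_left[of x y z] by (simp add: form_eq H1_sq_integrable)
  show "form \<mu> (\<lambda>t. c * x t) z = c * form \<mu> x z" if "x \<in> H1" "z \<in> H1" for c x z
    using that H1D.scale_left[of x z c] mu.scale_left[of x z c]
    by (simp add: form_eq H1_sq_integrable algebra_simps)
  show "form \<mu> y x = cnj (form \<mu> x y)" if "x \<in> H1" "y \<in> H1" for x y
    using that H1D.hermitian[of x y] mu.hermitian[of x y] by (simp add: form_eq H1_sq_integrable)
qed

lemma form_qf: "fm.qf f = H1D.qf f - mu.qf f"
  by (simp add: fm.qf_def H1D.qf_def mu.qf_def form_eq)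

lemma form_lower_bound: "f \<in> H1 \<Longrightarrow> 1/2 * H1D.qf f - K * L2.qf f \<le> fm.qf f"
  using mu_bound[of f] by (simp add: form_qf mu_qf)

sublocale closed_form "\<lambda>c (f::real \<Rightarrow> complex) x. c * f x" L2 L2_inner H1 "form \<mu>"
proof
  show "H1 \<subseteq> L2" using H1_L2 by blast
  show "x = 0" if "x \<in> H1" "L2_inner x x = 0" for x using that by (rule AE_zero_H1)
  fix p :: "nat \<Rightarrow> real \<Rightarrow> complex" and L
  assume p: "\<And>n. p n \<in> H1"
    and 1: "\<And>n. Re (L2_inner (p (Suc n) - p n) (p (Suc n) - p n)) \<le> L * (1/16) ^ n"
    and 2: "\<And>n. Re (form \<mu> (p (Suc n) - p n) (p (Suc n) - p n)) \<le> L * (1/16) ^ n"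
  have "0 \<le> L2.qf (p (Suc 0) - p 0)" by (simp add: L2_qf)
  then have L0: "0 \<le> L" using 1[of 0] by (simp add: L2.qf_def)
  \<comment> \<open>By \<open>form_lower_bound\<close> the Dirichlet integral is at most twice the
    form plus \<open>2 * K\<close> times the squared norm.\<close>
  define M where "M = 2 * (1 + K) * L"
  have LM: "L \<le> M" using L0 K_nonneg mult_nonneg_nonneg[OF K_nonneg L0] by (simp add: M_def algebra_simps)
  have dp: "p m - p n \<in> H1" for m n by (rule H1D.V_closed(4)[OF p p])
  have 3: "L2.qf (p (Suc n) - p n) \<le> M * (1/16) ^ n" for n
  proof -
    have "L * (1/16) ^ n \<le> M * (1/16) ^ n" by (intro mult_right_mono LM) simp
    then show ?thesis using 1[of n] unfolding L2.qf_def by linarith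
  qed
  have 4: "H1D.qf (p (Suc n) - p n) \<le> M * (1/16) ^ n" for n
  proof -
    have "K * L2.qf (p (Suc n) - p n) \<le> K * (L * (1/16) ^ n)"
      using 1[of n] K_nonneg by (intro mult_left_mono) (auto simp: L2.qf_def)
    then show ?thesis using form_lower_bound[OF dp[of "Suc n" n]] 2[of n]
      by (simp add: fm.qf_def M_def algebra_simps)
  qed
  obtain q where q: "q \<in> H1" "(\<lambda>n. L2.qf (p n - q)) \<longlonglongrightarrow> 0" "(\<lambda>n. H1D.qf (p n - q)) \<longlonglongrightarrow> 0"
    using H1_complete[of p M, OF p 3 4] by blast
  interpret H1D: positive_form "\<lambda>c (f::real \<Rightarrow> complex) x. c * f x" H1 "\<lambda>f g. L2_inner (H1_deriv f) (H1_deriv g)"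
    by unfold_locales (rule H1D_nonneg)
  have "(\<lambda>n. mu.qf (p n - q)) \<longlonglongrightarrow> 0"
  proof (rule tendsto_sandwich[OF _ _ tendsto_const])
    show "\<forall>\<^sub>F n in sequentially. 0 \<le> mu.qf (p n - q)" by (simp add: mu_qf)
    show "\<forall>\<^sub>F n in sequentially. mu.qf (p n - q) \<le> 1/2 * H1D.qf (p n - q) + K * L2.qf (p n - q)"
      unfolding mu_qf by (intro always_eventually allI mu_bound) (use p q in blast)
    have "(\<lambda>n. 1/2 * H1D.qf (p n - q) + K * L2.qf (p n - q)) \<longlonglongrightarrow> 1/2 * 0 + K * 0"
      by (intro tendsto_intros q)
    then show "(\<lambda>n. 1/2 * H1D.qf (p n - q) + K * L2.qf (p n - q)) \<longlonglongrightarrow> 0" by simp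
  qed
  then have "(\<lambda>n. LINT x|\<mu>. p n x * cnj (g x)) \<longlonglongrightarrow> (LINT x|\<mu>. q x * cnj (g x))" if "g \<in> H1" for g
    using mu.tendsto_form_left[of p q g] H1_sq_integrable p q(1) that by blast
  moreover have "(\<lambda>n. L2_inner (H1_deriv (p n)) (H1_deriv g)) \<longlonglongrightarrow> L2_inner (H1_deriv q) (H1_deriv g)" if "g \<in> H1" for g
    using H1D.tendsto_form_left[OF p q(1) that q(3)] .
  moreover have "(\<lambda>n. L2_inner (p n) g) \<longlonglongrightarrow> L2_inner q g" if "g \<in> H1" for g
    using L2.tendsto_form_left[OF H1_L2[OF p] H1_L2[OF q(1)] H1_L2[OF that] q(2)] .
  ultimately show "\<exists>q\<in>H1. \<forall>g\<in>H1. (\<lambda>n. L2_inner (p n) g) \<longlonglongrightarrow> L2_inner q g \<and>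
      (\<lambda>n. form \<mu> (p n) g) \<longlonglongrightarrow> form \<mu> q g"
    unfolding form_eq using q(1) by (intro bexI[of _ q] ballI conjI tendsto_diff) auto
qed

lemma H_op_iff:
  assumes h: "h \<in> L2"
  shows "(f, \<lambda>x. h x + complex_of_real c * f x) \<in> H_op \<mu> \<longleftrightarrow> sol c f h"
proof -
  have "L2_inner (h + (\<lambda>x. complex_of_real c * f x)) g = L2_inner h g + complex_of_real c * L2_inner f g"
    if "f \<in> H1" "g \<in> H1" for g
    using that h by (simp add: L2.sesqui H1_L2)
  moreover have "h + (\<lambda>x. complex_of_real c * f x) \<in> L2" if "f \<in> H1"
    by (rule L2.V_closed(2)[OF h L2.V_closed(3)[OF H1_L2[OF that]]])
  ultimately show ?thesis using h
    by (auto simp: H_op_def form_operator_def form_dom_eq sol_def plus_fun_def algebra_simps)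
qed

lemma resolvent_set_iff: "complex_of_real c \<in> resolvent_set (H_op \<mu>) \<longleftrightarrow> regular c"
  unfolding resolvent_set_def regular_def
  by (auto simp: H_op_iff nrm_def L2_norm_eq)

lemma eigenspace_iff: "f \<in> eigenspace (H_op \<mu>) (complex_of_real c) \<longleftrightarrow> sol c f 0"
  using H_op_iff[of 0 f c] by (simp add: eigenspace_def)

end

section \<open>Lower bound\<close>

lemma (in hermitian_form) qf_orthogonal_sum:
  assumes J: "finite J" and w: "\<And>j. j \<in> J \<Longrightarrow> w j \<in> V"
    and orth: "\<And>i j. \<lbrakk>i \<in> J; j \<in> J; i \<noteq> j\<rbrakk> \<Longrightarrow> B (w i) (w j) = 0"
  shows "qf (\<Sum>j\<in>J. c j *s w j) = (\<Sum>j\<in>J. (cmod (c j))\<^sup>2 * qf (w j))"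
  using J w orth
proof (induction J rule: finite_induct)
  case empty
  then show ?case by (simp add: qf_def sesqui)
next
  case (insert i J)
  have "B (c i *s w i) (\<Sum>j\<in>J. c j *s w j) = (\<Sum>j\<in>J. B (c i *s w i) (c j *s w j))"
    using insert.prems by (intro sum_right) auto
  also have "\<dots> = 0"
    using insert.prems insert.hyps by (intro sum.neutral) (auto simp: sesqui)
  finally have "B (c i *s w i) (\<Sum>j\<in>J. c j *s w j) = 0" .
  moreover have "c i *s w i \<in> V" "(\<Sum>j\<in>J. c j *s w j) \<in> V" using insert.prems by auto
  ultimately have "qf ((c i *s w i) + (\<Sum>j\<in>J. c j *s w j)) = qf (c i *s w i) + qf (\<Sum>j\<in>J. c j *s w j)"
    by (simp add: qf_add)
  then show ?case using insert by (simp add: qf_scale)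
qed

section \<open>Eigenvalue counting by the min-max principle\<close>

context form_bounded_measure
begin

lemma is_eigenvalue_iff: "is_eigenvalue (H_op \<mu>) (complex_of_real l) \<longleftrightarrow> (\<exists>f. sol l f 0 \<and> f \<noteq> 0)"
  by (auto simp: is_eigenvalue_def eigenspace_iff zero_fun_def)

lemma subspace_eigenspace: "cfun.subspace (eigenspace (H_op \<mu>) (complex_of_real l))"
proof (rule cfun.subspaceI)
  show "0 \<in> eigenspace (H_op \<mu>) (complex_of_real l)" by (simp add: eigenspace_iff sol_zero)
  show "x + y \<in> eigenspace (H_op \<mu>) (complex_of_real l)"
    if "x \<in> eigenspace (H_op \<mu>) (complex_of_real l)" "y \<in> eigenspace (H_op \<mu>) (complex_of_real l)" for x y
    using that sol_add[of l x 0 y 0] by (simp add: eigenspace_iff)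
  show "(\<lambda>t. c * x t) \<in> eigenspace (H_op \<mu>) (complex_of_real l)"
    if "x \<in> eigenspace (H_op \<mu>) (complex_of_real l)" for c x
    using that sol_scale[of l x 0 c] by (simp add: eigenspace_iff zero_fun_def)
qed

lemma eigenspace_basis:
  assumes disc: "negative_spectrum_discrete (H_op \<mu>)" and l: "l \<in> negative_eigenvalues (H_op \<mu>)"
  obtains B where "finite B" "B \<noteq> {}" "\<And>e. e \<in> B \<Longrightarrow> sol l e 0"
    "\<And>f. sol l f 0 \<Longrightarrow> f \<in> cfun.span B"
    "card B = multiplicity (H_op \<mu>) (complex_of_real l)" "cfun.independent B"
proof -
  let ?E = "eigenspace (H_op \<mu>) (complex_of_real l)"
  obtain f where f: "sol l f 0" "f \<noteq> 0" "l < 0"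
    using l by (auto simp: negative_eigenvalues_def is_eigenvalue_iff)
  \<comment> \<open>Discreteness speaks of spectral points, so the eigenvalue is first placed in the
    spectrum.\<close>
  have "complex_of_real l \<in> op_spectrum (H_op \<mu>)"
    using eigenvalue_not_regular[OF f(1,2)] by (simp add: op_spectrum_def resolvent_set_iff)
  then obtain B0 where B0: "finite B0" "?E \<subseteq> cfun.span B0"
    using disc f(3) by (auto simp: negative_spectrum_discrete_def finite_multiplicity_def)
  obtain B where B: "B \<subseteq> ?E" "cfun.independent B" "?E \<subseteq> cfun.span B" "card B = cfun.dim ?E"
    using cfun.basis_exists by blast
  have "finite B" using cfun.independent_span_bound[OF B0(1) B(2)] B(1) B0(2) by auto
  moreover have "B \<noteq> {}"
  proof
    assume "B = {}"
    then have "f \<in> cfun.span {}" using B(3) f(1) by (auto simp: eigenspace_iff)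
    then show False using f(2) by (simp add: cfun.span_empty)
  qed
  moreover have "sol l e 0" if "e \<in> B" for e using that B(1) by (auto simp: eigenspace_iff)
  moreover have "f \<in> cfun.span B" if "sol l f 0" for f using that B(3) by (auto simp: eigenspace_iff)
  ultimately show ?thesis using B(2,4) by (intro that[of B]) (auto simp: multiplicity_def)
qed

text \<open>If there are too few eigenvalues, then some vector of the given subspace
  is orthogonal to all the corresponding eigenvectors, and the infimum of the form over the
  orthogonal complement is a further eigenvalue.\<close>

lemma eigenvalue_count:
  assumes disc: "negative_spectrum_discrete (H_op \<mu>)" and E: "0 \<le> E" and J: "finite J"
    and w: "\<And>j. j \<in> J \<Longrightarrow> w j \<in> H1"
    and neg: "\<And>c f. \<lbrakk>\<exists>j\<in>J. c j \<noteq> 0; f = (\<Sum>j\<in>J. (\<lambda>x. c j * w j x))\<rbrakk> \<Longrightarrow> 0 < L2.qf f \<and> fm.qf f < - E * L2.qf f"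
  shows "\<exists>F. finite F \<and> F \<subseteq> {l \<in> negative_eigenvalues (H_op \<mu>). l < - E} \<and>
    card J \<le> (\<Sum>l\<in>F. multiplicity (H_op \<mu>) (complex_of_real l))"
proof (rule ccontr)
  let ?m = "\<lambda>l. multiplicity (H_op \<mu>) (complex_of_real l)"
  define \<Lambda> where "\<Lambda> = {l \<in> negative_eigenvalues (H_op \<mu>). l < - E}"
  assume "\<not> ?thesis"
  then have few: "(\<Sum>l\<in>F. ?m l) < card J" if "finite F" "F \<subseteq> \<Lambda>" for F
    using that unfolding \<Lambda>_def by (meson not_le)
  have "\<forall>l\<in>\<Lambda>. \<exists>B. finite B \<and> B \<noteq> {} \<and> (\<forall>e\<in>B. sol l e 0) \<and> (\<forall>f. sol l f 0 \<longrightarrow> f \<in> cfun.span B) \<and> card B = ?m l"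
    unfolding \<Lambda>_def using eigenspace_basis[OF disc] by (metis (mono_tags, lifting) mem_Collect_eq)
  from bchoice[OF this] obtain Bs where Bs0: "\<forall>l\<in>\<Lambda>. finite (Bs l) \<and> Bs l \<noteq> {} \<and> (\<forall>e\<in>Bs l. sol l e 0) \<and>
    (\<forall>f. sol l f 0 \<longrightarrow> f \<in> cfun.span (Bs l)) \<and> card (Bs l) = ?m l" ..
  have Bs: "\<And>l. l \<in> \<Lambda> \<Longrightarrow> finite (Bs l)" "\<And>l. l \<in> \<Lambda> \<Longrightarrow> Bs l \<noteq> {}"
    "\<And>l e. \<lbrakk>l \<in> \<Lambda>; e \<in> Bs l\<rbrakk> \<Longrightarrow> sol l e 0" "\<And>l f. \<lbrakk>l \<in> \<Lambda>; sol l f 0\<rbrakk> \<Longrightarrow> f \<in> cfun.span (Bs l)"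
    "\<And>l. l \<in> \<Lambda> \<Longrightarrow> card (Bs l) = ?m l"
    using Bs0 by blast+
  \<comment> \<open>Every eigenvalue has multiplicity at least one, so infinitely many of them would
    contradict \<open>few\<close>.\<close>
  have fin: "finite \<Lambda>"
  proof (rule ccontr)
    assume "infinite \<Lambda>"
    then obtain F where F: "finite F" "card F = card J" "F \<subseteq> \<Lambda>" using infinite_arbitrarily_large by blast
    have "1 \<le> ?m l" if "l \<in> F" for l
      using Bs(1,2,5)[of l] that F(3) by (metis One_nat_def Suc_leI card_gt_0_iff subsetD)
    then have "(\<Sum>l\<in>F. 1) \<le> (\<Sum>l\<in>F. ?m l)" by (rule sum_mono)
    then show False using few[OF F(1,3)] F(2) by simp
  qed
  define Eb where "Eb = (\<Union>l\<in>\<Lambda>. Bs l)"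
  have finE: "finite Eb" using fin Bs(1) by (auto simp: Eb_def)
  have "card Eb \<le> (\<Sum>l\<in>\<Lambda>. card (Bs l))" unfolding Eb_def by (rule card_UN_le[OF fin])
  also have "\<dots> = (\<Sum>l\<in>\<Lambda>. ?m l)" using Bs(5) by (intro sum.cong) auto
  also have "\<dots> < card J" by (rule few[OF fin]) simp
  finally have "card Eb < card J" .
  from underdetermined_system[OF finE J this, of "\<lambda>e j. L2_inner (w j) e"] obtain c where
    c: "\<exists>j\<in>J. c j \<noteq> 0" "\<And>e. e \<in> Eb \<Longrightarrow> (\<Sum>j\<in>J. L2_inner (w j) e * c j) = 0" by auto
  have eig: "\<exists>l. sol l e 0" if "e \<in> Eb" for e using that Bs(3) by (auto simp: Eb_def)
  have EX: "e \<in> L2" if "e \<in> Eb" for e using eig[OF that] sol_X' by blast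
  define f where "f = (\<Sum>j\<in>J. (\<lambda>x. c j * w j x))"
  have fH: "f \<in> H1" unfolding f_def using w by (intro fm.V_sum fm.V_closed(3))
  have f: "0 < L2.qf f" "fm.qf f < - E * L2.qf f" using neg[OF c(1) f_def] by auto
  define P where "P = {x \<in> H1. \<forall>e\<in>Eb. L2_inner x e = 0}"
  have scaleP: "(\<lambda>t. a * x t) \<in> P" if "x \<in> P" for a x
    using that EX by (auto simp: P_def L2.sesqui H1_L2)
  have PH: "x \<in> H1" if "x \<in> P" for x using that by (simp add: P_def)
  have fP: "f \<in> P"
  proof -
    have "L2_inner f e = (\<Sum>j\<in>J. L2_inner (\<lambda>x. c j * w j x) e)" if "e \<in> Eb" for e
      unfolding f_def by (rule L2.sum_left[OF L2.V_closed(3)[OF H1_L2[OF w]] EX[OF that]])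
    moreover have "(\<Sum>j\<in>J. L2_inner (\<lambda>x. c j * w j x) e) = (\<Sum>j\<in>J. L2_inner (w j) e * c j)" if "e \<in> Eb" for e
      using w EX[OF that] by (intro sum.cong) (auto simp: L2.scale_left H1_L2)
    ultimately show ?thesis using c(2) fH by (simp add: P_def)
  qed
  define S where "S = {fm.qf x | x. x \<in> P \<and> L2.qf x = 1}"
  define s where "s = Inf S"
  define nm where "nm x = (\<lambda>t. complex_of_real (1 / sqrt (L2.qf x)) * x t)" for x :: "real \<Rightarrow> complex"
  have nm: "nm x \<in> P" "L2.qf (nm x) = 1" "fm.qf (nm x) = fm.qf x / L2.qf x" if "x \<in> P" "0 < L2.qf x" for x
  proof -
    show "nm x \<in> P" unfolding nm_def by (rule scaleP[OF that(1)])
    have r: "(cmod (complex_of_real (1 / sqrt (L2.qf x))))\<^sup>2 = 1 / L2.qf x"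
      unfolding norm_of_real using that(2) by (simp add: power_divide)
    show "L2.qf (nm x) = 1" "fm.qf (nm x) = fm.qf x / L2.qf x"
      unfolding nm_def L2.qf_scale[OF H1_L2[OF PH[OF that(1)]]] fm.qf_scale[OF PH[OF that(1)]] r
      using that(2) by auto
  qed
  have lb: "- K \<le> r" if r: "r \<in> S" for r
  proof -
    obtain x where x: "r = fm.qf x" "x \<in> P" "L2.qf x = 1" using r by (auto simp: S_def)
    then show ?thesis using form_lower_bound[OF PH[OF x(2)]] H1D_nonneg[OF PH[OF x(2)]] by simp
  qed
  then have bdd: "bdd_below S" by (auto simp: bdd_below_def)
  have inS: "fm.qf x / L2.qf x \<in> S" if "x \<in> P" "0 < L2.qf x" for x
    unfolding S_def by (rule CollectI, rule exI[of _ "nm x"]) (use nm[OF that] in simp)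
  note fS = inS[OF fP f(1)]
  then have "s \<le> fm.qf f / L2.qf f" unfolding s_def using bdd by (intro cInf_lower)
  also have "\<dots> < - E" using f by (simp add: divide_less_eq)
  finally have sE: "s < - E" .
  obtain d0 where d0: "0 < d0" "\<And>x. \<lbrakk>x \<in> \<Lambda>; x \<noteq> s\<rbrakk> \<Longrightarrow> d0 \<le> dist s x"
    using finite_set_avoid[OF fin, of s] by blast
  \<comment> \<open>The punctured neighbourhood of \<open>s\<close> of radius \<open>2 * d\<close>
    stays below \<open>-E\<close> and avoids the other elements of \<open>\<Lambda>\<close>, hence
    the spectrum. Whether \<open>s\<close> itself is a spectral point is still open here.\<close>
  define d where "d = min (d0 / 2) ((- E - s) / 2)"
  have d: "0 < d" using d0 sE by (simp add: d_def)
  have d2: "2 * d \<le> d0" "2 * d \<le> - E - s" by (auto simp: d_def min_def)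
  have specL: "l \<in> \<Lambda>" if "\<not> regular l" "l < - E" for l
    using disc that E by (auto simp: negative_spectrum_discrete_def \<Lambda>_def negative_eigenvalues_def
        op_spectrum_def resolvent_set_iff)
  have reg: "regular t" if t: "0 < \<bar>t - s\<bar>" "\<bar>t - s\<bar> < 2 * d" for t
  proof (rule ccontr)
    assume "\<not> regular t"
    moreover have "t < - E" using t d2 by linarith
    ultimately have "t \<in> \<Lambda>" by (rule specL)
    then have "d0 \<le> \<bar>t - s\<bar>" using d0(2)[of t] t by (auto simp: dist_real_def abs_minus_commute)
    then show False using t d2 by linarith
  qed
  have pos: "s * L2.qf x \<le> fm.qf x" if x: "x \<in> P" for x
  proof (cases "L2.qf x = 0")
    case True
    then have "L2_inner x x = 0" using L2.form_self[OF H1_L2[OF PH[OF x]]] by simp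
    then have "x = 0" by (rule AE_zero_H1[OF PH[OF x]])
    then show ?thesis by (simp add: fm.qf_def fm.sesqui L2.qf_def L2.sesqui)
  next
    case False
    then have p: "0 < L2.qf x" using L2.qf_nonneg[OF H1_L2[OF PH[OF x]]] by simp
    have "fm.qf x / L2.qf x \<in> S" by (rule inS[OF x p])
    then have "s \<le> fm.qf x / L2.qf x" unfolding s_def using bdd by (intro cInf_lower)
    then show ?thesis using p by (simp add: field_simps)
  qed
  have "\<exists>r\<in>S. r < s + d" using fS d unfolding s_def by (intro cInf_lessD) auto
  then obtain u where u: "u \<in> P" "L2.qf u = 1" "fm.qf u < s + d" by (auto simp: S_def)
  have "\<exists>p\<in>P. p \<noteq> 0 \<and> sol s p 0"
    by (rule bottom_eigenvector[OF d reg eig P_def pos u(1) _ u(3)]) (auto simp: nrm_def u(2))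
  then obtain p where p: "p \<in> P" "p \<noteq> 0" "sol s p 0" by blast
  have "s \<in> \<Lambda>" using eigenvalue_not_regular[OF p(3,2)] sE by (rule specL)
  then have pB: "p \<in> cfun.span (Bs s)" "Bs s \<subseteq> Eb" using Bs(4) p(3) by (auto simp: Eb_def)
  have pL: "p \<in> L2" using PH[OF p(1)] H1_L2 by blast
  \<comment> \<open>The eigenvector \<open>p\<close> lies in the span of the basis for
    \<open>s\<close>, to which all of \<open>P\<close> is orthogonal, so \<open>p\<close> is
    orthogonal to itself.\<close>
  have "cfun.subspace {x \<in> L2. L2_inner p x = 0}"
    by (rule cfun.subspaceI) (use pL in \<open>auto simp: L2.sesqui\<close>)
  moreover have "Bs s \<subseteq> {x \<in> L2. L2_inner p x = 0}" using pB(2) p(1) EX by (auto simp: P_def)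
  ultimately have "cfun.span (Bs s) \<subseteq> {x \<in> L2. L2_inner p x = 0}" by (intro cfun.span_minimal)
  then have "L2_inner p p = 0" using pB(1) by blast
  then show False using AE_zero_H1[OF PH[OF p(1)]] p(2) by blast
qed

end

subsection \<open>Trapezoidal test functions\<close>

lemma ac_ramp: "ac (\<lambda>x. complex_of_real (max 0 (x - c))) (\<lambda>x. if c < x then 1 else 0)"
  unfolding ac_def
proof (intro allI impI ac_onI_diff)
  fix a b x :: real
  let ?f = "\<lambda>x. if c < x then 1 else 0 :: complex"
  have *: "(\<lambda>t. indicator {a..y} t *\<^sub>R ?f t) = (\<lambda>t. complex_of_real (indicator (if c < a then {a..y} else {c<..y}) t))" for y
    by (auto simp: fun_eq_iff indicator_def)
  have i: "integrable lborel (indicator (if c < a then {a..y} else {c<..y}) :: real \<Rightarrow> real)" for y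
    by (intro integrable_real_indicator emeasure_bounded_finite) auto
  show "set_integrable lborel {a..b} ?f" unfolding set_integrable_def * using i by simp
  assume x: "x \<in> {a..b}"
  have "(LINT t:{a..x}|lborel. ?f t) = complex_of_real (measure lborel (if c < a then {a..x} else {c<..x}))"
    unfolding set_lebesgue_integral_def * by simp
  also have "measure lborel (if c < a then {a..x} else {c<..x}) = max 0 (x - c) - max 0 (a - c)"
    using x by (auto simp: max_def)
  finally show "complex_of_real (max 0 (x - c)) - complex_of_real (max 0 (a - c)) = (LINT t:{a..x}|lborel. ?f t)"
    by simp
qed

lemma L2_bounded_support:
  assumes m: "f \<in> borel_measurable borel" and A: "A \<in> sets borel" "emeasure lborel A < \<infinity>"
    and z: "\<And>x. x \<notin> A \<Longrightarrow> f x = 0" and b: "\<And>x. cmod (f x) \<le> b"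
  shows "f \<in> L2" "L2.qf f \<le> b\<^sup>2 * measure lborel A"
proof -
  have i: "integrable lborel (\<lambda>x. b\<^sup>2 * indicator A x)"
    using A by (intro integrable_mult_right integrable_real_indicator) auto
  have le: "(cmod (f x))\<^sup>2 \<le> b\<^sup>2 * indicator A x" for x
    using z[of x] power_mono[OF b[of x], of 2] by (cases "x \<in> A") auto
  have "integrable lborel (\<lambda>x. (cmod (f x))\<^sup>2)"
    by (rule Bochner_Integration.integrable_bound[OF i]) (use m le in \<open>auto intro!: AE_I2 order_trans[OF le]\<close>)
  then show "f \<in> L2" using m by (simp add: L2_def)
  have "L2.qf f \<le> (LINT x|lborel. b\<^sup>2 * indicator A x)"
    unfolding L2_qf by (rule integral_mono[OF \<open>integrable lborel (\<lambda>x. (cmod (f x))\<^sup>2)\<close> i le])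
  also have "\<dots> = b\<^sup>2 * measure lborel A" using A by simp
  finally show "L2.qf f \<le> b\<^sup>2 * measure lborel A" .
qed

text \<open>Equal to 1 on \<open>{a..a + l}\<close>, with legs of length \<open>l / 2\<close> on
  either side. The slopes \<open>2 / l\<close> give the Dirichlet integral \<open>4 / l\<close>, and
  the support has length \<open>2 * l\<close>.\<close>

definition trapezoid :: "real \<Rightarrow> real \<Rightarrow> real \<Rightarrow> complex" where
  "trapezoid l a x = of_real (max 0 (min 1 (min (1 + 2 * (x - a) / l) (3 - 2 * (x - a) / l))))"

text \<open>The half-open cases match the density in \<open>ac_ramp\<close>, so that the trapezoid,
  as a combination of four ramps starting at its kinks, has exactly this density.\<close>

definition trapezoid_deriv :: "real \<Rightarrow> real \<Rightarrow> real \<Rightarrow> complex" where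
  "trapezoid_deriv l a x = (if a - l / 2 < x \<and> x \<le> a then of_real (2 / l)
     else if a + l < x \<and> x \<le> a + 3 * l / 2 then - of_real (2 / l) else 0)"

context
  fixes l a :: real
  assumes l: "0 < l"
begin

lemma trapezoid_zero: "x \<notin> {a - l / 2<..<a + 3 * l / 2} \<Longrightarrow> trapezoid l a x = 0"
proof -
  assume x: "x \<notin> {a - l / 2<..<a + 3 * l / 2}"
  define y where "y = (x - a) / l"
  have "y \<le> - (1/2) \<or> 3/2 \<le> y" using x l by (auto simp: y_def field_simps)
  moreover have "2 * (x - a) / l = 2 * y" by (simp add: y_def)
  ultimately show ?thesis by (auto simp: trapezoid_def max_def min_def)
qed

lemma trapezoid_one: "x \<in> {a..a + l} \<Longrightarrow> trapezoid l a x = 1"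
proof -
  assume x: "x \<in> {a..a + l}"
  define y where "y = (x - a) / l"
  have "0 \<le> y" "y \<le> 1" using x l by (auto simp: y_def field_simps)
  moreover have "2 * (x - a) / l = 2 * y" by (simp add: y_def)
  ultimately show ?thesis by (auto simp: trapezoid_def max_def min_def)
qed

lemma trapezoid_le_1: "cmod (trapezoid l a x) \<le> 1"
  unfolding trapezoid_def norm_of_real by (auto simp: max_def min_def)

lemma ac_trapezoid: "ac (trapezoid l a) (trapezoid_deriv l a)"
proof -
  let ?r = "\<lambda>c x. complex_of_real (max 0 (x - c))" and ?i = "\<lambda>c x. if c < x then 1 else 0 :: complex"
  let ?k = "complex_of_real (2 / l)"
  let ?F = "(\<lambda>x. ?k * ?r (a - l/2) x) + (\<lambda>x. - ?k * ?r a x) + (\<lambda>x. - ?k * ?r (a + l) x) + (\<lambda>x. ?k * ?r (a + 3 * l / 2) x)"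
  let ?G = "(\<lambda>x. ?k * ?i (a - l/2) x) + (\<lambda>x. - ?k * ?i a x) + (\<lambda>x. - ?k * ?i (a + l) x) + (\<lambda>x. ?k * ?i (a + 3 * l / 2) x)"
  have "ac ?F ?G" by (intro ac_add ac_scale ac_ramp)
  moreover have "?F = trapezoid l a"
  proof
    fix x
    have "?F x = complex_of_real (2 / l * (max 0 (x - (a - l/2)) - max 0 (x - a) - max 0 (x - (a + l)) + max 0 (x - (a + 3 * l / 2))))"
      by (simp add: algebra_simps)
    also have "2 / l * (max 0 (x - (a - l/2)) - max 0 (x - a) - max 0 (x - (a + l)) + max 0 (x - (a + 3 * l / 2)))
       = max 0 (min 1 (min (1 + 2 * (x - a) / l) (3 - 2 * (x - a) / l)))"
    proof -
      define y where "y = (x - a) / l"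
      have x: "x = a + l * y" using l by (simp add: y_def)
      have r: "max 0 (l * t) = l * max 0 t" for t using l by (simp add: max_mult_distrib_left)
      have "x - (a - l/2) = l * (y + 1/2)" "x - a = l * y" "x - (a + l) = l * (y - 1)" "x - (a + 3 * l / 2) = l * (y - 3/2)"
        by (auto simp: x algebra_simps)
      moreover have "2 * (l * y) / l = 2 * y" using l by simp
      moreover have "2 / l * (l * t1 - l * t2 - l * t3 + l * t4) = 2 * (t1 - t2 - t3 + t4)" for t1 t2 t3 t4
        using l by (simp add: field_simps)
      moreover have "2 * (max 0 (y + 1/2) - max 0 y - max 0 (y - 1) + max 0 (y - 3/2)) = max 0 (min 1 (min (1 + 2 * y) (3 - 2 * y)))"
        by (auto simp: max_def min_def)
      ultimately show ?thesis by (simp only: r)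
    qed
    finally show "?F x = trapezoid l a x" by (simp add: trapezoid_def)
  qed
  moreover have "?G = trapezoid_deriv l a"
    using l by (auto simp: fun_eq_iff trapezoid_deriv_def)
  ultimately show ?thesis by simp
qed

lemma trapezoid_L2: "trapezoid l a \<in> L2" "L2.qf (trapezoid l a) \<le> 2 * l"
  using L2_bounded_support[of "trapezoid l a" "{a - l / 2<..<a + 3 * l / 2}" 1]
    borel_measurable_continuous_onI[OF ac_continuous[OF ac_trapezoid]] trapezoid_zero trapezoid_le_1 l
  by (auto simp: emeasure_lborel_Ioo)

lemma trapezoid_deriv_L2: "trapezoid_deriv l a \<in> L2" "L2.qf (trapezoid_deriv l a) \<le> 4 / l"
proof -
  have m: "trapezoid_deriv l a \<in> borel_measurable borel" unfolding trapezoid_deriv_def[abs_def] by measurable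
  have e: "emeasure lborel ({a - l / 2<..a} \<union> {a + l<..a + 3 * l / 2}) = ennreal l"
  proof -
    have "emeasure lborel ({a - l / 2<..a} \<union> {a + l<..a + 3 * l / 2}) =
        emeasure lborel {a - l / 2<..a} + emeasure lborel {a + l<..a + 3 * l / 2}"
      using l by (intro plus_emeasure[symmetric]) auto
    also have "\<dots> = ennreal (l / 2) + ennreal (l / 2)"
      using l by (simp add: emeasure_lborel_Ioc field_simps)
    also have "\<dots> = ennreal l" using l by (simp flip: ennreal_plus)
    finally show ?thesis .
  qed
  have z: "trapezoid_deriv l a x = 0" if "x \<notin> {a - l / 2<..a} \<union> {a + l<..a + 3 * l / 2}" for x
    using that by (auto simp: trapezoid_deriv_def)
  have b: "cmod (trapezoid_deriv l a x) \<le> 2 / l" for x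
    using l by (auto simp: trapezoid_deriv_def norm_divide)
  have A: "{a - l / 2<..a} \<union> {a + l<..a + 3 * l / 2} \<in> sets borel"
    "emeasure lborel ({a - l / 2<..a} \<union> {a + l<..a + 3 * l / 2}) < \<infinity>"
    unfolding e by simp_all
  note L = L2_bounded_support[OF m A z b]
  show "trapezoid_deriv l a \<in> L2" by (rule L(1))
  have "L2.qf (trapezoid_deriv l a) \<le> (2 / l)\<^sup>2 * measure lborel ({a - l / 2<..a} \<union> {a + l<..a + 3 * l / 2})"
    by (rule L(2))
  also have "\<dots> = 4 / l" unfolding measure_def e using l by (simp add: power2_eq_square)
  finally show "L2.qf (trapezoid_deriv l a) \<le> 4 / l" .
qed

lemma trapezoid_H1: "trapezoid l a \<in> H1"
  by (rule H1I[OF trapezoid_L2(1) trapezoid_deriv_L2(1) ac_trapezoid])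

lemma trapezoid_H1_deriv: "AE x in lborel. H1_deriv (trapezoid l a) x = trapezoid_deriv l a x"
  by (rule H1_deriv_AE[OF trapezoid_L2(1) trapezoid_deriv_L2(1) ac_trapezoid])

lemma trapezoid_H1D_qf: "H1D.qf (trapezoid l a) \<le> 4 / l"
  using L2_qf_cong_AE[OF H1_deriv_L2[OF trapezoid_H1] trapezoid_deriv_L2(1) trapezoid_H1_deriv]
    trapezoid_deriv_L2(2) by (simp add: H1D_qf)

lemma trapezoid_qf_pos: "0 < L2.qf (trapezoid l a)"
proof (rule ccontr)
  assume "\<not> ?thesis"
  then have "L2.qf (trapezoid l a) = 0" using L2.qf_nonneg[OF trapezoid_L2(1)] by simp
  then have "L2_inner (trapezoid l a) (trapezoid l a) = 0" using L2.form_self[OF trapezoid_L2(1)] by simp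
  then have "trapezoid l a = 0" by (rule AE_zero_H1[OF trapezoid_H1])
  then have "trapezoid l a a = 0" by simp
  then show False using trapezoid_one[of a] l by simp
qed

end

subsection \<open>Counting test functions on dyadic grids\<close>

text \<open>The support of a trapezoid is twice as long as its plateau, so neighbours overlap.
  Distinct indices of equal parity differ by at least 2, and then the supports share at most an end
  point.\<close>

lemma trapezoid_disjoint:
  assumes l: "0 < l" and ij: "i \<noteq> j" "even (i + j)"
  shows "trapezoid l (b + l * real i) x * trapezoid l (b + l * real j) x = 0"
    "trapezoid_deriv l (b + l * real i) x * trapezoid_deriv l (b + l * real j) x = 0"
proof -
  have gap: "b + l * real i + 3 * l / 2 \<le> b + l * real j - l / 2" if "i < j" "even (i + j)" for i j :: nat
  proof -
    have "i + 2 \<le> j" using that by presburger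
    then have "real i + 2 \<le> real j" by linarith
    then have "l * (real i + 2) \<le> l * real j" using l by (intro mult_left_mono) auto
    then show ?thesis by (simp add: algebra_simps)
  qed
  consider "b + l * real i + 3 * l / 2 \<le> b + l * real j - l / 2" | "b + l * real j + 3 * l / 2 \<le> b + l * real i - l / 2"
    using gap[of i j] gap[of j i] ij by (metis add.commute linorder_neqE_nat)
  note disj = this
  have "x \<notin> {b + l * real i - l / 2<..<b + l * real i + 3 * l / 2} \<or> x \<notin> {b + l * real j - l / 2<..<b + l * real j + 3 * l / 2}"
    using disj by cases auto
  then show "trapezoid l (b + l * real i) x * trapezoid l (b + l * real j) x = 0"
    using trapezoid_zero[OF l] by auto
  have z: "trapezoid_deriv l a x = 0" if "x \<notin> {a - l / 2<..a + 3 * l / 2}" for a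
    using that l by (auto simp: trapezoid_deriv_def)
  have "x \<notin> {b + l * real i - l / 2<..b + l * real i + 3 * l / 2} \<or> x \<notin> {b + l * real j - l / 2<..b + l * real j + 3 * l / 2}"
    using disj by cases auto
  then show "trapezoid_deriv l (b + l * real i) x * trapezoid_deriv l (b + l * real j) x = 0"
    using z by auto
qed

lemma trapezoid_real: "cnj (trapezoid l a x) = trapezoid l a x" "cnj (trapezoid_deriv l a x) = trapezoid_deriv l a x"
  by (auto simp: trapezoid_def trapezoid_deriv_def)

lemma sum_lessThan_double:
  fixes g :: "nat \<Rightarrow> real"
  shows "(\<Sum>j<n. g (2 * j) + g (2 * j + 1)) = (\<Sum>c<2 * n. g c)"
  by (induction n) (auto simp: algebra_simps)

text \<open>In a doubling progression the earlier terms together do not exceed the last one, and the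
  last one counted is below \<open>t\<close>.\<close>

lemma geometric_below:
  fixes t c :: real
  assumes "0 < c" "0 < t"
  shows "(\<Sum>i<n. if 2 ^ i * c < t then 2 ^ i * c else 0) \<le> 2 * t"
proof (induction n)
  case 0
  then show ?case using assms by simp
next
  case (Suc n)
  show ?case
  proof (cases "2 ^ n * c < t")
    case True
    have "(\<Sum>i<n. if 2 ^ i * c < t then 2 ^ i * c else 0) \<le> (\<Sum>i<n. 2 ^ i * c)"
      using assms by (intro sum_mono) auto
    also have "\<dots> = (\<Sum>i<n. 2 ^ i) * c" by (simp add: sum_distrib_right)
    also have "(\<Sum>i<n. (2 :: real) ^ i) = 2 ^ n - 1" by (induction n) auto
    also have "(2 ^ n - 1) * c \<le> 2 ^ n * c" using assms by (intro mult_right_mono) auto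
    finally show ?thesis using True by simp
  next
    case False
    then show ?thesis using Suc by simp
  qed
qed

context form_bounded_measure
begin

text \<open>The threshold 6 leaves \<open>4 / l - 6 / l = - (2 / l)\<close>, and the squared norm is
  at most \<open>2 * l\<close>, which gives a Rayleigh quotient below
  \<open>- (1 / l)\<^sup>2\<close>.\<close>

lemma trapezoid_form:
  assumes l: "0 < l" and fin: "emeasure \<mu> {a..<a + l} < \<infinity>" and big: "6 / l < measure \<mu> {a..<a + l}"
  shows "fm.qf (trapezoid l a) < - (1 / l)\<^sup>2 * L2.qf (trapezoid l a)"
proof -
  have "measure \<mu> {a..<a + l} = (LINT x|\<mu>. indicator {a..<a + l} x)"
    by (simp add: sets_mu)
  also have "\<dots> \<le> (LINT x|\<mu>. (cmod (trapezoid l a x))\<^sup>2)"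
  proof (rule integral_mono)
    show "integrable \<mu> (indicator {a..<a + l} :: real \<Rightarrow> real)"
      using fin by (intro integrable_real_indicator) (auto simp: sets_mu)
    show "indicator {a..<a + l} x \<le> (cmod (trapezoid l a x))\<^sup>2" for x
      using trapezoid_one[OF l, of x a] by (auto simp: indicator_def)
  qed (rule mu_integrable[OF trapezoid_H1[OF l]])
  finally have "measure \<mu> {a..<a + l} \<le> mu.qf (trapezoid l a)" by (simp add: mu_qf)
  then have 1: "fm.qf (trapezoid l a) < 4 / l - 6 / l"
    using trapezoid_H1D_qf[OF l, of a] big by (simp add: form_qf)
  have "(1 / l)\<^sup>2 * L2.qf (trapezoid l a) \<le> (1 / l)\<^sup>2 * (2 * l)"
    using trapezoid_L2(2)[OF l] by (intro mult_left_mono) auto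
  also have "\<dots> = 2 / l" using l by (simp add: power2_eq_square)
  finally have "(1 / l)\<^sup>2 * L2.qf (trapezoid l a) \<le> 2 / l" .
  moreover have "4 / l - 6 / l = - (2 / l)" by (simp add: diff_divide_distrib[symmetric])
  ultimately show ?thesis using 1 by simp
qed

text \<open>Within one parity class the test functions are orthogonal for the inner product and for
  the form, so the estimate for single functions passes to their span.\<close>

lemma count_parity:
  assumes disc: "negative_spectrum_discrete (H_op \<mu>)" and l: "0 < l" and J: "finite J"
    and par: "\<And>i j. \<lbrakk>i \<in> J; j \<in> J\<rbrakk> \<Longrightarrow> even (i + j)"
    and fin: "\<And>j. j \<in> J \<Longrightarrow> emeasure \<mu> {b + l * real j..<b + l * real j + l} < \<infinity>"
    and big: "\<And>j. j \<in> J \<Longrightarrow> 6 / l < measure \<mu> {b + l * real j..<b + l * real j + l}"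
  shows "\<exists>F. finite F \<and> F \<subseteq> {e \<in> negative_eigenvalues (H_op \<mu>). e < - (1 / l)\<^sup>2} \<and>
    card J \<le> (\<Sum>e\<in>F. multiplicity (H_op \<mu>) (complex_of_real e))"
proof (rule eigenvalue_count[OF disc _ J])
  define w where "w j = trapezoid l (b + l * real j)" for j
  show wH: "w j \<in> H1" for j unfolding w_def by (rule trapezoid_H1[OF l])
  have orth: "L2_inner (w i) (w j) = 0" "form \<mu> (w i) (w j) = 0" if ij: "i \<in> J" "j \<in> J" "i \<noteq> j" for i j
  proof -
    note d = trapezoid_disjoint[OF l ij(3) par[OF ij(1,2)], of b]
    show "L2_inner (w i) (w j) = 0" by (simp add: L2_inner_def w_def trapezoid_real d)
    have "L2_inner (H1_deriv (w i)) (H1_deriv (w j)) =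
       L2_inner (trapezoid_deriv l (b + l * real i)) (trapezoid_deriv l (b + l * real j))"
      unfolding w_def by (intro L2_inner_cong_AE H1_deriv_L2 trapezoid_H1 trapezoid_deriv_L2 trapezoid_H1_deriv l)
    also have "\<dots> = 0" by (simp add: L2_inner_def trapezoid_real d)
    finally show "form \<mu> (w i) (w j) = 0" by (simp add: form_eq w_def trapezoid_real d)
  qed
  fix c f
  assume c: "\<exists>j\<in>J. c j \<noteq> 0" and f: "f = (\<Sum>j\<in>J. (\<lambda>x. c j * w j x))"
  have L: "L2.qf f = (\<Sum>j\<in>J. (cmod (c j))\<^sup>2 * L2.qf (w j))"
    unfolding f by (intro L2.qf_orthogonal_sum J H1_L2 wH orth)
  have M: "fm.qf f = (\<Sum>j\<in>J. (cmod (c j))\<^sup>2 * fm.qf (w j))"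
    unfolding f by (intro fm.qf_orthogonal_sum J wH orth)
  obtain j0 where j0: "j0 \<in> J" "c j0 \<noteq> 0" using c by blast
  have p: "0 < L2.qf (w j)" for j unfolding w_def by (rule trapezoid_qf_pos[OF l])
  have n: "fm.qf (w j) < - (1 / l)\<^sup>2 * L2.qf (w j)" if "j \<in> J" for j
    unfolding w_def using that by (intro trapezoid_form l fin big)
  have "0 < L2.qf f" unfolding L
    by (rule sum_pos2[OF J j0(1)]) (use j0(2) p less_imp_le[OF p] in auto)
  moreover have "fm.qf f < (\<Sum>j\<in>J. (cmod (c j))\<^sup>2 * (- (1 / l)\<^sup>2 * L2.qf (w j)))" unfolding M
  proof (rule sum_strict_mono_ex1[OF J])
    show "\<forall>j\<in>J. (cmod (c j))\<^sup>2 * fm.qf (w j) \<le> (cmod (c j))\<^sup>2 * (- (1 / l)\<^sup>2 * L2.qf (w j))"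
      using n by (intro ballI mult_left_mono) (auto intro: less_imp_le)
    show "\<exists>j\<in>J. (cmod (c j))\<^sup>2 * fm.qf (w j) < (cmod (c j))\<^sup>2 * (- (1 / l)\<^sup>2 * L2.qf (w j))"
    proof (rule bexI[of _ j0])
      show "(cmod (c j0))\<^sup>2 * fm.qf (w j0) < (cmod (c j0))\<^sup>2 * (- (1 / l)\<^sup>2 * L2.qf (w j0))"
        by (rule mult_strict_left_mono[OF n[OF j0(1)]]) (use j0(2) in simp)
    qed (rule j0(1))
  qed
  moreover have "(\<Sum>j\<in>J. (cmod (c j))\<^sup>2 * (- (1 / l)\<^sup>2 * L2.qf (w j))) = - (1 / l)\<^sup>2 * L2.qf f"
    unfolding L sum_distrib_left by (intro sum.cong) auto
  ultimately show "0 < L2.qf f \<and> fm.qf f < - (1 / l)\<^sup>2 * L2.qf f" by simp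
qed simp

text \<open>One of the two parity classes contains at least half of \<open>J\<close>; this costs the
  factor 2.\<close>

lemma count_scale:
  assumes disc: "negative_spectrum_discrete (H_op \<mu>)" and l: "0 < l" and J: "finite J"
    and fin: "\<And>j. j \<in> J \<Longrightarrow> emeasure \<mu> {b + l * real j..<b + l * real j + l} < \<infinity>"
    and big: "\<And>j. j \<in> J \<Longrightarrow> 6 / l < measure \<mu> {b + l * real j..<b + l * real j + l}"
  shows "\<exists>F. finite F \<and> F \<subseteq> {e \<in> negative_eigenvalues (H_op \<mu>). e < - (1 / l)\<^sup>2} \<and>
    card J \<le> 2 * (\<Sum>e\<in>F. multiplicity (H_op \<mu>) (complex_of_real e))"
proof -
  define J0 where "J0 = {j \<in> J. even j}"
  define J1 where "J1 = {j \<in> J. odd j}"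
  have "J = J0 \<union> J1" "J0 \<inter> J1 = {}" by (auto simp: J0_def J1_def)
  then have card: "card J = card J0 + card J1" using J by (metis card_Un_disjoint finite_Un)
  have fin01: "finite J0" "finite J1" using J by (auto simp: J0_def J1_def)
  have "\<exists>F. finite F \<and> F \<subseteq> {e \<in> negative_eigenvalues (H_op \<mu>). e < - (1 / l)\<^sup>2} \<and>
    card J0 \<le> (\<Sum>e\<in>F. multiplicity (H_op \<mu>) (complex_of_real e))"
    by (rule count_parity[OF disc l fin01(1)]) (use fin big in \<open>auto simp: J0_def\<close>)
  moreover have "\<exists>F. finite F \<and> F \<subseteq> {e \<in> negative_eigenvalues (H_op \<mu>). e < - (1 / l)\<^sup>2} \<and>
    card J1 \<le> (\<Sum>e\<in>F. multiplicity (H_op \<mu>) (complex_of_real e))"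
    by (rule count_parity[OF disc l fin01(2)]) (use fin big in \<open>auto simp: J1_def\<close>)
  moreover have "card J \<le> 2 * card J0 \<or> card J \<le> 2 * card J1" using card by linarith
  ultimately show ?thesis by (meson order_trans mult_le_mono2)
qed

lemma finite_sum_le_sum_sqrt:
  assumes "finite F" "F \<subseteq> negative_eigenvalues (H_op \<mu>)"
  shows "ennreal (\<Sum>e\<in>F. real (multiplicity (H_op \<mu>) (complex_of_real e)) * sqrt \<bar>e\<bar>)
    \<le> sum_sqrt_negative_eigenvalues (H_op \<mu>)"
proof -
  let ?f = "\<lambda>l. of_nat (multiplicity (H_op \<mu>) (complex_of_real l)) * ennreal (\<bar>l\<bar> powr (1/2))"
  have "ennreal (\<Sum>e\<in>F. real (multiplicity (H_op \<mu>) (complex_of_real e)) * sqrt \<bar>e\<bar>) = (\<Sum>e\<in>F. ?f e)"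
    by (simp add: sum_ennreal[symmetric] ennreal_mult powr_half_sqrt ennreal_of_nat_eq_real_of_nat)
  also have "\<dots> \<le> sum_sqrt_negative_eigenvalues (H_op \<mu>)"
    unfolding sum_sqrt_negative_eigenvalues_def
    by (subst nonneg_infsum_complete) (use assms in \<open>auto intro: SUP_upper\<close>)
  finally show ?thesis .
qed

text \<open>A grid interval of length \<open>l\<close> is called heavy here if its mass exceeds \<open>6/l\<close>. Every heavy
  interval consists of two halves that are heavy or have mass at most \<open>12/l\<close>, so that
  the total mass is controlled by the numbers of the heavy intervals at all scales.\<close>

lemma window_mass:
  assumes disc: "negative_spectrum_discrete (H_op \<mu>)"
    and C: "0 < C" "\<And>x. emeasure \<mu> {x..x+1} \<le> ennreal C"
    and fin: "\<And>a b. emeasure \<mu> {a..<b} < \<infinity>"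
  shows "emeasure \<mu> {- (2 ^ A)..<2 ^ A} \<le> ennreal (12 / 2 ^ A) + 96 * sum_sqrt_negative_eigenvalues (H_op \<mu>)"
proof -
  define len where "len i = 2 ^ A / (2 :: real) ^ i" for i
  have len: "0 < len i" "len (Suc i) = len i / 2" for i by (auto simp: len_def)
  define I where "I i j = {- (2 ^ A) + len i * real j..<- (2 ^ A) + len i * real j + len i}" for i j
  define m where "m i j = measure \<mu> (I i j)" for i j
  \<comment> \<open>The window has length \<open>2 * len 0\<close>, hence consists of
    \<open>2 ^ Suc i\<close> grid intervals at level \<open>i\<close>; \<open>P i\<close> collects
    the heavy ones.\<close>
  define P where "P i = {j. j < 2 ^ Suc i \<and> 6 / len i < m i j}" for i
  have finP: "finite (P i)" for i by (simp add: P_def)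
  have m0: "0 \<le> m i j" for i j by (simp add: m_def)
  have union: "measure \<mu> (I i j \<union> I i' j') = measure \<mu> (I i j) + measure \<mu> (I i' j')"
    if "I i j \<inter> I i' j' = {}" for i j i' j'
  proof -
    have "emeasure \<mu> (I i j) \<noteq> \<infinity>" for i j using fin unfolding I_def by (simp add: less_top)
    from measure_Union[OF this this _ _ that] show ?thesis by (simp add: I_def sets_mu)
  qed
  have split: "m i j = m (Suc i) (2 * j) + m (Suc i) (2 * j + 1)" for i j
  proof -
    have "I i j = I (Suc i) (2 * j) \<union> I (Suc i) (2 * j + 1)" "I (Suc i) (2 * j) \<inter> I (Suc i) (2 * j + 1) = {}"
      using len(1)[of i] by (auto simp: I_def len(2) field_simps)
    then show ?thesis unfolding m_def by (simp add: union)
  qed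
  define g where "g i j = (if 6 / len i < m i j then m i j else 0)" for i j
  have mg: "m i j \<le> g i j + 6 / len i" for i j using len(1)[of i] by (auto simp: g_def)
  have g0: "0 \<le> g i j" for i j by (simp add: g_def m0)
  define M where "M i = (\<Sum>j<2 ^ Suc i. g i j)" for i
  have MP: "M i = (\<Sum>j\<in>P i. m i j)" for i
    unfolding M_def by (rule sum.mono_neutral_cong_right) (auto simp: P_def g_def)
  \<comment> \<open>A light half has mass at most \<open>6 / len (Suc i) = 12 / len i\<close>, and
    two of them give 24.\<close>
  have step: "M i \<le> M (Suc i) + 24 * (real (card (P i)) / len i)" for i
  proof -
    have "M i \<le> (\<Sum>j\<in>P i. (g (Suc i) (2 * j) + g (Suc i) (2 * j + 1)) + 24 / len i)"
      unfolding MP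
    proof (rule sum_mono)
      fix j
      have "6 / len (Suc i) = 12 / len i" by (simp add: len(2))
      then show "m i j \<le> (g (Suc i) (2 * j) + g (Suc i) (2 * j + 1)) + 24 / len i"
        using mg[of "Suc i" "2 * j"] mg[of "Suc i" "2 * j + 1"] split[of i j] by simp
    qed
    also have "\<dots> = (\<Sum>j\<in>P i. g (Suc i) (2 * j) + g (Suc i) (2 * j + 1)) + 24 * (real (card (P i)) / len i)"
      by (simp add: sum.distrib)
    also have "(\<Sum>j\<in>P i. g (Suc i) (2 * j) + g (Suc i) (2 * j + 1)) \<le> (\<Sum>j<2 ^ Suc i. g (Suc i) (2 * j) + g (Suc i) (2 * j + 1))"
      by (rule sum_mono2) (auto simp: P_def g0 intro: add_nonneg_nonneg)
    also have "\<dots> = M (Suc i)" unfolding M_def by (subst sum_lessThan_double) simp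
    finally show ?thesis by simp
  qed
  have iter: "M 0 \<le> M n + 24 * (\<Sum>i<n. real (card (P i)) / len i)" for n
  proof (induction n)
    case (Suc n)
    then show ?case using step[of n] by (simp add: distrib_left)
  qed simp
  \<comment> \<open>At this level the length is at most 1 and the threshold \<open>6 / len n\<close>
    is at least \<open>C\<close>, so the Brinck bound leaves no heavy interval and the iteration
    stops.\<close>
  obtain n where n: "max (2 ^ A) (C * 2 ^ A / 6) < (2 :: real) ^ n"
    using real_arch_pow[of 2 "max (2 ^ A) (C * 2 ^ A / 6)"] by auto
  have "M n = 0" unfolding M_def
  proof (rule sum.neutral, rule ballI)
    fix j
    have "len n \<le> 1" using n by (simp add: len_def)
    then have "emeasure \<mu> (I n j) \<le> emeasure \<mu> {- (2 ^ A) + len n * real j..- (2 ^ A) + len n * real j + 1}"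
      by (intro emeasure_mono) (auto simp: I_def sets_mu)
    also have "\<dots> \<le> ennreal C" by (rule C(2))
    finally have "m n j \<le> C" unfolding m_def measure_def using C(1) by (intro enn2real_leI) auto
    also have "C \<le> 6 / len n" using n by (simp add: len_def field_simps)
    finally show "g n j = 0" by (simp add: g_def)
  qed
  then have M0: "M 0 \<le> 24 * (\<Sum>i<n. real (card (P i)) / len i)" using iter[of n] by simp
  let ?mult = "\<lambda>e. real (multiplicity (H_op \<mu>) (complex_of_real e))"
  have "\<exists>F. finite F \<and> F \<subseteq> {e \<in> negative_eigenvalues (H_op \<mu>). e < - (1 / len i)\<^sup>2} \<and>
      card (P i) \<le> 2 * (\<Sum>e\<in>F. multiplicity (H_op \<mu>) (complex_of_real e))" for i
    by (rule count_scale[OF disc len(1) finP, where b="- (2 ^ A)"]) (use fin in \<open>auto simp: P_def m_def I_def\<close>)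
  then obtain F where F: "\<And>i. finite (F i)" "\<And>i. F i \<subseteq> {e \<in> negative_eigenvalues (H_op \<mu>). e < - (1 / len i)\<^sup>2}"
    "\<And>i. card (P i) \<le> 2 * (\<Sum>e\<in>F i. multiplicity (H_op \<mu>) (complex_of_real e))" by metis
  define G where "G = (\<Union>i<n. F i)"
  have G: "finite G" "G \<subseteq> negative_eigenvalues (H_op \<mu>)" using F by (auto simp: G_def)
  have neg: "e < 0" if "e \<in> G" for e using that G(2) by (auto simp: negative_eigenvalues_def)
  define c where "c = 1 / (2 :: real) ^ A"
  have c: "0 < c" "1 / len i = 2 ^ i * c" for i by (auto simp: c_def len_def)
  have "(\<Sum>i<n. real (card (P i)) / len i) \<le> (\<Sum>i<n. \<Sum>e\<in>G. 2 * ?mult e * (if 2 ^ i * c < sqrt \<bar>e\<bar> then 2 ^ i * c else 0))"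
  proof (rule sum_mono)
    fix i assume i: "i \<in> {..<n}"
    have "real (card (P i)) \<le> real (2 * (\<Sum>e\<in>F i. multiplicity (H_op \<mu>) (complex_of_real e)))"
      using F(3)[of i] by (simp only: of_nat_le_iff)
    also have "\<dots> = 2 * (\<Sum>e\<in>F i. ?mult e)" by simp
    finally have "real (card (P i)) * (1 / len i) \<le> 2 * (\<Sum>e\<in>F i. ?mult e) * (1 / len i)"
      using len(1)[of i] by (intro mult_right_mono) auto
    also have "\<dots> = (\<Sum>e\<in>F i. 2 * ?mult e * (2 ^ i * c))"
      unfolding c(2) by (simp add: sum_distrib_left sum_distrib_right)
    also have "\<dots> = (\<Sum>e\<in>F i. 2 * ?mult e * (if 2 ^ i * c < sqrt \<bar>e\<bar> then 2 ^ i * c else 0))"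
    proof (rule sum.cong)
      fix e assume "e \<in> F i"
      then have "(2 ^ i * c)\<^sup>2 < \<bar>e\<bar>" using F(2)[of i] by (auto simp: c(2)[symmetric])
      then have "2 ^ i * c < sqrt \<bar>e\<bar>" by (rule real_less_rsqrt)
      then show "2 * ?mult e * (2 ^ i * c) = 2 * ?mult e * (if 2 ^ i * c < sqrt \<bar>e\<bar> then 2 ^ i * c else 0)" by simp
    qed simp
    also have "\<dots> \<le> (\<Sum>e\<in>G. 2 * ?mult e * (if 2 ^ i * c < sqrt \<bar>e\<bar> then 2 ^ i * c else 0))"
      using i c(1) by (intro sum_mono2 G(1)) (auto simp: G_def)
    finally show "real (card (P i)) / len i \<le> (\<Sum>e\<in>G. 2 * ?mult e * (if 2 ^ i * c < sqrt \<bar>e\<bar> then 2 ^ i * c else 0))"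
      by simp
  qed
  \<comment> \<open>For a fixed eigenvalue \<open>e\<close> only the scales with
    \<open>1 / len i < sqrt \<bar>e\<bar>\<close> contribute, and these form a geometric
    progression.\<close>
  also have "\<dots> = (\<Sum>e\<in>G. 2 * ?mult e * (\<Sum>i<n. if 2 ^ i * c < sqrt \<bar>e\<bar> then 2 ^ i * c else 0))"
    by (subst sum.swap) (simp only: sum_distrib_left)
  also have "\<dots> \<le> (\<Sum>e\<in>G. 2 * ?mult e * (2 * sqrt \<bar>e\<bar>))"
    by (intro sum_mono mult_left_mono geometric_below c(1)) (use neg in auto)
  also have "\<dots> = 4 * (\<Sum>e\<in>G. ?mult e * sqrt \<bar>e\<bar>)"
    unfolding sum_distrib_left by (intro sum.cong) auto
  finally have heavy: "(\<Sum>i<n. real (card (P i)) / len i) \<le> 4 * (\<Sum>e\<in>G. ?mult e * sqrt \<bar>e\<bar>)" .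
  have W: "{- (2 ^ A)..<2 ^ A} = I 0 0 \<union> I 0 1" "I 0 0 \<inter> I 0 1 = {}" by (auto simp: I_def len_def)
  have "measure \<mu> {- (2 ^ A)..<2 ^ A} = m 0 0 + m 0 1"
    unfolding W(1) m_def by (rule union[OF W(2)])
  \<comment> \<open>The two coarsest intervals may be light. The resulting loss of
    \<open>12 / 2 ^ A\<close> disappears as the window grows, because the coarsest scale grows with
    it.\<close>
  also have "\<dots> \<le> (g 0 0 + 6 / len 0) + (g 0 1 + 6 / len 0)" by (intro add_mono mg)
  also have "\<dots> = M 0 + 12 / 2 ^ A" by (simp add: M_def len_def numeral_2_eq_2)
  also have "\<dots> \<le> 12 / 2 ^ A + 96 * (\<Sum>e\<in>G. ?mult e * sqrt \<bar>e\<bar>)" using M0 heavy by simp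
  finally have "measure \<mu> {- (2 ^ A)..<2 ^ A} \<le> 12 / 2 ^ A + 96 * (\<Sum>e\<in>G. ?mult e * sqrt \<bar>e\<bar>)" .
  moreover have "emeasure \<mu> {- (2 ^ A)..<2 ^ A} = ennreal (measure \<mu> {- (2 ^ A)..<2 ^ A})"
    using fin by (intro emeasure_eq_ennreal_measure) (auto simp: less_top[symmetric])
  ultimately have "emeasure \<mu> {- (2 ^ A)..<2 ^ A} \<le> ennreal (12 / 2 ^ A + 96 * (\<Sum>e\<in>G. ?mult e * sqrt \<bar>e\<bar>))"
    by (simp add: ennreal_leI)
  also have "\<dots> = ennreal (12 / 2 ^ A) + 96 * ennreal (\<Sum>e\<in>G. ?mult e * sqrt \<bar>e\<bar>)"
    by (subst ennreal_plus) (auto simp: ennreal_mult sum_nonneg)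
  also have "\<dots> \<le> ennreal (12 / 2 ^ A) + 96 * sum_sqrt_negative_eigenvalues (H_op \<mu>)"
    by (intro add_left_mono mult_left_mono finite_sum_le_sum_sqrt G) simp
  finally show ?thesis .
qed

lemma total_mass_bound:
  assumes disc: "negative_spectrum_discrete (H_op \<mu>)"
    and C: "0 < C" "\<And>x. emeasure \<mu> {x..x+1} \<le> ennreal C"
    and fin: "\<And>a b. emeasure \<mu> {a..<b} < \<infinity>"
  shows "emeasure \<mu> UNIV \<le> 96 * sum_sqrt_negative_eigenvalues (H_op \<mu>)"
proof -
  define W where "W A = {- (2 ^ A)..<2 ^ A :: real}" for A :: nat
  have "incseq W" unfolding incseq_Suc_iff
    by (auto simp: W_def intro: order_trans[rotated] less_le_trans)
  then have "(\<lambda>A. emeasure \<mu> (W A)) \<longlonglongrightarrow> emeasure \<mu> (\<Union>A. W A)"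
    by (rule Lim_emeasure_incseq[rotated]) (auto simp: W_def sets_mu)
  also have "(\<Union>A. W A) = UNIV"
  proof (rule UNIV_eq_I[symmetric])
    fix x :: real
    obtain n :: nat where "\<bar>x\<bar> < 2 ^ n" using real_arch_pow[of 2 "\<bar>x\<bar>"] by auto
    then show "x \<in> (\<Union>A. W A)" by (auto simp: W_def abs_less_iff intro!: exI[of _ n])
  qed
  finally have 1: "(\<lambda>A. emeasure \<mu> (W A)) \<longlonglongrightarrow> emeasure \<mu> UNIV" .
  have "(\<lambda>A. 12 / 2 ^ A :: real) \<longlonglongrightarrow> 0"
    using tendsto_mult_right_zero[OF LIMSEQ_realpow_zero[of "1/2"], of 12] by (simp add: power_one_over)
  then have "(\<lambda>A. ennreal (12 / 2 ^ A)) \<longlonglongrightarrow> ennreal 0" by (rule tendsto_ennrealI)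
  then have 2: "(\<lambda>A. ennreal (12 / 2 ^ A) + 96 * sum_sqrt_negative_eigenvalues (H_op \<mu>)) \<longlonglongrightarrow>
     ennreal 0 + 96 * sum_sqrt_negative_eigenvalues (H_op \<mu>)" by (intro tendsto_add tendsto_const)
  have "emeasure \<mu> UNIV \<le> ennreal 0 + 96 * sum_sqrt_negative_eigenvalues (H_op \<mu>)"
    by (rule LIMSEQ_le[OF 1 2]) (auto simp: W_def intro!: window_mass[OF disc C fin])
  then show ?thesis by simp
qed

end

section \<open>Upper bound\<close>

lemma cnj_measurable [measurable]: "cnj \<in> borel_measurable borel"
  by (intro borel_measurable_continuous_onI continuous_intros)

text \<open>The product of the signs is -1 exactly for the cut points \<open>z\<close> in the
  half-open interval between \<open>x\<close> and \<open>y\<close>, so the integral loses twice the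
  clamped distance.\<close>

lemma integral_cut_product:
  fixes x y M :: real
  assumes M: "0 < M"
  defines "cl \<equiv> \<lambda>x. max (- M) (min M x)"
  defines "s \<equiv> \<lambda>z x. if z \<le> x then 1 else - 1 :: real"
  shows "(LINT z|lborel. indicator {-M..M} z * (s z x * s z y)) = 2 * M * (1 - \<bar>cl x - cl y\<bar> / M)"
proof -
  let ?A = "{min (cl x) (cl y)<..max (cl x) (cl y)}"
  have A: "measure lborel ?A = \<bar>cl x - cl y\<bar>" by (auto simp: max_def min_def)
  have eq: "AE z in lborel. indicator {-M..M} z * (s z x * s z y) = indicator {-M..M} z - 2 * indicator ?A z"
    using AE_lborel_singleton[of "-M"] AE_lborel_singleton[of M]
    by eventually_elim (use M in \<open>auto simp: s_def cl_def indicator_def max_def min_def split: if_splits\<close>)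
  have i: "integrable lborel (indicator {-M..M} :: real \<Rightarrow> real)" "integrable lborel (indicator ?A :: real \<Rightarrow> real)"
    by (auto intro!: integrable_real_indicator emeasure_bounded_finite)
  have "(LINT z|lborel. indicator {-M..M} z * (s z x * s z y)) = (LINT z|lborel. indicator {-M..M} z - 2 * indicator ?A z)"
    by (rule integral_cong_AE[OF _ _ eq]) (auto simp: s_def)
  also have "\<dots> = 2 * M - 2 * \<bar>cl x - cl y\<bar>"
    using i M by (subst Bochner_Integration.integral_diff) (auto simp: A simp del: measure_lborel_Ioc)
  also have "\<dots> = 2 * M * (1 - \<bar>cl x - cl y\<bar> / M)" using M by (simp add: field_simps)
  finally show ?thesis .
qed

text \<open>Factorization of the two-sided exponential kernel into one-sided ones. It makes that
  kernel positive semidefinite and ties it to \<open>H1_representation\<close>.\<close>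

lemma integral_kern_kern:
  assumes k: "0 < k"
  shows "(LINT z|lborel. kern k x z * kern k y z) = exp (- k * \<bar>x - y\<bar>) / (2 * k)"
proof -
  have *: "(LINT z|lborel. kern k x z * kern k y z) = exp (- k * \<bar>x - y\<bar>) / (2 * k)" if "x \<le> y" for x y
  proof -
    have "kern k x z * kern k y z = exp (- k * (y - x)) * kern (2 * k) x z" for z
      using that by (auto simp: kern_def algebra_simps simp flip: exp_add)
    then show ?thesis using has_integral_kern[of "2 * k" x] k that by simp
  qed
  show ?thesis
    using *[of x y] *[of y x] by (cases "x \<le> y") (auto simp: mult.commute abs_minus_commute)
qed

section \<open>Sums of the largest eigenvalues of kernels over a finite measure\<close>

locale finite_form_bounded_measure = form_bounded_measure + finite_measure \<mu>
begin

text \<open>A class that contains \<open>H1\<close>, is stable under multiplication by signs, and on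
  which kernel forms converge because \<open>\<mu>\<close> is finite.\<close>

definition bounded_borel :: "(real \<Rightarrow> complex) set" where
  "bounded_borel = {\<phi> \<in> borel_measurable borel. \<exists>M. \<forall>x. cmod (\<phi> x) \<le> M}"

definition kernel :: "(real \<times> real \<Rightarrow> real) \<Rightarrow> bool" where
  "kernel J \<longleftrightarrow> J \<in> borel_measurable (borel \<Otimes>\<^sub>M borel) \<and> (\<forall>z. \<bar>J z\<bar> \<le> 1)"

definition kernel_form :: "(real \<times> real \<Rightarrow> real) \<Rightarrow> (real \<Rightarrow> complex) \<Rightarrow> complex" where
  "kernel_form J \<phi> = (LINT z|(\<mu> \<Otimes>\<^sub>M \<mu>). complex_of_real (J z) * (\<phi> (fst z) * cnj (\<phi> (snd z))))"

definition orthonormal :: "nat \<Rightarrow> (nat \<Rightarrow> real \<Rightarrow> complex) \<Rightarrow> bool" where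
  "orthonormal n \<phi> \<longleftrightarrow> (\<forall>i<n. \<phi> i \<in> bounded_borel) \<and>
     (\<forall>i<n. \<forall>j<n. (LINT x|\<mu>. \<phi> i x * cnj (\<phi> j x)) = (if i = j then 1 else 0))"

text \<open>\<open>b\<close> bounds the sum of the \<open>n\<close> largest eigenvalues of the integral operator with kernel \<open>J\<close>.\<close>

definition kernel_bound :: "(real \<times> real \<Rightarrow> real) \<Rightarrow> nat \<Rightarrow> real \<Rightarrow> bool" where
  "kernel_bound J n b \<longleftrightarrow> (\<forall>\<phi>. orthonormal n \<phi> \<longrightarrow> (\<Sum>i<n. Re (kernel_form J (\<phi> i))) \<le> b)"

lemma kernel_abs_le: "kernel J \<Longrightarrow> \<bar>J z\<bar> \<le> 1"
  unfolding kernel_def by blast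

lemma sets_mu2: "sets (\<mu> \<Otimes>\<^sub>M \<mu>) = sets (borel \<Otimes>\<^sub>M borel)"
  by (intro sets_pair_measure_cong sets_mu)

lemma meas_mu: "measurable \<mu> N = measurable borel N"
  by (rule measurable_cong_sets[OF sets_mu refl])

lemma meas_mu2: "measurable (\<mu> \<Otimes>\<^sub>M \<mu>) N = measurable (borel \<Otimes>\<^sub>M borel) N"
  by (rule measurable_cong_sets[OF sets_mu2 refl])

sublocale P: pair_sigma_finite \<mu> \<mu>
  by (intro pair_sigma_finite.intro) unfold_locales
sublocale P2: finite_measure "\<mu> \<Otimes>\<^sub>M \<mu>"
  by (rule finite_measure_pair_measure) unfold_locales
sublocale PL: pair_sigma_finite "\<mu> \<Otimes>\<^sub>M \<mu>" "lborel :: real measure"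
  by (intro pair_sigma_finite.intro sigma_finite_lborel) unfold_locales
sublocale MZ: pair_sigma_finite \<mu> "lborel :: real measure"
  by (intro pair_sigma_finite.intro sigma_finite_lborel) unfold_locales

lemma bounded_borel_sq_integrable: "\<phi> \<in> bounded_borel \<Longrightarrow> \<phi> \<in> sq_integrable \<mu>"
proof -
  assume "\<phi> \<in> bounded_borel"
  then obtain M where m [measurable]: "\<phi> \<in> borel_measurable borel" and M: "\<And>x. cmod (\<phi> x) \<le> M"
    by (auto simp: bounded_borel_def)
  have "integrable \<mu> (\<lambda>x. (cmod (\<phi> x))\<^sup>2)"
    by (rule integrable_const_bound[where B="M\<^sup>2"]) (auto simp: meas_mu intro!: power_mono M)
  then show ?thesis using m by (simp add: sq_integrable_def meas_mu)
qed

lemma bounded_borel_mult: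
  assumes "\<phi> \<in> bounded_borel" "s \<in> borel_measurable borel" "\<And>x. cmod (s x) \<le> C"
  shows "(\<lambda>x. s x * \<phi> x) \<in> bounded_borel"
proof -
  obtain M where m [measurable]: "\<phi> \<in> borel_measurable borel" and M: "\<And>x. cmod (\<phi> x) \<le> M"
    using assms by (auto simp: bounded_borel_def)
  have "cmod (s x * \<phi> x) \<le> C * M" for x
    unfolding norm_mult using assms(3)[of x] M[of x] order_trans[OF norm_ge_zero assms(3)[of x]] by (intro mult_mono) auto
  moreover have "(\<lambda>x. s x * \<phi> x) \<in> borel_measurable borel" using assms(2) by measurable
  ultimately show ?thesis unfolding bounded_borel_def by blast
qed

lemma bounded_borel_product_integrable:
  assumes "\<phi> \<in> bounded_borel" "\<psi> \<in> bounded_borel"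
  shows "integrable (\<mu> \<Otimes>\<^sub>M \<mu>) (\<lambda>z. \<phi> (fst z) * cnj (\<psi> (snd z)))"
proof -
  obtain M N where [measurable]: "\<phi> \<in> borel_measurable borel" "\<psi> \<in> borel_measurable borel"
    and M: "\<And>x. cmod (\<phi> x) \<le> M" and N: "\<And>x. cmod (\<psi> x) \<le> N"
    using assms by (auto simp: bounded_borel_def)
  show ?thesis
  proof (rule P2.integrable_const_bound[where B="M * N"])
    show "AE z in \<mu> \<Otimes>\<^sub>M \<mu>. norm (\<phi> (fst z) * cnj (\<psi> (snd z))) \<le> M * N"
    proof (rule AE_I2)
      fix z
      show "norm (\<phi> (fst z) * cnj (\<psi> (snd z))) \<le> M * N"
        unfolding norm_mult using M[of "fst z"] N[of "snd z"] order_trans[OF norm_ge_zero M[of "fst z"]]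
        by (intro mult_mono) auto
    qed
    show "(\<lambda>z. \<phi> (fst z) * cnj (\<psi> (snd z))) \<in> borel_measurable (\<mu> \<Otimes>\<^sub>M \<mu>)"
      unfolding meas_mu2 by measurable
  qed
qed

lemma kernel_form_integrable:
  assumes "kernel J" "\<phi> \<in> bounded_borel"
  shows "integrable (\<mu> \<Otimes>\<^sub>M \<mu>) (\<lambda>z. complex_of_real (J z) * (\<phi> (fst z) * cnj (\<phi> (snd z))))"
proof (rule Bochner_Integration.integrable_bound[OF bounded_borel_product_integrable[OF assms(2,2)]])
  have [measurable]: "J \<in> borel_measurable (borel \<Otimes>\<^sub>M borel)" "\<phi> \<in> borel_measurable borel"
    using assms by (auto simp: kernel_def bounded_borel_def)
  show "(\<lambda>z. complex_of_real (J z) * (\<phi> (fst z) * cnj (\<phi> (snd z)))) \<in> borel_measurable (\<mu> \<Otimes>\<^sub>M \<mu>)"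
    unfolding meas_mu2 by measurable
  show "AE z in \<mu> \<Otimes>\<^sub>M \<mu>. norm (complex_of_real (J z) * (\<phi> (fst z) * cnj (\<phi> (snd z)))) \<le> norm (\<phi> (fst z) * cnj (\<phi> (snd z)))"
    using assms(1) by (intro AE_I2) (simp add: kernel_abs_le norm_mult mult_left_le_one_le)
qed

text \<open>The constant kernel has rank one: its form at \<open>\<phi> i\<close> is the squared
  modulus of the inner product with the constant 1. Bessel's inequality bounds the sum by the
  squared norm of 1, which is the total mass, for every \<open>n\<close>.\<close>

lemma kernel_bound_one: "kernel_bound (\<lambda>_. 1) n (measure \<mu> UNIV)"
  unfolding kernel_bound_def
proof (intro allI impI)
  fix \<phi> assume \<phi>: "orthonormal n \<phi>"
  have bb: "\<phi> i \<in> bounded_borel" if "i < n" for i using \<phi> that by (simp add: orthonormal_def)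
  have one: "(\<lambda>_. 1) \<in> sq_integrable \<mu>" by (simp add: sq_integrable_def meas_mu)
  have sp: "space \<mu> = UNIV" using sets_eq_imp_space_eq[OF sets_mu] by simp
  have "Re (kernel_form (\<lambda>_. 1) (\<phi> i)) = (cmod (LINT x|\<mu>. 1 * cnj (\<phi> i x)))\<^sup>2" if "i < n" for i
  proof -
    have i: "integrable (\<mu> \<Otimes>\<^sub>M \<mu>) (\<lambda>z. \<phi> i (fst z) * cnj (\<phi> i (snd z)))"
      using bb[OF that] by (intro bounded_borel_product_integrable)
    have "kernel_form (\<lambda>_. 1) (\<phi> i) = (LINT x|\<mu>. LINT y|\<mu>. \<phi> i x * cnj (\<phi> i y))"
      unfolding kernel_form_def using P.integral_fst'[OF i] by simp
    also have "\<dots> = (LINT x|\<mu>. \<phi> i x) * cnj (LINT x|\<mu>. \<phi> i x)" by simp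
    also have "\<dots> = complex_of_real ((cmod (LINT x|\<mu>. \<phi> i x))\<^sup>2)" by (simp only: complex_norm_square)
    finally show ?thesis by simp
  qed
  then have "(\<Sum>i<n. Re (kernel_form (\<lambda>_. 1) (\<phi> i))) = (\<Sum>i<n. (cmod (LINT x|\<mu>. 1 * cnj (\<phi> i x)))\<^sup>2)" by simp
  also have "\<dots> \<le> mu.qf (\<lambda>_. 1)"
    using \<phi> by (intro mu.Bessel bounded_borel_sq_integrable bb one) (auto simp: orthonormal_def)
  also have "\<dots> = measure \<mu> UNIV" by (simp add: mu_qf sp)
  finally show "(\<Sum>i<n. Re (kernel_form (\<lambda>_. 1) (\<phi> i))) \<le> measure \<mu> UNIV" .
qed

text \<open>The average of the sign products in \<open>integral_cut_product\<close>. It equals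
  \<open>1 - \<bar>x - y\<bar> / M\<close> when both points lie in \<open>{-M..M}\<close>; clamping
  keeps the range of cut points bounded.\<close>

definition cut_kernel :: "real \<Rightarrow> real \<times> real \<Rightarrow> real" where
  "cut_kernel M z = 1 - \<bar>max (- M) (min M (fst z)) - max (- M) (min M (snd z))\<bar> / M"

lemma kernel_mult: "kernel J \<Longrightarrow> kernel L \<Longrightarrow> kernel (\<lambda>z. J z * L z)"
proof -
  assume "kernel J" "kernel L"
  then have [measurable]: "J \<in> borel_measurable (borel \<Otimes>\<^sub>M borel)" "L \<in> borel_measurable (borel \<Otimes>\<^sub>M borel)"
    and "\<And>z. \<bar>J z\<bar> \<le> 1" "\<And>z. \<bar>L z\<bar> \<le> 1" by (auto simp: kernel_def)
  moreover from this(3,4) have "\<bar>J z\<bar> * \<bar>L z\<bar> \<le> 1 * 1" for z by (intro mult_mono) auto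
  ultimately show ?thesis by (auto simp: kernel_def abs_mult)
qed

lemma kernel_cut: "0 < M \<Longrightarrow> kernel (cut_kernel M)"
proof -
  assume M: "0 < M"
  have "\<bar>cut_kernel M z\<bar> \<le> 1" for z
  proof -
    have "\<bar>max (- M) (min M (fst z)) - max (- M) (min M (snd z))\<bar> \<le> 2 * M" using M by (auto simp: max_def min_def)
    then have "\<bar>max (- M) (min M (fst z)) - max (- M) (min M (snd z))\<bar> / M \<le> 2" using M by (simp add: field_simps)
    then show ?thesis using M by (simp add: cut_kernel_def abs_le_iff)
  qed
  moreover have "cut_kernel M \<in> borel_measurable (borel \<Otimes>\<^sub>M borel)"
    unfolding cut_kernel_def[abs_def] by measurable
  ultimately show ?thesis by (simp add: kernel_def)
qed

text \<open>The kernel \<open>J\<close> times the cut kernel is the average of the kernels \<open>s\<^sub>z(x) J(x,y) s\<^sub>z(y)\<close> over the cut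
  points \<open>z\<close>, where \<open>s\<^sub>z\<close> is \<open>1\<close> to the right of \<open>z\<close> and \<open>-1\<close> to the left. Multiplication by \<open>s\<^sub>z\<close>
  preserves orthonormality.\<close>

lemma kernel_bound_cut:
  assumes J: "kernel J" and M: "0 < M" and b: "kernel_bound J n b"
  shows "kernel_bound (\<lambda>z. J z * cut_kernel M z) n b"
  unfolding kernel_bound_def
proof (intro allI impI)
  fix \<phi> assume \<phi>: "orthonormal n \<phi>"
  have bb: "\<phi> i \<in> bounded_borel" if "i < n" for i using \<phi> that by (simp add: orthonormal_def)
  define s where "s z x = (if z \<le> x then 1 else - 1 :: real)" for z x :: real
  define \<psi> where "\<psi> z i x = complex_of_real (s z x) * \<phi> i x" for z i x
  have s1: "\<bar>s z x\<bar> = 1" "s z x * s z x = 1" for z x by (auto simp: s_def)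
  have sm [measurable]: "s z \<in> borel_measurable borel" for z unfolding s_def[abs_def] by measurable
  have on: "orthonormal n (\<psi> z)" for z
    unfolding orthonormal_def
  proof (intro conjI allI impI)
    show "\<psi> z i \<in> bounded_borel" if "i < n" for i
      unfolding \<psi>_def[abs_def] by (rule bounded_borel_mult[OF bb[OF that], of _ 1]) (auto simp: s1)
    have "\<psi> z i x * cnj (\<psi> z j x) = complex_of_real (s z x * s z x) * (\<phi> i x * cnj (\<phi> j x))" for i j x
      by (simp add: \<psi>_def mult_ac)
    then show "(LINT x|\<mu>. \<psi> z i x * cnj (\<psi> z j x)) = (if i = j then 1 else 0)" if "i < n" "j < n" for i j
      using \<phi> that by (simp add: s1 orthonormal_def)
  qed
  have Jm [measurable]: "J \<in> borel_measurable (borel \<Otimes>\<^sub>M borel)" and J1: "\<And>z. \<bar>J z\<bar> \<le> 1"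
    using J by (auto simp: kernel_def)
  define k where "k p = complex_of_real (J (fst p) * (s (snd p) (fst (fst p)) * s (snd p) (snd (fst p))))" for p
  \<comment> \<open>Integrating \<open>G i\<close> over the cut point produces the cut kernel
    (\<open>inner\<close>), integrating it over the two space variables produces the form of
    \<open>J\<close> at the sign-changed vectors (\<open>outer\<close>). Fubini equates the
    two.\<close>
  define G where "G i p = k p * ((\<phi> i (fst (fst p)) * cnj (\<phi> i (snd (fst p)))) * complex_of_real (indicator {-M..M} (snd p)))" for i p
  have G: "integrable ((\<mu> \<Otimes>\<^sub>M \<mu>) \<Otimes>\<^sub>M lborel) (\<lambda>(w, z). G i (w, z))" if "i < n" for i
  proof -
    have "integrable ((\<mu> \<Otimes>\<^sub>M \<mu>) \<Otimes>\<^sub>M lborel) (\<lambda>(w, z). k (w, z) * ((\<phi> i (fst w) * cnj (\<phi> i (snd w))) * complex_of_real (indicator {-M..M} z)))"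
    proof (rule PL.integrable_product_bounded)
      show "integrable (\<mu> \<Otimes>\<^sub>M \<mu>) (\<lambda>w. \<phi> i (fst w) * cnj (\<phi> i (snd w)))"
        using bb[OF that] by (intro bounded_borel_product_integrable)
      show "integrable lborel (\<lambda>z. complex_of_real (indicator {-M..M} z))"
        by (intro integrable_of_real integrable_real_indicator emeasure_bounded_finite) auto
      have eq: "sets ((\<mu> \<Otimes>\<^sub>M \<mu>) \<Otimes>\<^sub>M lborel) = sets ((borel \<Otimes>\<^sub>M borel) \<Otimes>\<^sub>M borel)"
        by (intro sets_pair_measure_cong sets_mu2) simp
      have "k \<in> borel_measurable ((borel \<Otimes>\<^sub>M borel) \<Otimes>\<^sub>M borel)"
        unfolding k_def[abs_def] s_def by measurable
      then show "k \<in> borel_measurable ((\<mu> \<Otimes>\<^sub>M \<mu>) \<Otimes>\<^sub>M lborel)"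
        by (simp only: measurable_cong_sets[OF eq refl])
      show "cmod (k p) \<le> 1" for p using J1[of "fst p"] by (simp add: k_def norm_mult s1 abs_mult del: of_real_mult)
    qed
    then show ?thesis by (simp add: G_def)
  qed
  have inner: "(LINT z|lborel. G i (w, z)) = complex_of_real (2 * M) * (complex_of_real (J w * cut_kernel M w) * (\<phi> i (fst w) * cnj (\<phi> i (snd w))))" for i w
  proof -
    have "(LINT z|lborel. G i (w, z)) = (LINT z|lborel. complex_of_real (J w) * (\<phi> i (fst w) * cnj (\<phi> i (snd w))) *
        complex_of_real (indicator {-M..M} z * (s z (fst w) * s z (snd w))))"
      by (intro Bochner_Integration.integral_cong) (auto simp: G_def k_def)
    also have "\<dots> = complex_of_real (J w) * (\<phi> i (fst w) * cnj (\<phi> i (snd w))) *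
        complex_of_real (LINT z|lborel. indicator {-M..M} z * (s z (fst w) * s z (snd w)))"
      by (simp only: integral_mult_right_zero integral_complex_of_real)
    also have "(LINT z|lborel. indicator {-M..M} z * (s z (fst w) * s z (snd w))) = 2 * M * cut_kernel M w"
      unfolding s_def cut_kernel_def by (rule integral_cut_product[OF M])
    finally show ?thesis by (simp add: mult_ac)
  qed
  have outer: "(LINT w|(\<mu> \<Otimes>\<^sub>M \<mu>). G i (w, z)) = complex_of_real (indicator {-M..M} z) * kernel_form J (\<psi> z i)" for i z
  proof -
    have "(LINT w|(\<mu> \<Otimes>\<^sub>M \<mu>). G i (w, z)) = (LINT w|(\<mu> \<Otimes>\<^sub>M \<mu>). complex_of_real (indicator {-M..M} z) *
        (complex_of_real (J w) * (\<psi> z i (fst w) * cnj (\<psi> z i (snd w)))))"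
      by (intro Bochner_Integration.integral_cong) (auto simp: G_def k_def \<psi>_def)
    also have "\<dots> = complex_of_real (indicator {-M..M} z) * kernel_form J (\<psi> z i)"
      unfolding kernel_form_def by (rule integral_mult_right_zero)
    finally show ?thesis .
  qed
  have Fub: "complex_of_real (2 * M) * kernel_form (\<lambda>z. J z * cut_kernel M z) (\<phi> i) =
      (LINT z|lborel. complex_of_real (indicator {-M..M} z) * kernel_form J (\<psi> z i))" if "i < n" for i
    using PL.Fubini_integral[OF G[OF that]] unfolding inner outer kernel_form_def by simp
  have int: "integrable lborel (\<lambda>z. complex_of_real (indicator {-M..M} z) * kernel_form J (\<psi> z i))" if "i < n" for i
    using PL.integrable_snd[OF G[OF that]] unfolding outer .
  have "2 * M * (\<Sum>i<n. Re (kernel_form (\<lambda>z. J z * cut_kernel M z) (\<phi> i))) =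
      (\<Sum>i<n. Re (LINT z|lborel. complex_of_real (indicator {-M..M} z) * kernel_form J (\<psi> z i)))"
    unfolding sum_distrib_left by (intro sum.cong refl) (simp flip: Fub)
  also have "\<dots> = (\<Sum>i<n. (LINT z|lborel. Re (complex_of_real (indicator {-M..M} z) * kernel_form J (\<psi> z i))))"
    by (intro sum.cong refl integral_Re[symmetric] int) simp
  also have "\<dots> = (LINT z|lborel. (\<Sum>i<n. Re (complex_of_real (indicator {-M..M} z) * kernel_form J (\<psi> z i))))"
    by (rule Bochner_Integration.integral_sum[symmetric]) (intro integrable_Re int, simp)
  also have "\<dots> \<le> (LINT z|lborel. b * indicator {-M..M} z)"
  proof (rule integral_mono)
    show "integrable lborel (\<lambda>z. \<Sum>i<n. Re (complex_of_real (indicator {-M..M} z) * kernel_form J (\<psi> z i)))"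
      by (intro Bochner_Integration.integrable_sum integrable_Re int) simp
    show "integrable lborel (\<lambda>z. b * indicator {-M..M} z)"
      by (intro integrable_mult_right integrable_real_indicator emeasure_bounded_finite) auto
    show "(\<Sum>i<n. Re (complex_of_real (indicator {-M..M} z) * kernel_form J (\<psi> z i))) \<le> b * indicator {-M..M} z" for z
      using b on[of z] by (auto simp: kernel_bound_def indicator_def)
  qed
  also have "\<dots> = 2 * M * b" using M by simp
  finally show "(\<Sum>i<n. Re (kernel_form (\<lambda>z. J z * cut_kernel M z) (\<phi> i))) \<le> b" using M by simp
qed

definition exp_kernel :: "real \<Rightarrow> real \<times> real \<Rightarrow> real" where
  "exp_kernel k z = exp (- k * \<bar>fst z - snd z\<bar>)"

lemma kernel_exp: "0 \<le> k \<Longrightarrow> kernel (exp_kernel k)"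
proof -
  assume "0 \<le> k"
  moreover have "exp_kernel k \<in> borel_measurable (borel \<Otimes>\<^sub>M borel)"
    unfolding exp_kernel_def[abs_def] by measurable
  ultimately show ?thesis by (simp add: kernel_def exp_kernel_def)
qed

text \<open>The exponential is the limit of
  \<open>(1 - \<delta> * \<bar>x - y\<bar> / N) ^ N\<close>, that is, of \<open>N\<close>-fold
  products of cut kernels with \<open>M = N / \<delta>\<close>, and each factor preserves the
  bound.\<close>

lemma kernel_bound_exp:
  assumes J: "kernel J" and \<delta>: "0 < \<delta>" and b: "kernel_bound J n b"
  shows "kernel_bound (\<lambda>z. J z * exp_kernel \<delta> z) n b"
proof -
  define T where "T N z = J z * cut_kernel (real N / \<delta>) z ^ N" for N z
  have T: "kernel (T N) \<and> kernel_bound (T N) n b" if N: "0 < N" for N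
  proof -
    have M: "0 < real N / \<delta>" using N \<delta> by simp
    have "kernel (\<lambda>z. J z * cut_kernel (real N / \<delta>) z ^ m) \<and> kernel_bound (\<lambda>z. J z * cut_kernel (real N / \<delta>) z ^ m) n b" for m
    proof (induction m)
      case 0
      then show ?case using J b by simp
    next
      case (Suc m)
      then show ?case
        using kernel_mult[OF _ kernel_cut[OF M]] kernel_bound_cut[OF _ M]
        by (simp only: power_Suc2 mult.assoc[symmetric])
    qed
    then show ?thesis by (simp add: T_def[abs_def])
  qed
  have lim: "(\<lambda>N. T N z) \<longlonglongrightarrow> J z * exp_kernel \<delta> z" for z
  proof -
    define r where "r = - \<delta> * \<bar>fst z - snd z\<bar>"
    \<comment> \<open>For \<open>N \<ge> m\<close> both coordinates of \<open>z\<close> lie in the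
      range of cut points, where clamping does nothing.\<close>
    obtain m :: nat where m: "\<delta> * (\<bar>fst z\<bar> + \<bar>snd z\<bar>) \<le> real m" using real_arch_simple by blast
    have "\<forall>\<^sub>F N in sequentially. (1 + r / real N) ^ N = cut_kernel (real N / \<delta>) z ^ N"
      using eventually_ge_at_top[of m]
    proof eventually_elim
      case (elim N)
      have "\<delta> * (\<bar>fst z\<bar> + \<bar>snd z\<bar>) \<le> real N" using m elim by linarith
      then have "\<bar>fst z\<bar> + \<bar>snd z\<bar> \<le> real N / \<delta>" using \<delta> by (simp add: field_simps)
      then have "max (- (real N / \<delta>)) (min (real N / \<delta>) (fst z)) = fst z"
        "max (- (real N / \<delta>)) (min (real N / \<delta>) (snd z)) = snd z" by (auto simp: max_def min_def)
      then have "cut_kernel (real N / \<delta>) z = 1 - \<bar>fst z - snd z\<bar> / (real N / \<delta>)" by (simp only: cut_kernel_def)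
      then show ?case by (simp add: r_def mult.commute)
    qed
    then have "(\<lambda>N. cut_kernel (real N / \<delta>) z ^ N) \<longlonglongrightarrow> exp r"
      by (rule Lim_transform_eventually[OF tendsto_exp_limit_sequentially])
    then show ?thesis unfolding T_def by (auto simp: exp_kernel_def r_def intro!: tendsto_mult)
  qed
  show ?thesis unfolding kernel_bound_def
  proof (intro allI impI)
    fix \<phi> assume \<phi>: "orthonormal n \<phi>"
    have bb: "\<phi> i \<in> bounded_borel" if "i < n" for i using \<phi> that by (simp add: orthonormal_def)
    \<comment> \<open>The shift to \<open>Suc N\<close> avoids \<open>N = 0\<close>, for which the
      cut range degenerates and \<open>T\<close> gives no bound.\<close>
    have conv: "(\<lambda>N. kernel_form (T (Suc N)) (\<phi> i)) \<longlonglongrightarrow> kernel_form (\<lambda>z. J z * exp_kernel \<delta> z) (\<phi> i)" if "i < n" for i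
      unfolding kernel_form_def
    proof (rule integral_dominated_convergence)
      show "integrable (\<mu> \<Otimes>\<^sub>M \<mu>) (\<lambda>z. cmod (\<phi> i (fst z) * cnj (\<phi> i (snd z))))"
        using bb[OF that] by (intro integrable_norm bounded_borel_product_integrable)
      show "(\<lambda>z. complex_of_real (T (Suc N) z) * (\<phi> i (fst z) * cnj (\<phi> i (snd z)))) \<in> borel_measurable (\<mu> \<Otimes>\<^sub>M \<mu>)" for N
        using T[of "Suc N"] bb[OF that] by (intro borel_measurable_integrable kernel_form_integrable) auto
      show "(\<lambda>z. complex_of_real (J z * exp_kernel \<delta> z) * (\<phi> i (fst z) * cnj (\<phi> i (snd z)))) \<in> borel_measurable (\<mu> \<Otimes>\<^sub>M \<mu>)"
        using kernel_mult[OF J kernel_exp[of \<delta>]] \<delta> bb[OF that]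
        by (intro borel_measurable_integrable kernel_form_integrable) auto
      show "AE z in \<mu> \<Otimes>\<^sub>M \<mu>. (\<lambda>N. complex_of_real (T (Suc N) z) * (\<phi> i (fst z) * cnj (\<phi> i (snd z))))
          \<longlonglongrightarrow> complex_of_real (J z * exp_kernel \<delta> z) * (\<phi> i (fst z) * cnj (\<phi> i (snd z)))"
        by (intro AE_I2 tendsto_mult_right tendsto_of_real LIMSEQ_Suc lim)
      show "AE z in \<mu> \<Otimes>\<^sub>M \<mu>. norm (complex_of_real (T (Suc N) z) * (\<phi> i (fst z) * cnj (\<phi> i (snd z))))
          \<le> cmod (\<phi> i (fst z) * cnj (\<phi> i (snd z)))" for N
        using T[of "Suc N"] by (intro AE_I2) (simp add: kernel_abs_le norm_mult mult_left_le_one_le)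
    qed
    have "(\<lambda>N. \<Sum>i<n. Re (kernel_form (T (Suc N)) (\<phi> i))) \<longlonglongrightarrow> (\<Sum>i<n. Re (kernel_form (\<lambda>z. J z * exp_kernel \<delta> z) (\<phi> i)))"
      by (intro tendsto_sum tendsto_Re conv) simp
    moreover have "(\<Sum>i<n. Re (kernel_form (T (Suc N)) (\<phi> i))) \<le> b" for N
      using T[of "Suc N"] \<phi> by (simp add: kernel_bound_def)
    ultimately show "(\<Sum>i<n. Re (kernel_form (\<lambda>z. J z * exp_kernel \<delta> z) (\<phi> i))) \<le> b"
      by (intro LIMSEQ_le_const2) auto
  qed
qed

text \<open>Exponentials multiply, so passing from \<open>k\<close> to \<open>k'\<close> is
  multiplication by \<open>exp_kernel (k' - k)\<close>.\<close>

lemma kernel_bound_mono: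
  assumes k: "0 \<le> k" "k \<le> k'" and b: "kernel_bound (exp_kernel k) n b"
  shows "kernel_bound (exp_kernel k') n b"
proof (cases "k = k'")
  case False
  have "exp_kernel k' = (\<lambda>z. exp_kernel k z * exp_kernel (k' - k) z)"
    by (simp add: fun_eq_iff exp_kernel_def algebra_simps flip: exp_add)
  then show ?thesis using kernel_bound_exp[OF kernel_exp[OF k(1)] _ b, of "k' - k"] False k by simp
qed (use b in simp)

end

section \<open>The Birman-Schwinger principle and the removal of one eigenvalue\<close>

context finite_form_bounded_measure
begin

lemma H1_bounded_borel: "f \<in> H1 \<Longrightarrow> f \<in> bounded_borel"
  using H1_bounded[of f] H1_L2[of f] by (simp add: bounded_borel_def L2_def)

text \<open>Inserting the factorization \<open>integral_kern_kern\<close> and exchanging the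
  integrals turns the form into the squared norm of \<open>A\<close>, the transposed one-sided
  kernel applied to \<open>f\<close> times \<open>\<mu>\<close>.\<close>

lemma kernel_form_exp:
  assumes k: "0 < k" and f: "f \<in> bounded_borel"
  defines "A \<equiv> \<lambda>z. LINT x|\<mu>. complex_of_real (kern k x z) * f x"
  shows "A \<in> L2" "complex_of_real (2 * k * L2.qf A) = kernel_form (exp_kernel k) f"
proof -
  have fm [measurable]: "f \<in> borel_measurable borel" using f by (simp add: bounded_borel_def)
  define F where "F p = complex_of_real (kern k (fst (fst p)) (snd p) * kern k (snd (fst p)) (snd p)) *
    (f (fst (fst p)) * cnj (f (snd (fst p))))" for p
  have kk: "integrable lborel (\<lambda>z. kern k x z * kern k y z)" for x y
  proof (rule Bochner_Integration.integrable_bound[OF has_integral_kern(1)[OF k, of x]])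
    show "AE z in lborel. norm (kern k x z * kern k y z) \<le> norm (kern k x z)"
      using k by (intro AE_I2) (simp add: kern_nonneg kern_le_1 mult_left_le abs_mult)
  qed measurable
  have eq: "sets ((\<mu> \<Otimes>\<^sub>M \<mu>) \<Otimes>\<^sub>M lborel) = sets ((borel \<Otimes>\<^sub>M borel) \<Otimes>\<^sub>M borel)"
    by (intro sets_pair_measure_cong sets_mu2) simp
  have Fm: "F \<in> borel_measurable ((\<mu> \<Otimes>\<^sub>M \<mu>) \<Otimes>\<^sub>M lborel)"
  proof -
    have "F \<in> borel_measurable ((borel \<Otimes>\<^sub>M borel) \<Otimes>\<^sub>M borel)"
      unfolding F_def[abs_def] kern_def by measurable
    then show ?thesis by (simp only: measurable_cong_sets[OF eq refl])
  qed
  have ff: "integrable (\<mu> \<Otimes>\<^sub>M \<mu>) (\<lambda>w. f (fst w) * cnj (f (snd w)))"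
    by (rule bounded_borel_product_integrable[OF f f])
  have inner: "(LINT z|lborel. F (w, z)) = complex_of_real (exp_kernel k w / (2 * k)) * (f (fst w) * cnj (f (snd w)))" for w
  proof -
    have "(LINT z|lborel. F (w, z)) = (LINT z|lborel. complex_of_real (kern k (fst w) z * kern k (snd w) z)) * (f (fst w) * cnj (f (snd w)))"
      unfolding F_def fst_conv snd_conv by (rule integral_mult_left_zero)
    then show ?thesis
      unfolding integral_complex_of_real integral_kern_kern[OF k] exp_kernel_def .
  qed
  have F: "integrable ((\<mu> \<Otimes>\<^sub>M \<mu>) \<Otimes>\<^sub>M lborel) (\<lambda>(w, z). F (w, z))"
  proof -
    have "integrable ((\<mu> \<Otimes>\<^sub>M \<mu>) \<Otimes>\<^sub>M lborel) F"
    proof (rule PL.Fubini_integrable[OF Fm])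
      have "(LINT z|lborel. norm (F (w, z))) = exp_kernel k w / (2 * k) * cmod (f (fst w) * cnj (f (snd w)))" for w
      proof -
        have "norm (F (w, z)) = kern k (fst w) z * kern k (snd w) z * cmod (f (fst w) * cnj (f (snd w)))" for z
          unfolding F_def norm_mult[of "complex_of_real _"] norm_of_real by (simp add: kern_nonneg)
        then show ?thesis unfolding exp_kernel_def by (simp add: integral_kern_kern[OF k])
      qed
      moreover have "integrable (\<mu> \<Otimes>\<^sub>M \<mu>) (\<lambda>w. exp_kernel k w / (2 * k) * cmod (f (fst w) * cnj (f (snd w))))"
      proof -
        have "integrable (\<mu> \<Otimes>\<^sub>M \<mu>) (\<lambda>w. cmod (complex_of_real (exp_kernel k w) * (f (fst w) * cnj (f (snd w)))) / (2 * k))"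
          using k by (intro integrable_divide integrable_norm kernel_form_integrable kernel_exp f) auto
        then show ?thesis by (simp add: norm_mult exp_kernel_def)
      qed
      ultimately show "integrable (\<mu> \<Otimes>\<^sub>M \<mu>) (\<lambda>w. LINT z|lborel. norm (F (w, z)))" by simp
      show "AE w in \<mu> \<Otimes>\<^sub>M \<mu>. integrable lborel (\<lambda>z. F (w, z))"
        unfolding F_def fst_conv snd_conv by (intro AE_I2 integrable_mult_left integrable_of_real kk)
    qed
    then show ?thesis by (simp add: case_prod_beta')
  qed
  have sq: "(LINT w|(\<mu> \<Otimes>\<^sub>M \<mu>). F (w, z)) = complex_of_real ((cmod (A z))\<^sup>2)" for z
  proof -
    define g where "g x = complex_of_real (kern k x z) * f x" for x
    have g: "g \<in> bounded_borel" unfolding g_def[abs_def]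
      by (rule bounded_borel_mult[OF f, of _ 1]) (use k in \<open>auto simp: kern_nonneg kern_le_1\<close>)
    have "(LINT w|(\<mu> \<Otimes>\<^sub>M \<mu>). F (w, z)) = (LINT w|(\<mu> \<Otimes>\<^sub>M \<mu>). g (fst w) * cnj (g (snd w)))"
      by (intro Bochner_Integration.integral_cong) (auto simp: F_def g_def)
    also have "\<dots> = (LINT x|\<mu>. LINT y|\<mu>. g x * cnj (g y))"
      using P.integral_fst'[OF bounded_borel_product_integrable[OF g g]] by simp
    also have "\<dots> = A z * cnj (A z)" by (simp add: A_def g_def[symmetric])
    finally show ?thesis by (simp only: complex_norm_square)
  qed
  have "integrable lborel (\<lambda>z. complex_of_real ((cmod (A z))\<^sup>2))"
    using PL.integrable_snd[OF F] unfolding sq .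
  from integrable_Re[OF this] have i: "integrable lborel (\<lambda>z. (cmod (A z))\<^sup>2)"
    unfolding Re_complex_of_real .
  have Am: "A \<in> borel_measurable borel"
  proof -
    have eq2: "sets (borel \<Otimes>\<^sub>M \<mu>) = sets (borel \<Otimes>\<^sub>M borel)" by (intro sets_pair_measure_cong sets_mu) simp
    have "(\<lambda>p. complex_of_real (kern k (snd p) (fst p)) * f (snd p)) \<in> borel_measurable (borel \<Otimes>\<^sub>M borel)"
      unfolding kern_def by measurable
    then have "(\<lambda>(z, x). complex_of_real (kern k x z) * f x) \<in> borel_measurable (borel \<Otimes>\<^sub>M \<mu>)"
      by (simp only: measurable_cong_sets[OF eq2 refl] case_prod_beta')
    then show ?thesis unfolding A_def by (rule borel_measurable_lebesgue_integral)
  qed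
  show "A \<in> L2" using i Am by (simp add: L2_def)
  have "complex_of_real (L2.qf A) = (LINT z|lborel. complex_of_real ((cmod (A z))\<^sup>2))"
    unfolding L2_qf by (rule integral_complex_of_real[symmetric])
  also have "\<dots> = (LINT w|(\<mu> \<Otimes>\<^sub>M \<mu>). LINT z|lborel. F (w, z))"
    using PL.Fubini_integral[OF F] unfolding sq by simp
  also have "\<dots> = (LINT w|(\<mu> \<Otimes>\<^sub>M \<mu>). complex_of_real (1 / (2 * k)) * (complex_of_real (exp_kernel k w) * (f (fst w) * cnj (f (snd w)))))"
    unfolding inner by (intro Bochner_Integration.integral_cong) auto
  also have "\<dots> = complex_of_real (1 / (2 * k)) * kernel_form (exp_kernel k) f"
    unfolding kernel_form_def by (rule integral_mult_right_zero)
  finally show "complex_of_real (2 * k * L2.qf A) = kernel_form (exp_kernel k) f" using k by simp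
qed

text \<open>The Birman-Schwinger principle: \<open>f\<close> is the integral of \<open>f' + k f\<close> against the exponential kernel,
  and the form of that kernel is a square, so that the estimate is an instance of the
  Cauchy-Schwarz inequality.\<close>

lemma Birman_Schwinger:
  assumes k: "0 < k" and f: "f \<in> H1" and neg: "fm.qf f \<le> - k\<^sup>2 * L2.qf f"
  shows "2 * k * mu.qf f \<le> Re (kernel_form (exp_kernel k) f)"
proof -
  define p where "p = (\<lambda>z. H1_deriv f z + complex_of_real k * f z)"
  have pL2: "p \<in> L2" unfolding p_def by (rule H1_symbol_L2[OF f k])
  have pm [measurable]: "p \<in> borel_measurable borel" using pL2 by (simp add: L2_def)
  have fb: "f \<in> bounded_borel" by (rule H1_bounded_borel[OF f])
  then obtain C where fm [measurable]: "f \<in> borel_measurable borel" and C: "\<And>x. cmod (f x) \<le> C"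
    by (auto simp: bounded_borel_def)
  define A where "A = (\<lambda>z. LINT x|\<mu>. complex_of_real (kern k x z) * f x)"
  note AL2 = kernel_form_exp(1)[OF k fb, folded A_def]
  note Aqf = kernel_form_exp(2)[OF k fb, folded A_def]
  define F where "F q = complex_of_real (kern k (fst q) (snd q)) * p (snd q) * cnj (f (fst q))" for q
  have eq: "sets (\<mu> \<Otimes>\<^sub>M lborel) = sets (borel \<Otimes>\<^sub>M borel)"
    by (intro sets_pair_measure_cong sets_mu) simp
  have Fm: "F \<in> borel_measurable (\<mu> \<Otimes>\<^sub>M lborel)"
  proof -
    have "F \<in> borel_measurable (borel \<Otimes>\<^sub>M borel)"
      unfolding F_def[abs_def] kern_def by measurable
    then show ?thesis by (simp only: measurable_cong_sets[OF eq refl])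
  qed
  have Fi: "integrable lborel (\<lambda>z. complex_of_real (kern k x z) * p z)" for x
    by (rule L2_mult_integrable[OF kern_L2(1)[OF k] pL2])
  have F: "integrable (\<mu> \<Otimes>\<^sub>M lborel) (\<lambda>(x, z). F (x, z))"
  proof -
    have "integrable (\<mu> \<Otimes>\<^sub>M lborel) F"
    proof (rule MZ.Fubini_integrable[OF Fm])
      have Fn: "norm (F (x, z)) = norm (complex_of_real (kern k x z) * p z) * cmod (f x)" for x z
        by (simp add: F_def norm_mult)
      \<comment> \<open>A bound of the inner integral that is uniform in \<open>x\<close>, from
        \<open>2 a b \<le> a\<^sup>2 + b\<^sup>2\<close>. As \<open>\<mu>\<close> is finite, it
        yields the integrability for Fubini.\<close>
      define D where "D = (1 / (4 * k) + L2.qf p / 2) * C"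
      have C0: "0 \<le> C" using order_trans[OF norm_ge_zero C] .
      have "(LINT z|lborel. norm (F (x, z))) \<le> D" for x
      proof -
        have "(LINT z|lborel. norm (complex_of_real (kern k x z) * p z)) \<le>
            (LINT z|lborel. 1/2 * kern (2 * k) x z + 1/2 * (cmod (p z))\<^sup>2)"
        proof (rule integral_mono)
          show "integrable lborel (\<lambda>z. norm (complex_of_real (kern k x z) * p z))" by (rule integrable_norm[OF Fi])
          show "integrable lborel (\<lambda>z. 1/2 * kern (2 * k) x z + 1/2 * (cmod (p z))\<^sup>2)"
            using has_integral_kern(1)[of "2 * k" x] k pL2 by (simp add: L2_def)
          show "norm (complex_of_real (kern k x z) * p z) \<le> 1/2 * kern (2 * k) x z + 1/2 * (cmod (p z))\<^sup>2" for z
            using sum_squares_bound[of "kern k x z" "cmod (p z)"]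
            by (simp add: norm_mult kern_nonneg kern_power2[symmetric])
        qed
        also have "\<dots> = 1 / (4 * k) + L2.qf p / 2"
          using has_integral_kern[of "2 * k" x] k pL2 by (simp add: L2_def L2_qf)
        finally have 1: "(LINT z|lborel. norm (complex_of_real (kern k x z) * p z)) \<le> 1 / (4 * k) + L2.qf p / 2" .
        have "(LINT z|lborel. norm (F (x, z))) = (LINT z|lborel. norm (complex_of_real (kern k x z) * p z)) * cmod (f x)"
          unfolding Fn by (rule integral_mult_left_zero)
        also have "\<dots> \<le> D" unfolding D_def
          using 1 C[of x] k by (intro mult_mono) (auto simp: L2_qf)
        finally show ?thesis .
      qed
      moreover have "(\<lambda>x. LINT z|lborel. norm (F (x, z))) \<in> borel_measurable \<mu>"
        using Fm by (intro sigma_finite_measure.borel_measurable_lebesgue_integral[OF sigma_finite_lborel]) (simp add: case_prod_beta')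
      ultimately show "integrable \<mu> (\<lambda>x. LINT z|lborel. norm (F (x, z)))"
        by (intro integrable_const_bound[where B=D] AE_I2) auto
      show "AE x in \<mu>. integrable lborel (\<lambda>z. F (x, z))"
        unfolding F_def fst_conv snd_conv by (intro AE_I2 integrable_mult_left Fi)
    qed
    then show ?thesis by (simp add: case_prod_beta')
  qed
  have inner: "(LINT z|lborel. F (x, z)) = f x * cnj (f x)" for x
  proof -
    have "(LINT z|lborel. F (x, z)) = (LINT z|lborel. complex_of_real (kern k x z) * p z) * cnj (f x)"
      unfolding F_def fst_conv snd_conv by (rule integral_mult_left_zero)
    then show ?thesis using H1_representation[OF f k, of x] by (simp add: p_def)
  qed
  have outer: "(LINT x|\<mu>. F (x, z)) = p z * cnj (A z)" for z
  proof -
    have "(LINT x|\<mu>. F (x, z)) = (LINT x|\<mu>. p z * cnj (complex_of_real (kern k x z) * f x))"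
      by (intro Bochner_Integration.integral_cong) (auto simp: F_def)
    also have "\<dots> = p z * cnj (A z)"
      unfolding A_def by (simp only: integral_mult_right_zero Bochner_Integration.integral_cnj)
    finally show ?thesis .
  qed
  have "complex_of_real (mu.qf f) = (LINT x|\<mu>. f x * cnj (f x))"
    using mu.form_self[OF H1_sq_integrable[OF f]] by simp
  also have "\<dots> = L2_inner p A"
    using MZ.Fubini_integral[OF F] unfolding inner outer L2_inner_def by simp
  finally have "(cmod (complex_of_real (mu.qf f)))\<^sup>2 \<le> L2.qf p * L2.qf A"
    using L2.Cauchy_Schwarz[OF pL2 AL2] by simp
  then have 1: "(mu.qf f)\<^sup>2 \<le> L2.qf p * L2.qf A" by simp
  \<comment> \<open>The hypothesis on the form says that the energy is at most
    \<open>mu.qf f\<close>. So one factor \<open>mu.qf f\<close> can be cancelled from the squared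
    inequality.\<close>
  have "L2.qf p = H1_energy k f" unfolding p_def by (rule H1_energy_eq[OF f])
  also have "\<dots> \<le> mu.qf f" using neg form_qf[of f] by (simp add: H1_energy_def)
  finally have "L2.qf p * L2.qf A \<le> mu.qf f * L2.qf A"
    using L2.qf_nonneg[OF AL2] by (intro mult_right_mono)
  with 1 have 2: "mu.qf f * mu.qf f \<le> mu.qf f * L2.qf A" by (simp add: power2_eq_square)
  have "mu.qf f \<le> L2.qf A"
  proof (cases "mu.qf f = 0")
    case True
    then show ?thesis using L2.qf_nonneg[OF AL2] by simp
  next
    case False
    then have "0 < mu.qf f" using mu.qf_nonneg[OF H1_sq_integrable[OF f]] by simp
    then show ?thesis using 2 by simp
  qed
  moreover have "Re (kernel_form (exp_kernel k) f) = 2 * k * L2.qf A" by (simp flip: Aqf)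
  ultimately show ?thesis using k by simp
qed

text \<open>The span of \<open>n + 1\<close> vectors contains one that is orthogonal in L2 of
  \<open>\<mu>\<close> to a given orthonormal family of length \<open>n\<close>. Adding it,
  normalized, gives a family obeying the bound \<open>b\<close>, to which the new member contributes
  at least \<open>2 * k\<close> by the Birman-Schwinger principle.\<close>

lemma kernel_bound_drop:
  assumes k: "0 < k" and J: "finite J" "card J = Suc n" and w: "\<And>j. j \<in> J \<Longrightarrow> w j \<in> H1"
    and neg: "\<And>c f. \<lbrakk>\<exists>j\<in>J. c j \<noteq> 0; f = (\<Sum>j\<in>J. (\<lambda>x. c j * w j x))\<rbrakk> \<Longrightarrow> 0 < L2.qf f \<and> fm.qf f \<le> - k\<^sup>2 * L2.qf f"
    and b: "kernel_bound (exp_kernel k) (Suc n) b"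
  shows "kernel_bound (exp_kernel k) n (b - 2 * k)"
  unfolding kernel_bound_def
proof (intro allI impI)
  fix \<phi> assume \<phi>: "orthonormal n \<phi>"
  have bb: "\<phi> i \<in> bounded_borel" if "i < n" for i using \<phi> that by (simp add: orthonormal_def)
  let ?B = "\<lambda>f g. LINT x|\<mu>. f x * cnj (g x)"
  have "card {..<n} < card J" using J by simp
  from underdetermined_system[OF finite_lessThan J(1) this, of "\<lambda>i j. ?B (w j) (\<phi> i)"] obtain c where
    c: "\<exists>j\<in>J. c j \<noteq> 0" "\<And>i. i < n \<Longrightarrow> (\<Sum>j\<in>J. ?B (w j) (\<phi> i) * c j) = 0" by auto
  define f where "f = (\<Sum>j\<in>J. (\<lambda>x. c j * w j x))"
  have fH: "f \<in> H1" unfolding f_def using w by (intro fm.V_sum fm.V_closed(3))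
  have f: "0 < L2.qf f" "fm.qf f \<le> - k\<^sup>2 * L2.qf f" using neg[OF c(1) f_def] by auto
  have orth: "?B f (\<phi> i) = 0" if i: "i < n" for i
  proof -
    have "?B f (\<phi> i) = (\<Sum>j\<in>J. ?B (\<lambda>x. c j * w j x) (\<phi> i))"
      unfolding f_def
      by (rule mu.sum_left[OF mu.V_closed(3)[OF H1_sq_integrable[OF w]] bounded_borel_sq_integrable[OF bb[OF i]]])
    also have "\<dots> = (\<Sum>j\<in>J. ?B (w j) (\<phi> i) * c j)"
      using mu.scale_left[OF H1_sq_integrable[OF w] bounded_borel_sq_integrable[OF bb[OF i]]]
      by (intro sum.cong) (auto simp: mult.commute)
    finally show ?thesis using c(2)[OF i] by simp
  qed
  \<comment> \<open>The vector is normalized with respect to \<open>\<mu>\<close>. Its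
    \<open>\<mu>\<close>-norm is positive, because the form can be negative only through the
    \<open>\<mu>\<close>-term.\<close>
  have "0 < k\<^sup>2 * L2.qf f" using k f(1) by simp
  then have pos: "0 < mu.qf f" using f(2) H1D_nonneg[OF fH] form_qf[of f] by linarith
  define r where "r = complex_of_real (1 / sqrt (mu.qf f))"
  define u where "u = (\<lambda>x. r * f x)"
  have r: "(cmod r)\<^sup>2 = 1 / mu.qf f" unfolding r_def norm_of_real using pos by (simp add: power_divide)
  have uH: "u \<in> H1" unfolding u_def by (rule fm.V_closed(3)[OF fH])
  have u1: "mu.qf u = 1" unfolding u_def mu.qf_scale[OF H1_sq_integrable[OF fH]] r using pos by simp
  have u2: "fm.qf u \<le> - k\<^sup>2 * L2.qf u"
    unfolding u_def fm.qf_scale[OF fH] L2.qf_scale[OF H1_L2[OF fH]] r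
    using mult_left_mono[OF f(2), of "1 / mu.qf f"] pos by simp
  have uB: "?B u (\<phi> i) = 0" "?B (\<phi> i) u = 0" if i: "i < n" for i
  proof -
    show 0: "?B u (\<phi> i) = 0"
      unfolding u_def using mu.scale_left[OF H1_sq_integrable[OF fH] bounded_borel_sq_integrable[OF bb[OF i]], of r]
      by (simp add: orth[OF i])
    show "?B (\<phi> i) u = 0"
      using mu.hermitian[OF H1_sq_integrable[OF uH] bounded_borel_sq_integrable[OF bb[OF i]]] 0 by simp
  qed
  define \<psi> where "\<psi> = \<phi>(n := u)"
  have "?B u u = 1" using mu.form_self[OF H1_sq_integrable[OF uH]] u1 by simp
  then have "orthonormal (Suc n) \<psi>"
    using \<phi> uB H1_bounded_borel[OF uH] by (auto simp: orthonormal_def \<psi>_def less_Suc_eq)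
  then have "(\<Sum>i<Suc n. Re (kernel_form (exp_kernel k) (\<psi> i))) \<le> b"
    using b by (simp add: kernel_bound_def)
  moreover have "(\<Sum>i<Suc n. Re (kernel_form (exp_kernel k) (\<psi> i))) =
      (\<Sum>i<n. Re (kernel_form (exp_kernel k) (\<phi> i))) + Re (kernel_form (exp_kernel k) u)"
    by (simp add: \<psi>_def)
  moreover have "2 * k \<le> Re (kernel_form (exp_kernel k) u)"
    using Birman_Schwinger[OF k uH u2] u1 by simp
  ultimately show "(\<Sum>i<n. Re (kernel_form (exp_kernel k) (\<phi> i))) \<le> b - 2 * k" by simp
qed

end

section \<open>Linear combinations of eigenvectors\<close>

context form_bounded_measure
begin

lemma eigenvectors_orthogonal:
  assumes f: "sol l f 0" and g: "sol l' g 0" and ne: "l \<noteq> l'"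
  shows "L2_inner f g = 0" "form \<mu> f g = 0"
proof -
  note fH = sol_D[OF f] and gH = sol_D[OF g]
  have 1: "form \<mu> f g = complex_of_real l * L2_inner f g"
    using sol_eq[OF f gH] H1_L2[OF gH] by (simp add: L2.zero_left)
  have "form \<mu> g f = complex_of_real l' * L2_inner g f"
    using sol_eq[OF g fH] H1_L2[OF fH] by (simp add: L2.zero_left)
  then have "form \<mu> f g = complex_of_real l' * L2_inner f g"
    using fm.hermitian[OF gH fH] L2.hermitian[OF H1_L2[OF gH] H1_L2[OF fH]] by simp
  with 1 ne show "L2_inner f g = 0" by auto
  with 1 show "form \<mu> f g = 0" by simp
qed

lemma eigenvector_qf: "sol l f 0 \<Longrightarrow> fm.qf f = l * L2.qf f"
  using sol_eq[of l f 0 f] sol_D[of l f 0] H1_L2[of f] by (simp add: fm.qf_def L2.qf_def L2.zero_left)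

text \<open>A basis of an eigenspace need not be orthogonal, so the combination is grouped by
  eigenvalues; the groups are mutually orthogonal for the inner product and for the form. Pairs of
  an eigenvalue and a basis vector keep track of multiplicities.\<close>

lemma eigenvector_combination:
  assumes \<Lambda>: "finite \<Lambda>" and Bs: "\<And>l. l \<in> \<Lambda> \<Longrightarrow> finite (Bs l)"
    "\<And>l e. \<lbrakk>l \<in> \<Lambda>; e \<in> Bs l\<rbrakk> \<Longrightarrow> sol l e 0" "\<And>l. l \<in> \<Lambda> \<Longrightarrow> cfun.independent (Bs l)"
    and E: "E \<subseteq> Sigma \<Lambda> Bs" and top: "\<And>p. p \<in> E \<Longrightarrow> fst p \<le> t"
    and c: "\<exists>p\<in>E. c p \<noteq> 0" and f: "f = (\<Sum>p\<in>E. (\<lambda>x. c p * snd p x))"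
  shows "0 < L2.qf f \<and> fm.qf f \<le> t * L2.qf f"
proof -
  have finS: "finite (Sigma \<Lambda> Bs)" using \<Lambda> Bs(1) by auto
  \<comment> \<open>Extension by 0 permits summation over whole bases, although \<open>E\<close> may
    contain only part of a basis.\<close>
  define c' where "c' p = (if p \<in> E then c p else 0)" for p
  define g where "g l = (\<Sum>e\<in>Bs l. (\<lambda>x. c' (l, e) * e x))" for l
  define \<Lambda>' where "\<Lambda>' = {l \<in> \<Lambda>. l \<le> t}"
  have g0: "g l = 0" if "l \<in> \<Lambda> - \<Lambda>'" for l
  proof -
    have "c' (l, e) = 0" for e using that top[of "(l, e)"] by (auto simp: c'_def \<Lambda>'_def)
    then show ?thesis by (simp add: g_def fun_eq_iff sum.neutral zero_fun_def)
  qed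
  have "f = (\<Sum>p\<in>Sigma \<Lambda> Bs. (\<lambda>x. c' p * snd p x))"
    unfolding f by (rule sum.mono_neutral_cong_left[OF finS E]) (auto simp: c'_def zero_fun_def)
  also have "\<dots> = (\<Sum>l\<in>\<Lambda>. g l)"
    unfolding g_def by (subst sum.Sigma[OF \<Lambda>]) (use Bs(1) in \<open>auto intro!: sum.cong\<close>)
  also have "\<dots> = (\<Sum>l\<in>\<Lambda>'. g l)"
    by (rule sum.mono_neutral_right[OF \<Lambda>]) (use g0 in \<open>auto simp: \<Lambda>'_def\<close>)
  finally have fg: "f = (\<Sum>l\<in>\<Lambda>'. (\<lambda>x. 1 * g l x))" by simp
  have \<Lambda>': "finite \<Lambda>'" "\<And>l. l \<in> \<Lambda>' \<Longrightarrow> l \<in> \<Lambda>" "\<And>l. l \<in> \<Lambda>' \<Longrightarrow> l \<le> t" using \<Lambda> by (auto simp: \<Lambda>'_def)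
  have gs: "sol l (g l) 0" if "l \<in> \<Lambda>" for l
  proof -
    have "g l \<in> eigenspace (H_op \<mu>) (complex_of_real l)" unfolding g_def
      by (intro cfun.subspace_sum[OF subspace_eigenspace] cfun.subspace_scale[OF subspace_eigenspace])
         (simp add: eigenspace_iff Bs(2)[OF that])
    then show ?thesis by (simp add: eigenspace_iff)
  qed
  have gH: "g l \<in> H1" if "l \<in> \<Lambda>" for l using sol_D[OF gs[OF that]] .
  have L: "L2.qf f = (\<Sum>l\<in>\<Lambda>'. L2.qf (g l))"
    unfolding fg using L2.qf_orthogonal_sum[OF \<Lambda>'(1), of g "\<lambda>_. 1"] eigenvectors_orthogonal(1)[OF gs gs] gH H1_L2 \<Lambda>'(2) by simp
  have M: "fm.qf f = (\<Sum>l\<in>\<Lambda>'. l * L2.qf (g l))"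
    unfolding fg using fm.qf_orthogonal_sum[OF \<Lambda>'(1), of g "\<lambda>_. 1"] eigenvectors_orthogonal(2)[OF gs gs] gH \<Lambda>'(2)
    by (simp add: eigenvector_qf[OF gs])
  have nn: "0 \<le> L2.qf (g l)" if "l \<in> \<Lambda>" for l by (rule L2.qf_nonneg[OF H1_L2[OF gH[OF that]]])
  obtain l e where le: "(l, e) \<in> E" "c (l, e) \<noteq> 0" using c by auto
  have l: "l \<in> \<Lambda>" "l \<in> \<Lambda>'" "e \<in> Bs l" using le E top[OF le(1)] by (auto simp: \<Lambda>'_def)
  \<comment> \<open>Independence of the basis turns one nonzero coefficient into a nonzero group,
    which makes the norm of \<open>f\<close> positive.\<close>
  have "g l \<noteq> 0"
  proof
    assume "g l = 0"
    then have "c' (l, e) = 0"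
      using cfun.independentD[OF Bs(3)[OF l(1)] Bs(1)[OF l(1)] order_refl, of "\<lambda>e. c' (l, e)" e] l(3)
      by (simp add: g_def)
    then show False using le by (simp add: c'_def)
  qed
  then have "L2.qf (g l) \<noteq> 0"
    using AE_zero_H1[OF gH[OF l(1)]] L2.form_self[OF H1_L2[OF gH[OF l(1)]]] by auto
  then have "0 < L2.qf (g l)" using nn[OF l(1)] by simp
  then have "0 < L2.qf f" unfolding L using \<Lambda>' l(2) nn by (intro sum_pos2[of _ l]) auto
  moreover have "fm.qf f \<le> t * L2.qf f" unfolding L M sum_distrib_left
    using \<Lambda>' nn by (intro sum_mono mult_right_mono) auto
  ultimately show ?thesis by simp
qed

end

section \<open>Summation of the square roots\<close>

context finite_form_bounded_measure
begin

text \<open>Induction over the pairs \<open>E\<close> still present, with \<open>k\<close> the level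
  reached so far. For the pair nearest to zero, at level \<open>k0\<close>, all combinations of
  \<open>E\<close> obey the form bound with \<open>k0\<close>, and the pairs left after its removal
  still have eigenvalues at most \<open>- k0\<^sup>2\<close>.\<close>

lemma sum_sqrt_kernel_bound:
  assumes \<Lambda>: "finite \<Lambda>" "\<And>l. l \<in> \<Lambda> \<Longrightarrow> l < 0" and Bs: "\<And>l. l \<in> \<Lambda> \<Longrightarrow> finite (Bs l)"
    "\<And>l e. \<lbrakk>l \<in> \<Lambda>; e \<in> Bs l\<rbrakk> \<Longrightarrow> sol l e 0" "\<And>l. l \<in> \<Lambda> \<Longrightarrow> cfun.independent (Bs l)"
    and E: "E \<subseteq> Sigma \<Lambda> Bs" "card E = n" and k: "0 \<le> k" "\<And>p. p \<in> E \<Longrightarrow> fst p \<le> - k\<^sup>2"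
    and b: "kernel_bound (exp_kernel k) n b"
  shows "2 * (\<Sum>p\<in>E. sqrt \<bar>fst p\<bar>) \<le> b"
  using E k b
proof (induction n arbitrary: E k b)
  case 0
  have "finite E" using 0(1) \<Lambda>(1) Bs(1) by (meson finite_SigmaI finite_subset)
  then have "E = {}" using 0(2) by simp
  \<comment> \<open>For \<open>n = 0\<close> the kernel bound is a statement about the empty
    sum.\<close>
  moreover have "0 \<le> b" using 0(5) by (auto simp: kernel_bound_def orthonormal_def)
  ultimately show ?case by simp
next
  case (Suc n)
  have finE: "finite E" using Suc.prems(1) \<Lambda>(1) Bs(1) by (meson finite_SigmaI finite_subset)
  have "E \<noteq> {}" using Suc.prems(2) by auto
  then have "Max (fst ` E) \<in> fst ` E" using finE by (intro Max_in) auto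
  then obtain p0 where p0E: "Max (fst ` E) = fst p0" "p0 \<in> E" by (rule imageE)
  have p0: "p0 \<in> E" "\<And>p. p \<in> E \<Longrightarrow> fst p \<le> fst p0"
    using p0E(2) Max_ge[OF finite_imageI[OF finE], of _ fst] by (auto simp: p0E(1))
  have neg: "fst p0 < 0" using p0(1) Suc.prems(1) \<Lambda>(2) by auto
  define k0 where "k0 = sqrt \<bar>fst p0\<bar>"
  have k0: "0 < k0" "k0\<^sup>2 = - fst p0" using neg by (auto simp: k0_def)
  have "k\<^sup>2 \<le> k0\<^sup>2" using Suc.prems(4)[OF p0(1)] k0(2) by simp
  from power2_le_imp_le[OF this less_imp_le[OF k0(1)]] have kk0: "k \<le> k0" .
  have b0: "kernel_bound (exp_kernel k0) (Suc n) b" by (rule kernel_bound_mono[OF Suc.prems(3) kk0 Suc.prems(5)])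
  have "kernel_bound (exp_kernel k0) n (b - 2 * k0)"
  proof (rule kernel_bound_drop[OF k0(1) finE Suc.prems(2) _ _ b0])
    show "snd p \<in> H1" if "p \<in> E" for p
      using that Suc.prems(1) Bs(2) sol_D by fastforce
    fix c f assume "\<exists>p\<in>E. c p \<noteq> 0" "f = (\<Sum>p\<in>E. (\<lambda>x. c p * snd p x))"
    from eigenvector_combination[OF \<Lambda>(1) Bs Suc.prems(1) p0(2) this]
    show "0 < L2.qf f \<and> fm.qf f \<le> - k0\<^sup>2 * L2.qf f" by (simp add: k0(2))
  qed
  then have "2 * (\<Sum>p\<in>E - {p0}. sqrt \<bar>fst p\<bar>) \<le> b - 2 * k0"
    using Suc.prems(1,2) p0 k0 by (intro Suc.IH[of _ k0]) auto
  moreover have "(\<Sum>p\<in>E. sqrt \<bar>fst p\<bar>) = k0 + (\<Sum>p\<in>E - {p0}. sqrt \<bar>fst p\<bar>)"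
    using sum.remove[OF finE p0(1)] by (simp add: k0_def)
  ultimately show ?case by simp
qed

lemma sum_sqrt_upper_bound:
  assumes disc: "negative_spectrum_discrete (H_op \<mu>)"
  shows "sum_sqrt_negative_eigenvalues (H_op \<mu>) \<le> ennreal (1 / 2) * emeasure \<mu> UNIV"
proof -
  have sp: "space \<mu> = UNIV" using sets_eq_imp_space_eq[OF sets_mu] by simp
  have "(\<Sum>l\<in>F. of_nat (multiplicity (H_op \<mu>) (complex_of_real l)) * ennreal (\<bar>l\<bar> powr (1/2))) \<le>
      ennreal (1 / 2) * emeasure \<mu> UNIV"
    if F: "finite F" "F \<subseteq> negative_eigenvalues (H_op \<mu>)" for F
  proof -
    have "\<forall>l\<in>F. \<exists>B. finite B \<and> (\<forall>e\<in>B. sol l e 0) \<and> card B = multiplicity (H_op \<mu>) (complex_of_real l) \<and> cfun.independent B"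
      using F(2) eigenspace_basis[OF disc] by (metis subsetD)
    from bchoice[OF this] obtain Bs where Bs: "\<forall>l\<in>F. finite (Bs l) \<and> (\<forall>e\<in>Bs l. sol l e 0) \<and>
      card (Bs l) = multiplicity (H_op \<mu>) (complex_of_real l) \<and> cfun.independent (Bs l)" ..
    have F0: "l < 0" if "l \<in> F" for l using that F(2) by (auto simp: negative_eigenvalues_def)
    have one: "exp_kernel 0 = (\<lambda>_. 1)" by (simp add: fun_eq_iff exp_kernel_def)
    \<comment> \<open>The start is \<open>k = 0\<close>, where the kernel is constantly 1 and the
      bound is the total mass whatever the number of eigenvectors.\<close>
    have "2 * (\<Sum>p\<in>Sigma F Bs. sqrt \<bar>fst p\<bar>) \<le> measure \<mu> UNIV"
      by (rule sum_sqrt_kernel_bound[OF F(1) F0, of Bs _ _ 0])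
         (use Bs F0 kernel_bound_one in \<open>auto simp: one intro: less_imp_le\<close>)
    moreover have "(\<Sum>p\<in>Sigma F Bs. sqrt \<bar>fst p\<bar>) = (\<Sum>l\<in>F. real (multiplicity (H_op \<mu>) (complex_of_real l)) * sqrt \<bar>l\<bar>)"
    proof -
      have "(\<Sum>p\<in>Sigma F Bs. sqrt \<bar>fst p\<bar>) = (\<Sum>l\<in>F. \<Sum>e\<in>Bs l. sqrt \<bar>l\<bar>)"
        using Bs by (subst sum.Sigma[OF F(1)]) (auto intro!: sum.cong)
      then show ?thesis using Bs by simp
    qed
    ultimately have "(\<Sum>l\<in>F. real (multiplicity (H_op \<mu>) (complex_of_real l)) * sqrt \<bar>l\<bar>) \<le> 1 / 2 * measure \<mu> UNIV" by simp
    then have "ennreal (\<Sum>l\<in>F. real (multiplicity (H_op \<mu>) (complex_of_real l)) * sqrt \<bar>l\<bar>) \<le> ennreal (1 / 2) * ennreal (measure \<mu> UNIV)"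
      by (subst ennreal_mult[symmetric]) (auto intro: ennreal_leI)
    then show ?thesis
      by (simp add: sum_ennreal[symmetric] ennreal_mult powr_half_sqrt ennreal_of_nat_eq_real_of_nat emeasure_eq_measure)
  qed
  then show ?thesis unfolding sum_sqrt_negative_eigenvalues_def
    by (subst nonneg_infsum_complete) (auto intro!: SUP_least)
qed

end

theorem theorem4p15:
  fixes \<mu> :: "real measure" and \<alpha> :: real
  defines "\<alpha> \<equiv> inverse (pi\<^sup>2 + 3/4)"
  assumes "radon_measure \<mu>"
    and "brinck \<mu>"
    and "negative_spectrum_discrete (H_op \<mu>)"
  shows "(emeasure \<mu> UNIV = \<infinity> \<longleftrightarrow> sum_sqrt_negative_eigenvalues (H_op \<mu>) = \<infinity>) \<and>
         ennreal (\<alpha> / 32) * emeasure \<mu> UNIV \<le> sum_sqrt_negative_eigenvalues (H_op \<mu>) \<and>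
         sum_sqrt_negative_eigenvalues (H_op \<mu>) \<le> ennreal (1 / 2) * emeasure \<mu> UNIV"
proof -
  let ?T = "sum_sqrt_negative_eigenvalues (H_op \<mu>)"
  have sets: "sets \<mu> = sets borel" and cpt: "\<And>K. compact K \<Longrightarrow> emeasure \<mu> K < \<infinity>"
    using assms(2) by (auto simp: radon_measure_def)
  have sp: "space \<mu> = UNIV" using sets_eq_imp_space_eq[OF sets] by simp
  obtain C where C: "0 < C" "\<And>x. emeasure \<mu> {x..x+1} \<le> ennreal C"
    using assms(3) by (auto simp: brinck_def intro: less_imp_le)
  have fin: "emeasure \<mu> {a..<b} < \<infinity>" for a b
    by (rule order_le_less_trans[OF emeasure_mono cpt[OF compact_Icc[of a b]]]) (auto simp: sets)
  have sf: "sigma_finite_measure \<mu>"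
  proof
    show "\<exists>A. countable A \<and> A \<subseteq> sets \<mu> \<and> \<Union> A = space \<mu> \<and> (\<forall>a\<in>A. emeasure \<mu> a \<noteq> \<infinity>)"
    proof (intro exI[of _ "range (\<lambda>n::nat. {- real n..real n})"] conjI)
      show "\<Union> (range (\<lambda>n::nat. {- real n..real n})) = space \<mu>"
      proof -
        have "\<exists>n::nat. - real n \<le> x \<and> x \<le> real n" for x
        proof -
          obtain n :: nat where "\<bar>x\<bar> \<le> real n" using real_arch_simple by blast
          then have "- real n \<le> x \<and> x \<le> real n" by linarith
          then show ?thesis ..
        qed
        then show ?thesis by (auto simp: sp)
      qed
    qed (use cpt in \<open>auto simp: sets less_top[symmetric]\<close>)
  qed
  \<comment> \<open>This choice makes the factor \<open>2 * C / k\<close> at most 1/2 while keeping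
    \<open>k\<close> at least 1, as \<open>form_bound\<close> requires.\<close>
  define k where "k = max 1 (4 * C)"
  have k: "1 \<le> k" "2 * C / k \<le> 1 / 2" using C(1) by (auto simp: k_def max_def field_simps)
  interpret form_bounded_measure \<mu> "k\<^sup>2 / 2"
  proof
    show "sets \<mu> = sets borel" by (rule sets)
    show "integrable \<mu> (\<lambda>x. (cmod (f x))\<^sup>2)" if "f \<in> H1" for f by (rule form_bound(1)[OF sets sf C k(1) that])
    show "(LINT x|\<mu>. (cmod (f x))\<^sup>2) \<le> 1 / 2 * H1D.qf f + k\<^sup>2 / 2 * L2.qf f" if f: "f \<in> H1" for f
    proof -
      have "(LINT x|\<mu>. (cmod (f x))\<^sup>2) \<le> 2 * C / k * H1_energy k f" by (rule form_bound(2)[OF sets sf C k(1) f])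
      also have "\<dots> \<le> 1 / 2 * H1_energy k f"
        using H1D_nonneg[OF f] L2.qf_nonneg[OF H1_L2[OF f]] by (intro mult_right_mono k(2)) (simp add: H1_energy_def)
      finally show ?thesis by (simp add: H1_energy_def field_simps)
    qed
  qed simp
  have upper: "?T \<le> ennreal (1 / 2) * emeasure \<mu> UNIV"
  proof (cases "emeasure \<mu> UNIV = \<infinity>")
    case True
    then show ?thesis by (simp add: ennreal_mult_top)
  next
    case False
    then have "finite_measure \<mu>" by (intro finite_measureI) (simp add: sp)
    then interpret finite_form_bounded_measure \<mu> "k\<^sup>2 / 2"
      by (intro finite_form_bounded_measure.intro form_bounded_measure_axioms)
    show ?thesis by (rule sum_sqrt_upper_bound[OF assms(4)])
  qed
  have lower: "ennreal (\<alpha> / 32) * emeasure \<mu> UNIV \<le> ?T"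
  proof -
    \<comment> \<open>This crude estimate already gives \<open>\<alpha> \<le> 1/3\<close>, hence
      \<open>\<alpha> / 32 \<le> 1 / 96\<close>, the reciprocal of the constant in
      \<open>total_mass_bound\<close>.\<close>
    have "3 \<le> pi\<^sup>2" using pi_gt3 power_mono[of 3 pi 2] by simp
    then have \<alpha>: "\<alpha> / 32 \<le> 1 / 96" "0 < \<alpha> / 32" by (auto simp: \<alpha>_def field_simps intro!: add_pos_pos)
    have "ennreal (\<alpha> / 32) * emeasure \<mu> UNIV \<le> ennreal (1 / 96) * emeasure \<mu> UNIV"
      using \<alpha> by (intro mult_right_mono ennreal_leI) auto
    also have "\<dots> \<le> ennreal (1 / 96) * (96 * ?T)"
      by (intro mult_left_mono total_mass_bound[OF assms(4) C fin]) auto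
    also have "\<dots> = ennreal (1 / 96) * ennreal 96 * ?T" by (simp add: mult.assoc)
    also have "ennreal (1 / 96) * ennreal 96 = 1" by (subst ennreal_mult[symmetric]) auto
    finally show ?thesis by simp
  qed
  have "?T = \<infinity>" if "emeasure \<mu> UNIV = \<infinity>"
  proof -
    have "0 < \<alpha> / 32" by (auto simp: \<alpha>_def intro!: add_pos_pos)
    then show ?thesis using lower that by (simp add: ennreal_mult_top top_unique)
  qed
  moreover have "emeasure \<mu> UNIV = \<infinity>" if "?T = \<infinity>"
  proof (rule ccontr)
    assume "emeasure \<mu> UNIV \<noteq> \<infinity>"
    then obtain r where r: "0 \<le> r" "emeasure \<mu> UNIV = ennreal r" by (cases "emeasure \<mu> UNIV") auto
    have "?T \<le> ennreal (1 / 2 * r)" using upper r by (simp only: r(2) ennreal_mult)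
    with that show False by (simp add: top_unique)
  qed
  ultimately show ?thesis using upper lower by blast
qed

end
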